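(* Let $X\subset\mathbb{P}(T_{\mathbf v})$ be an embedded smooth projective toric variety over $\mathbb{C}$ and let $r$ be a positive integer. There exists a Zariski open dense subset $W_{sat}\subseteq\sigma_r(X)$ such that, if $[F]\in W_{sat}$, then $\underline{\mathrm{VSP}}(F,r)$ contains a $B$-saturated ideal. There exists a Zariski open dense subset $W_{rad}\subseteq\sigma_r(X)$ such that, if $[F]\in W_{rad}$, then $\underline{\mathrm{VSP}}(F,r)$ contains a radical ideal.
   Context: $X$ is a smooth projective toric variety over $\mathbb{C}$ with Cox ring $S=\mathbb{C}[y_0,\dots,y_n]$, graded by $\mathrm{Pic}(X)\cong\mathbb{Z}^s$, with irrelevant ideal $B$. The graded dual ring is $T=\bigoplus_{D\in \mathrm{Pic}(X)}H^0(\mathcal O_X(D))^*\cong \mathbb{C}[x_0,\dots,x_n]$, on which $S$ acts by differentiation ($y_i\circ x_j=\delta_{ij}$). $\mathbf v$ is the class of a fixed ample line bundle, giving the embedding $X\subset\mathbb{P}(T_{\mathbf v})$; $\sigma_r(X)\subseteq\mathbb{P}(T_{\mathbf v})$ is the $r$-th secant variety (closure of the union of linear spans of $r$ points of $X$). $\mathrm{Ann}(F)=\{\psi\in S:\psi\circ F=0\}$. A homogeneous ideal $I\subset S$ is $B$-saturated if $I=(I:B^\infty)$. $h_{r,X}(\mathbf u)=\min\{r,\dim_{\mathbb C}S_{\mathbf u}\}$. $\mathrm{Hilb}^{h_{r,X}}_S$ is the Haiman–Sturmfels multigraded Hilbert scheme of homogeneous ideals $I\subset S$ with $\dim_{\mathbb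 C}(S/I)_{\mathbf u}=h_{r,X}(\mathbf u)$ for all $\mathbf u$; $\mathrm{Slip}_{r,X}$ is its irreducible component which is the closure of the locus of $B$-saturated ideals of $r$ distinct points of $X$ with Hilbert function $h_{r,X}$. $\underline{\mathrm{VSP}}(F,r)=\{J\in \mathrm{Slip}_{r,X}: J\subset \mathrm{Ann}(F)\}$. *)

theory Defs
  imports
    "HOL-Analysis.Analysis"
    "HOL-Library.Poly_Mapping"
    "Jordan_Normal_Form.Determinant"
begin

section \<open>Complex polynomials in variables indexed by an arbitrary type\<close>

type_synonym 'x cpoly = "('x \<Rightarrow>\<^sub>0 nat) \<Rightarrow>\<^sub>0 complex"

definition peval :: "'x cpoly \<Rightarrow> ('x \<Rightarrow> complex) \<Rightarrow> complex" where
  "peval f z = (\<Sum>a\<in>Poly_Mapping.keys f. Poly_Mapping.lookup f a *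
     (\<Prod>i\<in>Poly_Mapping.keys a. z i ^ Poly_Mapping.lookup a i))"

definition cscale :: "complex \<Rightarrow> 'x cpoly \<Rightarrow> 'x cpoly" where
  "cscale c f = Poly_Mapping.single 0 c * f"

interpretation cp: vector_space "cscale :: complex \<Rightarrow> 'x cpoly \<Rightarrow> 'x cpoly"
  by unfold_locales
    (simp_all add: cscale_def algebra_simps single_add mult_single flip: mult.assoc)

interpretation ideal: Modules.module "(*) :: 'x cpoly \<Rightarrow> 'x cpoly \<Rightarrow> 'x cpoly"
  by unfold_locales (simp_all add: algebra_simps)

text \<open>Ideals are the \<open>ideal.subspace\<close> sets; \<open>ideal.span G\<close> is the ideal generated by \<open>G\<close>.\<close>

definition radical_ideal :: "'x cpoly set \<Rightarrow> bool" where
  "radical_ideal I \<longleftrightarrow> ideal.subspace I \<and> (\<forall>f k. f ^ k \<in> I \<longrightarrow> f \<in> I)"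

primrec ideal_power :: "'x cpoly set \<Rightarrow> nat \<Rightarrow> 'x cpoly set" where
  "ideal_power B 0 = UNIV"
| "ideal_power B (Suc k) = ideal.span {f * g |f g. f \<in> B \<and> g \<in> ideal_power B k}"

definition saturation :: "'x cpoly set \<Rightarrow> 'x cpoly set \<Rightarrow> 'x cpoly set" where
  "saturation I B = {f. \<exists>k. \<forall>g\<in>ideal_power B k. f * g \<in> I}"


section \<open>Fans in \<open>N = \<int>\<^sup>d\<close>\<close>

definition lattice_vec :: "int^'d \<Rightarrow> real^'d" where
  "lattice_vec m = (\<chi> j. of_int (vec_nth m j))"

definition dual_pairing :: "int^'d \<Rightarrow> int^'d \<Rightarrow> int" where
  "dual_pairing m w = (\<Sum>j\<in>UNIV. vec_nth m j * vec_nth w j)"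

text \<open>The face relation of the library also admits the empty set as a face, and on cones its
  nonempty faces are the usual ones.\<close>

definition is_fan :: "(real^'d) set set \<Rightarrow> bool" where
  "is_fan \<Delta> \<longleftrightarrow> finite \<Delta> \<and> \<Delta> \<noteq> {} \<and>
     (\<forall>\<sigma>\<in>\<Delta>. \<exists>G. finite G \<and> \<sigma> = convex_cone hull (lattice_vec ` G)) \<and>
     (\<forall>\<sigma>\<in>\<Delta>. \<sigma> \<inter> uminus ` \<sigma> = {0}) \<and>
     (\<forall>\<sigma>\<in>\<Delta>. \<forall>\<tau>. \<tau> face_of \<sigma> \<and> \<tau> \<noteq> {} \<longrightarrow> \<tau> \<in> \<Delta>) \<and>
     (\<forall>\<sigma>\<in>\<Delta>. \<forall>\<tau>\<in>\<Delta>. (\<sigma> \<inter> \<tau>) face_of \<sigma> \<and> (\<sigma> \<inter> \<tau>) face_of \<tau>)"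

definition complete_fan :: "(real^'d) set set \<Rightarrow> bool" where
  "complete_fan \<Delta> \<longleftrightarrow> \<Union>\<Delta> = UNIV"

definition lattice_basis :: "('d \<Rightarrow> int^'d) \<Rightarrow> bool" where
  "lattice_basis e \<longleftrightarrow> (\<forall>x. \<exists>!c. x = (\<Sum>j\<in>UNIV. c j *s e j))"

definition smooth_fan :: "(real^'d) set set \<Rightarrow> bool" where
  "smooth_fan \<Delta> \<longleftrightarrow>
     (\<forall>\<sigma>\<in>\<Delta>. \<exists>e A. lattice_basis e \<and> \<sigma> = convex_cone hull (lattice_vec ` e ` A))"

text \<open>\<open>u\<close> enumerates, by the index type of the Cox variables and without repetition, the primitive
  generators of the rays of \<open>\<Delta>\<close>.\<close>

definition ray_generators :: "(real^'d) set set \<Rightarrow> ('n \<Rightarrow> int^'d) \<Rightarrow> bool" where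
  "ray_generators \<Delta> u \<longleftrightarrow>
     (\<forall>i. Gcd (range (vec_nth (u i))) = 1) \<and>
     bij_betw (\<lambda>i. convex_cone hull {lattice_vec (u i)}) UNIV {\<sigma> \<in> \<Delta>. aff_dim \<sigma> = 1}"


section \<open>Picard group and Cox ring\<close>

text \<open>\<open>D :: 'n \<Rightarrow> int\<close> is the torus invariant divisor \<open>\<Sum>\<^sub>i D i D\<^sub>i\<close>. A class is the coset of \<open>D\<close> modulo
  the divisors \<open>div(\<chi>\<^sup>m)\<close> of characters; for a smooth fan the class group is the Picard group.\<close>

definition div_class :: "('n \<Rightarrow> int^'d) \<Rightarrow> ('n \<Rightarrow> int) \<Rightarrow> ('n \<Rightarrow> int) set" where
  "div_class u D = {D'. \<exists>m. \<forall>i. D' i = D i + dual_pairing m (u i)}"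

definition Pic :: "('n \<Rightarrow> int^'d) \<Rightarrow> ('n \<Rightarrow> int) set set" where
  "Pic u = range (div_class u)"

definition class_multiple :: "('n \<Rightarrow> int^'d) \<Rightarrow> nat \<Rightarrow> ('n \<Rightarrow> int) set \<Rightarrow> ('n \<Rightarrow> int) set" where
  "class_multiple u k \<alpha> = (\<Union>D\<in>\<alpha>. div_class u (\<lambda>i. int k * D i))"

text \<open>Exponent vectors of the monomials of degree \<open>\<alpha>\<close>.\<close>

definition monomials :: "('n \<Rightarrow> int) set \<Rightarrow> ('n \<Rightarrow>\<^sub>0 nat) set" where
  "monomials \<alpha> = {a. (\<lambda>i. int (Poly_Mapping.lookup a i)) \<in> \<alpha>}"

text \<open>The graded piece of degree \<open>\<alpha>\<close>, used both for \<open>S = \<complex>[y\<^sub>i]\<close> (so that it is the space of global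
  sections of \<open>\<O>(\<alpha>)\<close>) and for the graded dual \<open>T = \<complex>[x\<^sub>i]\<close>.\<close>

definition graded_piece :: "('n \<Rightarrow> int) set \<Rightarrow> 'n cpoly set" where
  "graded_piece \<alpha> = {f. Poly_Mapping.keys f \<subseteq> monomials \<alpha>}"

definition homogeneous_ideal :: "('n \<Rightarrow> int^'d) \<Rightarrow> 'n cpoly set \<Rightarrow> bool" where
  "homogeneous_ideal u I \<longleftrightarrow> ideal.subspace I \<and>
     I = ideal.span {f \<in> I. \<exists>\<alpha>\<in>Pic u. f \<in> graded_piece \<alpha>}"

text \<open>The generator for the cone \<open>\<sigma>\<close> is the product of the variables whose ray is not in \<open>\<sigma>\<close>.\<close>

definition irrelevant_ideal ::
  "(real^'d) set set \<Rightarrow> ('n::finite \<Rightarrow> int^'d) \<Rightarrow> 'n cpoly set" where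
  "irrelevant_ideal \<Delta> u = ideal.span
     {(\<Prod>i\<in>{i. lattice_vec (u i) \<notin> \<sigma>}. Poly_Mapping.single (Poly_Mapping.single i 1) 1) |\<sigma>. \<sigma> \<in> \<Delta>}"

definition B_saturated ::
  "(real^'d) set set \<Rightarrow> ('n::finite \<Rightarrow> int^'d) \<Rightarrow> 'n cpoly set \<Rightarrow> bool" where
  "B_saturated \<Delta> u I \<longleftrightarrow> I = saturation I (irrelevant_ideal \<Delta> u)"


section \<open>The toric variety as Cox quotient, ampleness\<close>

definition cox_torus :: "('n::finite \<Rightarrow> int^'d) \<Rightarrow> ('n \<Rightarrow> complex) set" where
  "cox_torus u = {t. (\<forall>i. t i \<noteq> 0) \<and> (\<forall>m. (\<Prod>i\<in>UNIV. t i powi dual_pairing m (u i)) = 1)}"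

definition stable_locus ::
  "(real^'d) set set \<Rightarrow> ('n::finite \<Rightarrow> int^'d) \<Rightarrow> ('n \<Rightarrow> complex) set" where
  "stable_locus \<Delta> u = {\<xi>. \<exists>f\<in>irrelevant_ideal \<Delta> u. peval f \<xi> \<noteq> 0}"

definition cox_orbit :: "('n::finite \<Rightarrow> int^'d) \<Rightarrow> ('n \<Rightarrow> complex) \<Rightarrow> ('n \<Rightarrow> complex) set" where
  "cox_orbit u \<xi> = (\<lambda>t i. t i * \<xi> i) ` cox_torus u"

text \<open>A point of \<open>X\<close> is the orbit of its Cox coordinates.\<close>

definition toric_variety ::
  "(real^'d) set set \<Rightarrow> ('n::finite \<Rightarrow> int^'d) \<Rightarrow> ('n \<Rightarrow> complex) set set" where
  "toric_variety \<Delta> u = cox_orbit u ` stable_locus \<Delta> u"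

definition nonvanishing_locus ::
  "(real^'d) set set \<Rightarrow> ('n::finite \<Rightarrow> int^'d) \<Rightarrow> 'n cpoly \<Rightarrow> ('n \<Rightarrow> complex) set set" where
  "nonvanishing_locus \<Delta> u f = {p \<in> toric_variety \<Delta> u. \<forall>\<xi>\<in>p. peval f \<xi> \<noteq> 0}"

definition toric_zariski ::
  "(real^'d) set set \<Rightarrow> ('n::finite \<Rightarrow> int^'d) \<Rightarrow> ('n \<Rightarrow> complex) set topology" where
  "toric_zariski \<Delta> u = topology_generated_by
     {nonvanishing_locus \<Delta> u f |f. \<exists>\<alpha>\<in>Pic u. f \<in> graded_piece \<alpha>}"

text \<open>A line bundle is ample if the nonvanishing loci of the sections of its positive powers form
  a base of the Zariski topology (EGA II, 4.5.2--4.5.3).\<close>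

definition ample ::
  "(real^'d) set set \<Rightarrow> ('n::finite \<Rightarrow> int^'d) \<Rightarrow> ('n \<Rightarrow> int) set \<Rightarrow> bool" where
  "ample \<Delta> u \<alpha> \<longleftrightarrow> \<alpha> \<in> Pic u \<and>
     (\<forall>U p. openin (toric_zariski \<Delta> u) U \<and> p \<in> U \<longrightarrow>
        (\<exists>k>0. \<exists>s\<in>graded_piece (class_multiple u k \<alpha>).
           p \<in> nonvanishing_locus \<Delta> u s \<and> nonvanishing_locus \<Delta> u s \<subseteq> U))"


section \<open>Apolarity\<close>

text \<open>\<open>S\<close> acts on \<open>T\<close> by differentiation: \<open>y\<^sup>a \<circ> x\<^sup>b = (\<Prod>\<^sub>i b\<^sub>i! / (b\<^sub>i - a\<^sub>i)!) x\<^sup>(\<^sup>b\<^sup>-\<^sup>a\<^sup>)\<close> if \<open>a \<le> b\<close>, and \<open>0\<close>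
  otherwise; the product of binomials below vanishes in the second case.\<close>

definition diff_act :: "'n::finite cpoly \<Rightarrow> 'n cpoly \<Rightarrow> 'n cpoly" where
  "diff_act g F = (\<Sum>a\<in>Poly_Mapping.keys g. \<Sum>b\<in>Poly_Mapping.keys F.
     Poly_Mapping.single (b - a)
       (Poly_Mapping.lookup g a * Poly_Mapping.lookup F b *
        (\<Prod>i\<in>UNIV. of_nat ((Poly_Mapping.lookup b i choose Poly_Mapping.lookup a i) *
                             fact (Poly_Mapping.lookup a i)))))"

definition Ann :: "'n::finite cpoly \<Rightarrow> 'n cpoly set" where
  "Ann F = {g. diff_act g F = 0}"


section \<open>Projective space \<open>\<P>(T\<^sub>v)\<close>, the embedding and secant varieties\<close>

definition proj_point :: "'x cpoly \<Rightarrow> 'x cpoly set" where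
  "proj_point F = {cscale c F |c. c \<noteq> 0}"

definition total_homogeneous :: "'x cpoly \<Rightarrow> bool" where
  "total_homogeneous q \<longleftrightarrow> (\<exists>d. \<forall>a\<in>Poly_Mapping.keys q.
     (\<Sum>x\<in>Poly_Mapping.keys a. Poly_Mapping.lookup a x) = d)"

text \<open>The homogeneous coordinates of \<open>[F]\<close> are the coefficients of \<open>F\<close>, so polynomials on \<open>T\<^sub>v\<close> have
  variables indexed by exponent vectors.\<close>

definition proj_zariski :: "('n \<Rightarrow> int) set \<Rightarrow> 'n cpoly set topology" where
  "proj_zariski v = topology_generated_by
     {{proj_point F |F. F \<in> graded_piece v \<and> F \<noteq> 0 \<and> peval q (Poly_Mapping.lookup F) \<noteq> 0} |q.
        total_homogeneous (q :: ('n \<Rightarrow>\<^sub>0 nat) cpoly)}"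

text \<open>Evaluation at \<open>\<xi>\<close>, as a functional on \<open>S\<^sub>v\<close>, corresponds to \<open>\<Sum>\<^sub>a (\<xi>\<^sup>a / a!) x\<^sup>a\<close>, since
  \<open>y\<^sup>a \<circ> x\<^sup>a = a!\<close>. On an orbit this varies only by nonzero scalars.\<close>

definition eval_point :: "('n \<Rightarrow> int) set \<Rightarrow> ('n::finite \<Rightarrow> complex) \<Rightarrow> 'n cpoly" where
  "eval_point v \<xi> = (\<Sum>a\<in>monomials v. Poly_Mapping.single a
     (\<Prod>i\<in>UNIV. \<xi> i ^ Poly_Mapping.lookup a i / fact (Poly_Mapping.lookup a i)))"

definition embedded_variety ::
  "(real^'d) set set \<Rightarrow> ('n::finite \<Rightarrow> int^'d) \<Rightarrow> ('n \<Rightarrow> int) set \<Rightarrow> 'n cpoly set set" where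
  "embedded_variety \<Delta> u v = {proj_point (eval_point v \<xi>) |\<xi>. \<xi> \<in> stable_locus \<Delta> u}"

definition proj_span :: "'x cpoly set set \<Rightarrow> 'x cpoly set set" where
  "proj_span P = {proj_point F |F. F \<in> cp.span (\<Union>P) \<and> F \<noteq> 0}"

definition secant_variety ::
  "(real^'d) set set \<Rightarrow> ('n::finite \<Rightarrow> int^'d) \<Rightarrow> ('n \<Rightarrow> int) set \<Rightarrow> nat \<Rightarrow> 'n cpoly set set" where
  "secant_variety \<Delta> u v r = proj_zariski v closure_of
     \<Union>{proj_span P |P. P \<subseteq> embedded_variety \<Delta> u v \<and> finite P \<and> card P = r}"


section \<open>Multigraded Hilbert scheme and \<open>Slip\<close>\<close>

text \<open>\<open>dim (S/I)\<^sub>\<alpha>\<close>, the pieces \<open>S\<^sub>\<alpha>\<close> being finite dimensional on a complete variety.\<close>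

definition hilbert_fun :: "'n cpoly set \<Rightarrow> ('n \<Rightarrow> int) set \<Rightarrow> nat" where
  "hilbert_fun I \<alpha> = cp.dim (graded_piece \<alpha> :: 'n cpoly set) - cp.dim (I \<inter> graded_piece \<alpha>)"

definition generic_hilbert_fun :: "nat \<Rightarrow> ('n \<Rightarrow> int) set \<Rightarrow> nat" where
  "generic_hilbert_fun r \<alpha> = min r (cp.dim (graded_piece \<alpha> :: 'n cpoly set))"

definition Hilb :: "('n \<Rightarrow> int^'d) \<Rightarrow> nat \<Rightarrow> 'n cpoly set set" where
  "Hilb u r = {I. homogeneous_ideal u I \<and>
     (\<forall>\<alpha>\<in>Pic u. hilbert_fun I \<alpha> = generic_hilbert_fun r \<alpha>)}"

definition basis_list :: "'x cpoly set \<Rightarrow> 'x cpoly list \<Rightarrow> bool" where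
  "basis_list W ws \<longleftrightarrow> distinct ws \<and> cp.independent (set ws) \<and> cp.span (set ws) = W"

text \<open>Pluecker coordinate of the span of \<open>ws\<close> for the monomials \<open>as\<close>. Coordinates are indexed by lists
  rather than sets of monomials, which only adds signed copies and zeros.\<close>

definition pluecker :: "'n cpoly list \<Rightarrow> ('n \<Rightarrow>\<^sub>0 nat) list \<Rightarrow> complex" where
  "pluecker ws as = (if length as = length ws
     then Determinant.det (mat (length ws) (length ws)
            (\<lambda>(i, j). Poly_Mapping.lookup (ws ! i) (as ! j)))
     else 0)"

text \<open>Polynomials in the Pluecker coordinates of the pieces \<open>I\<^sub>\<alpha>\<close>, homogeneous separately for each
  degree \<open>\<alpha>\<close>; only finitely many degrees occur in a given polynomial.\<close>

definition multihomogeneous ::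
  "('n \<Rightarrow> int^'d) \<Rightarrow> (('n \<Rightarrow> int) set \<times> ('n \<Rightarrow>\<^sub>0 nat) list) cpoly \<Rightarrow> bool" where
  "multihomogeneous u q \<longleftrightarrow>
     (\<forall>a\<in>Poly_Mapping.keys q. fst ` Poly_Mapping.keys a \<subseteq> Pic u) \<and>
     (\<forall>\<alpha>. \<exists>d. \<forall>a\<in>Poly_Mapping.keys q.
        (\<Sum>x\<in>{x \<in> Poly_Mapping.keys a. fst x = \<alpha>}. Poly_Mapping.lookup a x) = d)"

text \<open>The Zariski topology on the closed points of the multigraded Hilbert scheme. By Haiman and
  Sturmfels, the scheme is closed in \<open>\<Prod>\<^sub>\<alpha> Gr(S\<^sub>\<alpha>)\<close> over a suitable finite set of degrees, and the maps
  \<open>I \<mapsto> I\<^sub>\<alpha>\<close> for further degrees are morphisms; hence allowing all degrees gives the same topology.\<close>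

definition hilb_zariski :: "('n \<Rightarrow> int^'d) \<Rightarrow> nat \<Rightarrow> 'n cpoly set topology" where
  "hilb_zariski u r = topology_generated_by
     {{I \<in> Hilb u r. \<exists>ws. (\<forall>\<alpha>\<in>Pic u. basis_list (I \<inter> graded_piece \<alpha>) (ws \<alpha>)) \<and>
         peval q (\<lambda>(\<alpha>, as). pluecker (ws \<alpha>) as) \<noteq> 0} |q. multihomogeneous u q}"

text \<open>The vanishing locus in Cox coordinates is stable under the torus, so this ideal is homogeneous:
  it is generated by the homogeneous polynomials vanishing at the given points of \<open>X\<close>.\<close>

definition vanishing_ideal :: "('n \<Rightarrow> complex) set set \<Rightarrow> 'n cpoly set" where
  "vanishing_ideal P = {f. \<forall>p\<in>P. \<forall>\<xi>\<in>p. peval f \<xi> = 0}"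

definition Sip ::
  "(real^'d) set set \<Rightarrow> ('n::finite \<Rightarrow> int^'d) \<Rightarrow> nat \<Rightarrow> 'n cpoly set set" where
  "Sip \<Delta> u r = {I \<in> Hilb u r. B_saturated \<Delta> u I \<and>
     (\<exists>P. P \<subseteq> toric_variety \<Delta> u \<and> finite P \<and> card P = r \<and> I = vanishing_ideal P)}"

definition Slip ::
  "(real^'d) set set \<Rightarrow> ('n::finite \<Rightarrow> int^'d) \<Rightarrow> nat \<Rightarrow> 'n cpoly set set" where
  "Slip \<Delta> u r = hilb_zariski u r closure_of Sip \<Delta> u r"

definition VSP ::
  "(real^'d) set set \<Rightarrow> ('n::finite \<Rightarrow> int^'d) \<Rightarrow> 'n cpoly \<Rightarrow> nat \<Rightarrow> 'n cpoly set set" where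
  "VSP \<Delta> u F r = {J \<in> Slip \<Delta> u r. J \<subseteq> Ann F}"

definition open_dense_in :: "'a topology \<Rightarrow> 'a set \<Rightarrow> 'a set \<Rightarrow> bool" where
  "open_dense_in T Y W \<longleftrightarrow>
     openin (subtopology T Y) W \<and> (subtopology T Y) closure_of W = Y"

end

theory Submission
  imports Defs "HOL-Computational_Algebra.Computational_Algebra"
begin

text \<open>Both open sets can be taken equal: a general \<open>F\<close> in the secant variety lies in the span of \<open>r\<close>
  points \<open>\<xi>\<^sub>1, \<dots>, \<xi>\<^sub>r\<close> of the torus whose vanishing ideal \<open>J\<close> has the generic Hilbert function, and then
  \<open>J\<close> is radical, \<open>B\<close>-saturated, a member of \<open>Sip\<close>, and contained in \<open>Ann F\<close> because the pairing with
  \<open>eval_point v \<xi>\<close> is evaluation at \<open>\<xi>\<close>. Two points need an argument. First, the Hilbert function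
  of the points must be controlled in infinitely many degrees; on the torus, multiplication by monomials
  and Dickson's lemma reduce this to finitely many determinants, so \<open>h(\<xi>) \<noteq> 0\<close> for a single nonzero polynomial
  \<open>h\<close> suffices. Second, the set of the \<open>F\<close> reached from \<open>h \<noteq> 0\<close> must contain an open dense subset of the closure;
  this is Chevalley's theorem for the polynomial map \<open>(\<lambda>, \<xi>) \<mapsto> \<Sum>\<^sub>j \<lambda>\<^sub>j eval_point v \<xi>\<^sub>j\<close>, proved by extending
  homomorphisms to \<open>\<complex>\<close> along finitely generated ring extensions.\<close>

section \<open>Evaluation of polynomials\<close>

text \<open>Chevalley's theorem is affine, while the secant variety is a closure in projective
  space. The bridge is that the image of the map is a cone: a polynomial vanishing on it has all its
  homogeneous components vanishing there, and one homogeneous component of the affine witness cuts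
  out the projective open set. Density rests on irreducibility of the parameter space, in the form
  that a product of nonzero polynomials is nonzero. The map also admits coinciding points, whereas
  secants and \<open>Sip\<close> ask for exactly \<open>r\<close> distinct ones. Coincidences are
  excluded by two distinct monomials of equal degree: their ratio is a function on the torus points
  of the variety, and it separates the powers of a point with prime coordinates. Two such pairs
  occur, one of any degree for Cox orbits and one of degree \<open>v\<close> for points of
  projective space. Finitely many determinants suffice because the generic Hilbert function never
  exceeds \<open>r\<close>: for each threshold \<open>m \<le> r\<close>, Dickson's lemma is applied
  to the exponents whose degree has at least \<open>m\<close> monomials.\<close>

definition mono_eval :: "('x \<Rightarrow> complex) \<Rightarrow> ('x \<Rightarrow>\<^sub>0 nat) \<Rightarrow> complex" where
  "mono_eval z a = (\<Prod>i\<in>Poly_Mapping.keys a. z i ^ Poly_Mapping.lookup a i)"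

lemma peval_alt: "peval f z = (\<Sum>a\<in>Poly_Mapping.keys f. Poly_Mapping.lookup f a * mono_eval z a)"
  by (simp add: peval_def mono_eval_def)

lemma mono_eval_superset:
  assumes "finite S" "Poly_Mapping.keys a \<subseteq> S"
  shows "mono_eval z a = (\<Prod>i\<in>S. z i ^ Poly_Mapping.lookup a i)"
  unfolding mono_eval_def using assms
  by (intro prod.mono_neutral_left) (auto simp: in_keys_iff)

lemma mono_eval_finite: "mono_eval z a = (\<Prod>i\<in>UNIV. z i ^ Poly_Mapping.lookup a i)"
  for z :: "'x::finite \<Rightarrow> complex"
  by (rule mono_eval_superset) auto

lemma mono_eval_0 [simp]: "mono_eval z 0 = 1"
  by (simp add: mono_eval_def)

lemma mono_eval_single [simp]: "mono_eval z (Poly_Mapping.single i k) = z i ^ k"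
  by (subst mono_eval_superset[of "{i}"]) auto

lemma mono_eval_add: "mono_eval z (a + b) = mono_eval z a * mono_eval z b"
proof -
  let ?S = "Poly_Mapping.keys a \<union> Poly_Mapping.keys b"
  have "mono_eval z c = (\<Prod>i\<in>?S. z i ^ Poly_Mapping.lookup c i)" if "c \<in> {a, b, a + b}" for c
    using that Poly_Mapping.keys_add[of a b] by (intro mono_eval_superset) auto
  then show ?thesis by (simp add: lookup_add power_add prod.distrib)
qed

lemma mono_eval_mult: "mono_eval (\<lambda>i. z i * w i) a = mono_eval z a * mono_eval w a"
  by (simp add: mono_eval_def power_mult_distrib prod.distrib)

lemma mono_eval_power: "mono_eval (\<lambda>i. z i ^ k) a = mono_eval z a ^ k"
  by (simp add: mono_eval_def prod_power_distrib mult.commute flip: power_mult)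

lemma mono_eval_nonzero: "(\<And>i. z i \<noteq> 0) \<Longrightarrow> mono_eval z a \<noteq> 0"
  by (simp add: mono_eval_def)

lemma peval_superset:
  assumes "finite S" "Poly_Mapping.keys f \<subseteq> S"
  shows "peval f z = (\<Sum>a\<in>S. Poly_Mapping.lookup f a * mono_eval z a)"
  unfolding peval_alt using assms
  by (intro sum.mono_neutral_left) (auto simp: in_keys_iff)

lemma peval_0 [simp]: "peval 0 z = 0"
  by (simp add: peval_def)

lemma peval_single [simp]: "peval (Poly_Mapping.single a c) z = c * mono_eval z a"
  by (subst peval_superset[of "{a}"]) auto

lemma peval_1 [simp]: "peval 1 z = 1"
  by (simp flip: single_one)

lemma peval_add [simp]: "peval (f + g) z = peval f z + peval g z"
proof -
  let ?S = "Poly_Mapping.keys f \<union> Poly_Mapping.keys g"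
  have "peval h z = (\<Sum>a\<in>?S. Poly_Mapping.lookup h a * mono_eval z a)" if "h \<in> {f, g, f + g}" for h
    using that Poly_Mapping.keys_add[of f g] by (intro peval_superset) auto
  then show ?thesis by (simp add: lookup_add algebra_simps sum.distrib)
qed

lemma peval_sum [simp]: "peval (\<Sum>x\<in>A. f x) z = (\<Sum>x\<in>A. peval (f x) z)"
  by (induction A rule: infinite_finite_induct) auto

lemma poly_mapping_sum_single:
  "f = (\<Sum>a\<in>Poly_Mapping.keys f. Poly_Mapping.single a (Poly_Mapping.lookup f a))"
proof (rule poly_mapping_eqI)
  fix k
  have "(\<Sum>a\<in>Poly_Mapping.keys f. Poly_Mapping.lookup f a when a = k) = Poly_Mapping.lookup f k"
    by (cases "k \<in> Poly_Mapping.keys f") (auto simp: when_def in_keys_iff intro!: sum.neutral)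
  then show "Poly_Mapping.lookup f k = Poly_Mapping.lookup
      (\<Sum>a\<in>Poly_Mapping.keys f. Poly_Mapping.single a (Poly_Mapping.lookup f a)) k"
    by (simp add: lookup_sum lookup_single)
qed

lemma peval_mult [simp]: "peval (f * g) z = peval f z * peval g z"
proof -
  let ?c = "\<lambda>f a. Poly_Mapping.single a (Poly_Mapping.lookup f a)"
  have "f * g = (\<Sum>a\<in>Poly_Mapping.keys f. \<Sum>b\<in>Poly_Mapping.keys g. ?c f a * ?c g b)"
    by (subst poly_mapping_sum_single[of f], subst poly_mapping_sum_single[of g])
      (simp only: sum_product)
  also have "peval \<dots> z = (\<Sum>a\<in>Poly_Mapping.keys f. \<Sum>b\<in>Poly_Mapping.keys g.
      (Poly_Mapping.lookup f a * mono_eval z a) * (Poly_Mapping.lookup g b * mono_eval z b))"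
    by (simp add: mult_single mono_eval_add algebra_simps)
  also have "\<dots> = peval f z * peval g z"
    by (simp add: peval_alt sum_product)
  finally show ?thesis .
qed

lemma peval_uminus [simp]: "peval (- f) z = - peval f z"
  using peval_add[of f "- f" z] by (simp add: add_eq_0_iff2)

lemma peval_diff [simp]: "peval (f - g) z = peval f z - peval g z"
  using peval_add[of f "- g" z] by simp

lemma peval_power [simp]: "peval (f ^ k) z = peval f z ^ k"
  by (induction k) auto

lemma peval_prod [simp]: "peval (\<Prod>x\<in>A. f x) z = (\<Prod>x\<in>A. peval (f x) z)"
  by (induction A rule: infinite_finite_induct) auto

lemma peval_cscale [simp]: "peval (cscale c f) z = c * peval f z"
  by (simp add: cscale_def)

lemma lookup_cscale [simp]: "Poly_Mapping.lookup (cscale c f) a = c * Poly_Mapping.lookup f a"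
proof -
  have "Poly_Mapping.map ((*) c) f = cscale c f"
    by (simp add: cscale_def mult_map_scale_conv_mult)
  then have "Poly_Mapping.lookup (cscale c f) a = (c * Poly_Mapping.lookup f a when Poly_Mapping.lookup f a \<noteq> 0)"
    by (metis Poly_Mapping.map.rep_eq)
  then show ?thesis by (simp add: when_def split: if_splits)
qed

lemma peval_ring_hom: "comm_ring_hom (\<lambda>f. peval f z)"
  by unfold_locales auto

section \<open>Nonvanishing of polynomials, witnessed by points with prime coordinates\<close>

lemma vandermonde_kernel:
  fixes x c :: "'a \<Rightarrow> complex"
  assumes "finite K" "inj_on x K" "\<And>k. k < card K \<Longrightarrow> (\<Sum>a\<in>K. c a * x a ^ k) = 0" "b \<in> K"
  shows "c b = 0"
proof -
  \<comment> \<open>A Lagrange polynomial up to scaling: it vanishes at every node except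
    \<open>x b\<close>, and its degree \<open>card K - 1\<close> is within reach of the assumed
    power sums.\<close>
  define p where "p = (\<Prod>a\<in>K - {b}. [:- x a, 1:])"
  have deg: "degree p < card K"
  proof -
    have "degree p = card (K - {b})"
      by (simp add: p_def degree_prod_eq_sum_degree)
    then show ?thesis
      using assms(1,4) by (metis card_Diff1_less)
  qed
  have "0 = (\<Sum>k\<le>degree p. coeff p k * (\<Sum>a\<in>K. c a * x a ^ k))"
    using assms(3) deg by simp
  also have "\<dots> = (\<Sum>a\<in>K. c a * poly p (x a))"
    unfolding poly_altdef sum_distrib_left by (subst sum.swap) (simp add: mult_ac)
  also have "\<dots> = (\<Sum>a\<in>K. if a = b then c b * poly p (x b) else 0)"
    using assms(1) by (intro sum.cong) (auto simp: p_def poly_prod prod_zero_iff)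
  also have "\<dots> = c b * poly p (x b)"
    using assms(1,4) by simp
  finally have "c b * poly p (x b) = 0" ..
  moreover have "poly p (x b) \<noteq> 0"
    using assms(1,2,4) by (auto simp: p_def poly_prod inj_on_def)
  ultimately show ?thesis by simp
qed

text \<open>Unique factorization: the exponent at \<open>i\<close> is the multiplicity of the prime
  \<open>g i\<close> in the value of the monomial.\<close>

lemma primes_mono_inj:
  assumes "inj g" "\<And>i. prime (g i :: nat)"
    and eq: "mono_eval (\<lambda>i. of_nat (g i)) a = mono_eval (\<lambda>i. of_nat (g i)) b"
  shows "a = b"
proof (rule poly_mapping_eqI)
  fix i
  let ?S = "Poly_Mapping.keys a \<union> Poly_Mapping.keys b \<union> {i}"
  have *: "mono_eval (\<lambda>i. of_nat (g i)) c = of_nat (\<Prod>i\<in>?S. g i ^ Poly_Mapping.lookup c i)"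
    if "c \<in> {a, b}" for c
    using that by (subst mono_eval_superset[of ?S]) auto
  have "of_nat (\<Prod>i\<in>?S. g i ^ Poly_Mapping.lookup a i)
      = (of_nat (\<Prod>i\<in>?S. g i ^ Poly_Mapping.lookup b i) :: complex)"
    using eq *[of a] *[of b] by simp
  then have nat_eq: "(\<Prod>i\<in>?S. g i ^ Poly_Mapping.lookup a i) = (\<Prod>i\<in>?S. g i ^ Poly_Mapping.lookup b i)"
    using of_nat_eq_iff by blast
  have "multiplicity (g i) (\<Prod>i\<in>?S. g i ^ Poly_Mapping.lookup c i) = Poly_Mapping.lookup c i" for c :: "'a \<Rightarrow>\<^sub>0 nat"
  proof -
    have "(\<Prod>j\<in>?S. g j ^ Poly_Mapping.lookup c j)
        = (\<Prod>p\<in>g ` ?S. p ^ Poly_Mapping.lookup c (inv_into UNIV g p))"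
      using assms(1) by (subst prod.reindex) (auto simp: inj_on_def)
    moreover have "multiplicity (g i) (\<Prod>p\<in>g ` ?S. p ^ Poly_Mapping.lookup c (inv_into UNIV g p)) = Poly_Mapping.lookup c i"
      using assms(1,2) by (subst multiplicity_prod_prime_powers) auto
    ultimately show ?thesis by simp
  qed
  from this[of a] this[of b] nat_eq show "Poly_Mapping.lookup a i = Poly_Mapping.lookup b i"
    by metis
qed

definition nth_prime :: "nat \<Rightarrow> nat" where
  "nth_prime = enumerate {p. prime p}"

lemma inj_nth_prime: "inj nth_prime"
  unfolding nth_prime_def by (simp add: primes_infinite strict_mono_enumerate strict_mono_imp_inj_on)

lemma prime_nth_prime: "prime (nth_prime k)"
  unfolding nth_prime_def using enumerate_in_set[OF primes_infinite] by simp

text \<open>Test points are those whose coordinates are the \<open>k\<close>-th powers of distinct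
  primes. Distinct monomials give distinct nodes there, and the values of \<open>f\<close> for
  varying \<open>k\<close> are power sums to which the Vandermonde argument applies.\<close>

lemma exists_peval_nonzero:
  fixes f :: "nat cpoly"
  assumes "f \<noteq> 0"
  shows "\<exists>z. peval f z \<noteq> 0"
proof (rule ccontr)
  assume z: "\<nexists>z. peval f z \<noteq> 0"
  let ?z = "\<lambda>i. of_nat (nth_prime i) :: complex"
  have "Poly_Mapping.lookup f b = 0" if "b \<in> Poly_Mapping.keys f" for b
  proof (rule vandermonde_kernel[OF _ _ _ that])
    show "inj_on (mono_eval ?z) (Poly_Mapping.keys f)"
      by (rule inj_onI) (rule primes_mono_inj[OF inj_nth_prime prime_nth_prime])
    show "(\<Sum>a\<in>Poly_Mapping.keys f. Poly_Mapping.lookup f a * mono_eval ?z a ^ k) = 0" for k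
      using z by (simp add: peval_alt flip: mono_eval_power)
  qed auto
  then show False using assms by (metis lookup_zero not_in_keys_iff_lookup_eq_zero poly_mapping_eqI)
qed


section \<open>Extension of homomorphisms\<close>

text \<open>Subrings are carriers inside one ambient ring type, and homomorphisms are total
  functions constrained only on the carrier. A tower of extensions can then be built by induction
  without changing the type.\<close>

definition is_subring :: "'b::comm_ring_1 set \<Rightarrow> bool" where
  "is_subring A \<longleftrightarrow> 1 \<in> A \<and> (\<forall>x\<in>A. \<forall>y\<in>A. x - y \<in> A \<and> x * y \<in> A)"

definition ring_hom_on :: "'b::comm_ring_1 set \<Rightarrow> ('b \<Rightarrow> complex) \<Rightarrow> bool" where
  "ring_hom_on A \<phi> \<longleftrightarrow>
     \<phi> 1 = 1 \<and> (\<forall>x\<in>A. \<forall>y\<in>A. \<phi> (x + y) = \<phi> x + \<phi> y \<and> \<phi> (x * y) = \<phi> x * \<phi> y)"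

definition polys_over :: "'b::comm_ring_1 set \<Rightarrow> 'b poly set" where
  "polys_over A = {p. \<forall>i. poly.coeff p i \<in> A}"

definition adjoin :: "'b::comm_ring_1 set \<Rightarrow> 'b \<Rightarrow> 'b set" where
  "adjoin A b = (\<lambda>p. poly p b) ` polys_over A"

lemma subring_closed:
  assumes "is_subring A"
  shows "0 \<in> A" "1 \<in> A" "x \<in> A \<Longrightarrow> y \<in> A \<Longrightarrow> x + y \<in> A" "x \<in> A \<Longrightarrow> y \<in> A \<Longrightarrow> x - y \<in> A"
    "x \<in> A \<Longrightarrow> - x \<in> A" "x \<in> A \<Longrightarrow> y \<in> A \<Longrightarrow> x * y \<in> A"
proof -
  show 0: "0 \<in> A" using assms by (metis cancel_comm_monoid_add_class.diff_cancel is_subring_def)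
  show uminus: "x \<in> A \<Longrightarrow> - x \<in> A" for x using assms 0 by (metis diff_0 is_subring_def)
  show "x \<in> A \<Longrightarrow> y \<in> A \<Longrightarrow> x + y \<in> A" using assms uminus by (metis diff_minus_eq_add is_subring_def)
qed (use assms in \<open>auto simp: is_subring_def\<close>)

lemma subring_sum: "is_subring A \<Longrightarrow> (\<And>i. i \<in> I \<Longrightarrow> f i \<in> A) \<Longrightarrow> (\<Sum>i\<in>I. f i) \<in> A"
  by (induction I rule: infinite_finite_induct) (auto intro: subring_closed)

lemma subring_prod: "is_subring A \<Longrightarrow> (\<And>i. i \<in> I \<Longrightarrow> f i \<in> A) \<Longrightarrow> (\<Prod>i\<in>I. f i) \<in> A"
  by (induction I rule: infinite_finite_induct) (auto intro: subring_closed)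

lemma subring_power: "is_subring A \<Longrightarrow> x \<in> A \<Longrightarrow> x ^ k \<in> A"
  by (induction k) (auto intro: subring_closed)

lemma polys_over_closed:
  assumes "is_subring A"
  shows "is_subring (polys_over A)" "a \<in> A \<Longrightarrow> p \<in> polys_over A \<Longrightarrow> Polynomial.smult a p \<in> polys_over A"
    "a \<in> A \<Longrightarrow> Polynomial.monom a k \<in> polys_over A" "p \<in> polys_over A \<Longrightarrow> lead_coeff p \<in> A"
proof -
  show "is_subring (polys_over A)"
    unfolding is_subring_def[of "polys_over A"] using assms
    by (auto simp: polys_over_def coeff_mult intro!: subring_sum intro: subring_closed)
qed (use assms in \<open>auto simp: polys_over_def intro: subring_closed\<close>)

lemma subring_adjoin:
  assumes "is_subring A"
  shows "is_subring (adjoin A b)"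
proof -
  note P = polys_over_closed(1)[OF assms]
  have "\<exists>p\<in>polys_over A. 1 = poly p b"
    by (rule bexI[of _ 1]) (auto intro: subring_closed[OF P])
  moreover have "\<exists>r\<in>polys_over A. poly p b - poly q b = poly r b"
    "\<exists>r\<in>polys_over A. poly p b * poly q b = poly r b" if "p \<in> polys_over A" "q \<in> polys_over A" for p q
    using that subring_closed(4,6)[OF P, of p q] by (force simp flip: poly_diff poly_mult)+
  ultimately show ?thesis
    by (auto simp: is_subring_def adjoin_def image_iff)
qed

lemma subset_adjoin:
  assumes "is_subring A"
  shows "A \<subseteq> adjoin A b"
proof
  fix a assume "a \<in> A"
  then have "Polynomial.monom a 0 \<in> polys_over A" by (rule polys_over_closed(3)[OF assms])
  then show "a \<in> adjoin A b" unfolding adjoin_def by (rule rev_image_eqI) (simp add: poly_monom)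
qed

lemma mem_adjoin:
  assumes "is_subring A"
  shows "b \<in> adjoin A b"
proof -
  have "Polynomial.monom 1 1 \<in> polys_over A" by (intro polys_over_closed(3) subring_closed assms)
  then show ?thesis unfolding adjoin_def by (rule rev_image_eqI) (simp add: poly_monom)
qed

lemma hom_on_0: "ring_hom_on A \<phi> \<Longrightarrow> is_subring A \<Longrightarrow> \<phi> 0 = 0"
  by (metis add_cancel_right_left ring_hom_on_def subring_closed(1))

lemma hom_on_diff:
  assumes "ring_hom_on A \<phi>" "is_subring A" "x \<in> A" "y \<in> A"
  shows "\<phi> (x - y) = \<phi> x - \<phi> y"
proof -
  have "\<phi> (x - y) + \<phi> y = \<phi> (x - y + y)"
    using assms subring_closed(4)[OF assms(2)] by (metis ring_hom_on_def)
  then show ?thesis by (simp add: algebra_simps)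
qed

lemma hom_on_sum:
  assumes "ring_hom_on A \<phi>" "is_subring A"
  shows "(\<And>i. i \<in> I \<Longrightarrow> f i \<in> A) \<Longrightarrow> \<phi> (\<Sum>i\<in>I. f i) = (\<Sum>i\<in>I. \<phi> (f i))"
proof (induction I rule: infinite_finite_induct)
  case (insert x F)
  then have "\<phi> (f x + (\<Sum>i\<in>F. f i)) = \<phi> (f x) + \<phi> (\<Sum>i\<in>F. f i)"
    using assms subring_sum[OF assms(2), of F f] by (simp add: ring_hom_on_def)
  with insert show ?case by simp
qed (use hom_on_0[OF assms] in auto)

lemma hom_on_power:
  assumes "ring_hom_on A \<phi>" "is_subring A" "x \<in> A"
  shows "\<phi> (x ^ k) = \<phi> x ^ k"
  using assms by (induction k) (auto simp: ring_hom_on_def subring_power)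

lemma hom_on_prod:
  assumes "ring_hom_on A \<phi>" "is_subring A"
  shows "(\<And>i. i \<in> I \<Longrightarrow> f i \<in> A) \<Longrightarrow> \<phi> (\<Prod>i\<in>I. f i) = (\<Prod>i\<in>I. \<phi> (f i))"
proof (induction I rule: infinite_finite_induct)
  case (insert x F)
  then have "\<phi> (f x * (\<Prod>i\<in>F. f i)) = \<phi> (f x) * \<phi> (\<Prod>i\<in>F. f i)"
    using assms subring_prod[OF assms(2), of F f] by (simp add: ring_hom_on_def)
  with insert show ?case by simp
qed (use assms in \<open>auto simp: ring_hom_on_def\<close>)

lemma map_poly_hom_on:
  assumes hom: "ring_hom_on A \<phi>" and A: "is_subring A" and "p \<in> polys_over A" "q \<in> polys_over A"
  shows "map_poly \<phi> (p + q) = map_poly \<phi> p + map_poly \<phi> q"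
    "map_poly \<phi> (p * q) = map_poly \<phi> p * map_poly \<phi> q"
    "map_poly \<phi> (p - q) = map_poly \<phi> p - map_poly \<phi> q"
    "a \<in> A \<Longrightarrow> map_poly \<phi> (Polynomial.smult a p) = Polynomial.smult (\<phi> a) (map_poly \<phi> p)"
proof -
  note simps = poly_eq_iff coeff_map_poly[of \<phi>, OF hom_on_0[OF hom A]] 
  have pq: "poly.coeff p i \<in> A" "poly.coeff q i \<in> A" for i
    using assms by (auto simp: polys_over_def)
  show "map_poly \<phi> (p + q) = map_poly \<phi> p + map_poly \<phi> q"
    "a \<in> A \<Longrightarrow> map_poly \<phi> (Polynomial.smult a p) = Polynomial.smult (\<phi> a) (map_poly \<phi> p)"
    using hom pq by (simp_all add: simps ring_hom_on_def)
  show "map_poly \<phi> (p - q) = map_poly \<phi> p - map_poly \<phi> q"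
    using hom_on_diff[OF hom A] pq by (simp add: simps)
  have "\<phi> (\<Sum>i\<le>n. poly.coeff p i * poly.coeff q (n - i))
      = (\<Sum>i\<le>n. \<phi> (poly.coeff p i) * \<phi> (poly.coeff q (n - i)))" for n
    by (subst hom_on_sum[OF hom A]) (use hom pq A in \<open>auto simp: ring_hom_on_def intro: subring_closed\<close>)
  then show "map_poly \<phi> (p * q) = map_poly \<phi> p * map_poly \<phi> q"
    by (simp add: simps coeff_mult)
qed

text \<open>Division by \<open>p\<close> produces denominators that are powers of its leading
  coefficient; multiplying by such a power beforehand keeps all coefficients in
  \<open>A\<close>.\<close>

lemma pseudo_division:
  fixes A :: "'b::idom set"
  assumes A: "is_subring A" and p: "p \<in> polys_over A" "p \<noteq> 0"
  shows "q \<in> polys_over A \<Longrightarrow> \<exists>k. \<exists>s\<in>polys_over A. \<exists>r\<in>polys_over A.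
    Polynomial.smult (lead_coeff p ^ k) q = p * s + r \<and> (r \<noteq> 0 \<longrightarrow> degree r < degree p)"
\<comment> \<open>The measure places the zero polynomial strictly below the nonzero constants, which
  \<open>degree\<close> alone does not separate.\<close>
proof (induction "if q = 0 then 0 else Suc (degree q)" arbitrary: q rule: less_induct)
  case less
  note closed = subring_closed[OF polys_over_closed(1)[OF A]] polys_over_closed(2-)[OF A]
  show ?case
  proof (cases "q \<noteq> 0 \<longrightarrow> degree q < degree p")
    case True
    then show ?thesis
      using less.prems by (intro exI[of _ 0] bexI[of _ 0] bexI[of _ q]) (auto intro: closed)
  next
    case False
    define m where "m = Polynomial.monom (lead_coeff q) (degree q - degree p)"
    define q' where "q' = Polynomial.smult (lead_coeff p) q - m * p"
    have q': "q' \<in> polys_over A"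
      unfolding q'_def m_def using p less.prems by (intro closed)
    have deg_eq: "degree (m * p) = degree q" "degree (Polynomial.smult (lead_coeff p) q) = degree q"
      using False p by (auto simp: m_def degree_mult_eq degree_monom_eq monom_eq_0_iff)
    have "poly.coeff q' (degree q) = 0"
    proof -
      have "poly.coeff (m * p) (degree q) = lead_coeff m * lead_coeff p"
        using deg_eq lead_coeff_mult[of m p] by simp
      then show ?thesis
        using False by (simp add: q'_def m_def degree_monom_eq)
    qed
    moreover have "degree q' \<le> degree q"
      unfolding q'_def using deg_eq by (intro degree_diff_le) auto
    ultimately have "q' \<noteq> 0 \<Longrightarrow> degree q' < degree q"
      by (metis leading_coeff_0_iff nat_less_le)
    then have "(if q' = 0 then 0 else Suc (degree q')) < (if q = 0 then 0 else Suc (degree q))"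
      using False by auto
    from less.hyps[OF this q'] obtain k s r where *: "s \<in> polys_over A" "r \<in> polys_over A"
      "Polynomial.smult (lead_coeff p ^ k) q' = p * s + r" "r \<noteq> 0 \<longrightarrow> degree r < degree p" by blast
    have "Polynomial.smult (lead_coeff p ^ Suc k) q = Polynomial.smult (lead_coeff p ^ k) (q' + m * p)"
      by (simp add: q'_def mult.commute)
    also have "\<dots> = p * (s + Polynomial.smult (lead_coeff p ^ k) m) + r"
      using *(3) by (simp add: smult_add_right algebra_simps)
    finally show ?thesis
      using * p less.prems A unfolding m_def
      by (intro exI[of _ "Suc k"] bexI[of _ "s + Polynomial.smult (lead_coeff p ^ k) m"] bexI[of _ r])
        (auto simp: m_def intro!: closed subring_power)
  qed
qed

text \<open>This is the universal property of \<open>A[b]\<close> as a quotient of the polynomial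
  ring over \<open>A\<close>. Sending \<open>b\<close> to \<open>c\<close> is well defined because
  two polynomials with the same value at \<open>b\<close> differ by a relation, and \<open>c\<close>
  satisfies the image of each relation.\<close>

lemma hom_extend_root:
  assumes A: "is_subring A" and hom: "ring_hom_on A \<phi>"
    and c: "\<And>q. q \<in> polys_over A \<Longrightarrow> poly q b = 0 \<Longrightarrow> poly (map_poly \<phi> q) c = 0"
  obtains \<psi> where "ring_hom_on (adjoin A b) \<psi>" "\<And>x. x \<in> A \<Longrightarrow> \<psi> x = \<phi> x"
    "\<And>q. q \<in> polys_over A \<Longrightarrow> \<psi> (poly q b) = poly (map_poly \<phi> q) c"
proof -
  note closed = subring_closed[OF polys_over_closed(1)[OF A]] polys_over_closed(2-)[OF A]
  define \<psi> where "\<psi> x = poly (map_poly \<phi> (SOME q. q \<in> polys_over A \<and> poly q b = x)) c" for x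
  have \<psi>: "\<psi> (poly q b) = poly (map_poly \<phi> q) c" if q: "q \<in> polys_over A" for q
  proof -
    define q' where "q' = (SOME q'. q' \<in> polys_over A \<and> poly q' b = poly q b)"
    have q': "q' \<in> polys_over A \<and> poly q' b = poly q b"
      unfolding q'_def by (rule someI[of _ q]) (use q in simp)
    have "poly (map_poly \<phi> (q' - q)) c = 0"
      using q q' by (intro c closed) auto
    then show ?thesis
      using q q' by (simp add: \<psi>_def q'_def[symmetric] map_poly_hom_on[OF hom A])
  qed
  have ext: "\<psi> x = \<phi> x" if "x \<in> A" for x
    using \<psi>[OF closed(8)[OF that, of 0]] hom_on_0[OF hom A]
    by (simp add: poly_monom map_poly_monom)
  have "\<psi> 1 = 1"
    using ext[of 1] subring_closed(2)[OF A] hom by (simp add: ring_hom_on_def)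
  moreover have "\<psi> (poly p b + poly q b) = \<psi> (poly p b) + \<psi> (poly q b)"
    "\<psi> (poly p b * poly q b) = \<psi> (poly p b) * \<psi> (poly q b)"
    if "p \<in> polys_over A" "q \<in> polys_over A" for p q
    using that \<psi>[of "p + q"] \<psi>[of "p * q"] by (simp_all add: \<psi> closed map_poly_hom_on[OF hom A])
  ultimately have "ring_hom_on (adjoin A b) \<psi>"
    by (auto simp: ring_hom_on_def adjoin_def)
  with ext \<psi> show ?thesis using that by blast
qed

text \<open>Among the polynomials whose value at \<open>b\<close> is a nonzero multiple of
  \<open>P(b)\<close> in \<open>A[b]\<close>, take \<open>Q\<close> of least degree and
  pseudo-divide the minimal \<open>p\<close> by it. The remainder takes at \<open>b\<close> again a
  multiple of \<open>P(b)\<close>, so minimality of \<open>Q\<close>, or of \<open>p\<close> if that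
  value is zero, makes the remainder zero. The quotient then vanishes at \<open>b\<close>, hence has
  degree at least that of \<open>p\<close>, and \<open>Q\<close> is left constant.\<close>

lemma algebraic_multiple_in_base:
  fixes A :: "'b::idom set"
  assumes A: "is_subring A" and p: "p \<in> polys_over A" "p \<noteq> 0" "poly p b = 0"
    and min: "\<And>q. q \<in> polys_over A \<Longrightarrow> q \<noteq> 0 \<Longrightarrow> poly q b = 0 \<Longrightarrow> degree p \<le> degree q"
    and P: "P \<in> polys_over A" "poly P b \<noteq> 0"
  shows "\<exists>s\<in>polys_over A. poly s b * poly P b \<in> A - {0}"
proof -
  note closed = subring_closed[OF polys_over_closed(1)[OF A]] polys_over_closed(2-)[OF A]
  define J where "J Q \<longleftrightarrow> Q \<in> polys_over A \<and> poly Q b \<noteq> 0 \<and>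
    (\<exists>s\<in>polys_over A. poly Q b = poly s b * poly P b)" for Q
  have "J P" using P by (auto simp: J_def intro!: bexI[of _ 1] closed)
  then obtain Q where Q: "J Q" and Qmin: "\<And>R. J R \<Longrightarrow> degree Q \<le> degree R"
    by (metis ex_has_least_nat)
  from Q obtain t where t: "t \<in> polys_over A" "poly Q b = poly t b * poly P b"
    and Q': "Q \<in> polys_over A" "poly Q b \<noteq> 0" by (auto simp: J_def)
  have "Q \<noteq> 0" using Q' by auto
  \<comment> \<open>The pseudo-remainder of \<open>Q\<close> by \<open>p\<close> is again
    admissible, so minimality bounds the degree of \<open>Q\<close> by that of the
    remainder.\<close>
  have "degree Q < degree p"
  proof -
    obtain k s r where *: "s \<in> polys_over A" "r \<in> polys_over A"
      "Polynomial.smult (lead_coeff p ^ k) Q = p * s + r" "r \<noteq> 0 \<longrightarrow> degree r < degree p"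
      using pseudo_division[OF A p(1,2) Q'(1)] by blast
    from arg_cong[OF *(3), of "\<lambda>f. poly f b"] p(3)
    have r: "poly r b = lead_coeff p ^ k * poly Q b" by simp
    then have "poly r b \<noteq> 0" using p(2) Q'(2) by simp
    moreover have "poly r b = poly (Polynomial.smult (lead_coeff p ^ k) t) b * poly P b"
      using r t by simp
    moreover have "Polynomial.smult (lead_coeff p ^ k) t \<in> polys_over A"
      using t p A by (intro closed subring_power)
    ultimately have "J r" unfolding J_def using *(2) by blast
    then have "degree Q \<le> degree r" by (rule Qmin)
    also have "\<dots> < degree p" using * \<open>poly r b \<noteq> 0\<close> by auto
    finally show ?thesis .
  qed
  obtain k s r where *: "s \<in> polys_over A" "r \<in> polys_over A"
    "Polynomial.smult (lead_coeff Q ^ k) p = Q * s + r" "r \<noteq> 0 \<longrightarrow> degree r < degree Q"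
    using pseudo_division[OF A Q'(1) \<open>Q \<noteq> 0\<close> p(1)] by blast
  from arg_cong[OF *(3), of "\<lambda>f. poly f b"] p(3)
  have r: "poly r b = - (poly Q b * poly s b)" by (simp add: eq_neg_iff_add_eq_0 add.commute)
  have "r = 0"
  proof (rule ccontr)
    assume "r \<noteq> 0"
    show False
    proof (cases "poly r b = 0")
      case True
      with min[OF *(2) \<open>r \<noteq> 0\<close>] * \<open>r \<noteq> 0\<close> \<open>degree Q < degree p\<close> show False by simp
    next
      case False
      have "poly r b = poly (- (s * t)) b * poly P b" using r t by simp
      moreover have "- (s * t) \<in> polys_over A" using * t by (intro closed)
      ultimately have "J r" unfolding J_def using False *(2) by blast
      then show False using Qmin[of r] * \<open>r \<noteq> 0\<close> by simp
    qed
  qed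
  then have "poly s b = 0" using r Q' by simp
  have eq: "Polynomial.smult (lead_coeff Q ^ k) p = Q * s" using * \<open>r = 0\<close> by simp
  then have "s \<noteq> 0" using p(2) \<open>Q \<noteq> 0\<close> by auto
  have "degree p = degree Q + degree s"
    using arg_cong[OF eq, of degree] \<open>Q \<noteq> 0\<close> \<open>s \<noteq> 0\<close> by (simp add: degree_mult_eq)
  moreover have "degree p \<le> degree s"
    using min * \<open>s \<noteq> 0\<close> \<open>poly s b = 0\<close> by blast
  ultimately have "degree Q = 0" by simp
  then obtain a where "Q = [:a:]" by (metis degree_eq_zeroE)
  then have "poly Q b \<in> A - {0}" using Q' by (auto simp: polys_over_def split: nat.splits) (metis coeff_pCons_0)
  then show ?thesis using t by auto
qed

text \<open>The element \<open>a\<close> collects what must survive under \<phi>. If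
  \<open>b\<close> is transcendental over \<open>A\<close>, the leading coefficient of
  \<open>P\<close> keeps the image of \<open>P\<close> nonzero, and any non-root \<open>c\<close> of
  that image can serve as the image of \<open>b\<close>. If \<open>b\<close> is algebraic,
  \<open>c\<close> has to be a root of the image of a relation of least degree, which the
  fundamental theorem of algebra provides.\<close>

lemma hom_extend_step:
  fixes A :: "'b::idom set"
  assumes A: "is_subring A" and h: "h \<in> adjoin A b" "h \<noteq> 0"
  shows "\<exists>a\<in>A - {0}. \<forall>\<phi>. ring_hom_on A \<phi> \<and> \<phi> a \<noteq> 0 \<longrightarrow>
    (\<exists>\<psi>. ring_hom_on (adjoin A b) \<psi> \<and> (\<forall>x\<in>A. \<psi> x = \<phi> x) \<and> \<psi> h \<noteq> 0)"
proof -
  note closed = subring_closed[OF polys_over_closed(1)[OF A]] polys_over_closed(2-)[OF A]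
  obtain P where P: "P \<in> polys_over A" "h = poly P b" using h by (auto simp: adjoin_def)
  show ?thesis
  proof (cases "\<exists>q\<in>polys_over A. q \<noteq> 0 \<and> poly q b = 0")
    case False
    show ?thesis
    proof (intro bexI[of _ "lead_coeff P"] allI impI)
      show "lead_coeff P \<in> A - {0}" using P h closed by auto
      fix \<phi> assume \<phi>: "ring_hom_on A \<phi> \<and> \<phi> (lead_coeff P) \<noteq> 0"
      then have "poly.coeff (map_poly \<phi> P) (degree P) \<noteq> 0"
        by (simp add: coeff_map_poly hom_on_0[OF _ A])
      then have "map_poly \<phi> P \<noteq> 0" by auto
      then obtain c where c: "poly (map_poly \<phi> P) c \<noteq> 0"
        using poly_all_0_iff_0 by blast
      have "poly (map_poly \<phi> q) c = 0" if "q \<in> polys_over A" "poly q b = 0" for q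
        using that False by auto
      then obtain \<psi> where "ring_hom_on (adjoin A b) \<psi>" "\<And>x. x \<in> A \<Longrightarrow> \<psi> x = \<phi> x"
        "\<And>q. q \<in> polys_over A \<Longrightarrow> \<psi> (poly q b) = poly (map_poly \<phi> q) c"
        using hom_extend_root[OF A conjunct1[OF \<phi>], of b c] by metis
      then show "\<exists>\<psi>. ring_hom_on (adjoin A b) \<psi> \<and> (\<forall>x\<in>A. \<psi> x = \<phi> x) \<and> \<psi> h \<noteq> 0"
        using P c by auto
    qed
  next
    case True
    then obtain p where p: "p \<in> polys_over A" "p \<noteq> 0" "poly p b = 0"
      and min: "\<And>q. q \<in> polys_over A \<Longrightarrow> q \<noteq> 0 \<Longrightarrow> poly q b = 0 \<Longrightarrow> degree p \<le> degree q"
      using ex_has_least_nat[of "\<lambda>q. q \<in> polys_over A \<and> q \<noteq> 0 \<and> poly q b = 0" _ degree] by blast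
    obtain s where s: "s \<in> polys_over A" "poly s b * h \<in> A - {0}"
      using algebraic_multiple_in_base[OF A p min P(1)] P h by blast
    \<comment> \<open>The first factor keeps the degree of \<open>p\<close> under \<phi>, so that
      its image has a root. The second is a multiple of \<open>h\<close> lying in \<open>A\<close>,
      so its nonzero image forces the extension to be nonzero at \<open>h\<close>.\<close>
    define a where "a = lead_coeff p * (poly s b * h)"
    show ?thesis
    proof (intro bexI[of _ a] allI impI)
      show "a \<in> A - {0}" using s p closed A by (auto simp: a_def intro: subring_closed)
      fix \<phi> assume \<phi>: "ring_hom_on A \<phi> \<and> \<phi> a \<noteq> 0"
      then have hom: "ring_hom_on A \<phi>" by simp
      have "\<phi> a = \<phi> (lead_coeff p) * \<phi> (poly s b * h)"
        unfolding a_def using hom s p closed by (auto simp: ring_hom_on_def)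
      then have nz: "\<phi> (lead_coeff p) \<noteq> 0" "\<phi> (poly s b * h) \<noteq> 0" using \<phi> by auto
      have "degree p \<noteq> 0"
      proof
        assume "degree p = 0"
        then obtain x where "p = [:x:]" by (elim degree_eq_zeroE)
        with p show False by simp
      qed
      have "degree (map_poly \<phi> p) = degree p"
        using nz by (intro antisym degree_le le_degree allI impI)
          (simp_all add: coeff_map_poly hom_on_0[OF hom A] coeff_eq_0)
      then have "\<not> constant (poly (map_poly \<phi> p))"
        using \<open>degree p \<noteq> 0\<close> by (simp add: constant_degree)
      then obtain c where c: "poly (map_poly \<phi> p) c = 0"
        using fundamental_theorem_of_algebra by blast
      \<comment> \<open>Up to a power of the leading coefficient, every relation of \<open>b\<close>
        is a multiple of \<open>p\<close>: the pseudo-remainder vanishes at \<open>b\<close> and has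
        too small a degree. Hence \<open>c\<close> satisfies the images of all relations.\<close>
      have "poly (map_poly \<phi> q) c = 0" if q: "q \<in> polys_over A" "poly q b = 0" for q
      proof -
        obtain k s r where *: "s \<in> polys_over A" "r \<in> polys_over A"
          "Polynomial.smult (lead_coeff p ^ k) q = p * s + r" "r \<noteq> 0 \<longrightarrow> degree r < degree p"
          using pseudo_division[OF A p(1,2) q(1)] by blast
        have "poly r b = 0"
          using arg_cong[OF *(3), of "\<lambda>f. poly f b"] q p by simp
        then have "r = 0" using min[of r] * by force
        then have eq: "Polynomial.smult (lead_coeff p ^ k) q = p * s" using * by simp
        have "Polynomial.smult (\<phi> (lead_coeff p ^ k)) (map_poly \<phi> q) = map_poly \<phi> (Polynomial.smult (lead_coeff p ^ k) q)"
          using map_poly_hom_on(4)[OF hom A q(1) q(1)] p A by (simp add: subring_power closed)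
        also have "\<dots> = map_poly \<phi> p * map_poly \<phi> s"
          unfolding eq using map_poly_hom_on(2)[OF hom A p(1) *(1)] .
        finally have "\<phi> (lead_coeff p ^ k) * poly (map_poly \<phi> q) c = 0"
          using c by (metis mult_zero_left poly_mult poly_smult)
        moreover have "\<phi> (lead_coeff p ^ k) \<noteq> 0"
          using hom_on_power[OF hom A] p nz closed by simp
        ultimately show ?thesis by simp
      qed
      then obtain \<psi> where \<psi>: "ring_hom_on (adjoin A b) \<psi>" "\<And>x. x \<in> A \<Longrightarrow> \<psi> x = \<phi> x"
        using hom_extend_root[OF A hom, of b c] by metis
      have "poly s b \<in> adjoin A b" using s by (auto simp: adjoin_def)
      then have "\<psi> (poly s b) * \<psi> h = \<psi> (poly s b * h)"
        using \<psi>(1) h(1) by (simp add: ring_hom_on_def)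
      also have "\<dots> = \<phi> (poly s b * h)"
        using \<psi>(2) s by simp
      finally have "\<psi> (poly s b) * \<psi> h = \<phi> (poly s b * h)" .
      then have "\<psi> h \<noteq> 0" using nz by auto
      with \<psi> show "\<exists>\<psi>. ring_hom_on (adjoin A b) \<psi> \<and> (\<forall>x\<in>A. \<psi> x = \<phi> x) \<and> \<psi> h \<noteq> 0" by blast
    qed
  qed
qed

primrec adjoins :: "'b::comm_ring_1 set \<Rightarrow> 'b list \<Rightarrow> 'b set" where
  "adjoins A [] = A"
| "adjoins A (b # bs) = adjoins (adjoin A b) bs"

lemma adjoins_closed:
  "is_subring A \<Longrightarrow> is_subring (adjoins A bs) \<and> A \<union> set bs \<subseteq> adjoins A bs"
proof (induction bs arbitrary: A)
  case (Cons b bs)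
  then show ?case
    using subring_adjoin[OF Cons.prems, of b] subset_adjoin[OF Cons.prems, of b]
      mem_adjoin[OF Cons.prems, of b] by auto
qed simp

text \<open>The nonvanishing condition travels down the tower: the element that must have nonzero
  image at one level becomes the \<open>h\<close> of the level below, until a single condition on
  \<open>A\<close> remains.\<close>

lemma hom_extend:
  fixes A :: "'b::idom set"
  shows "is_subring A \<Longrightarrow> h \<in> adjoins A bs \<Longrightarrow> h \<noteq> 0 \<Longrightarrow>
    \<exists>a\<in>A - {0}. \<forall>\<phi>. ring_hom_on A \<phi> \<and> \<phi> a \<noteq> 0 \<longrightarrow>
      (\<exists>\<psi>. ring_hom_on (adjoins A bs) \<psi> \<and> (\<forall>x\<in>A. \<psi> x = \<phi> x) \<and> \<psi> h \<noteq> 0)"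
proof (induction bs arbitrary: A)
  case Nil
  then show ?case by (intro bexI[of _ h]) auto
next
  case (Cons b bs)
  note sub = subring_adjoin[OF Cons.prems(1), of b] subset_adjoin[OF Cons.prems(1), of b]
  obtain a1 where a1: "a1 \<in> adjoin A b - {0}" "\<And>\<phi>. ring_hom_on (adjoin A b) \<phi> \<Longrightarrow> \<phi> a1 \<noteq> 0 \<Longrightarrow>
      (\<exists>\<psi>. ring_hom_on (adjoins (adjoin A b) bs) \<psi> \<and> (\<forall>x\<in>adjoin A b. \<psi> x = \<phi> x) \<and> \<psi> h \<noteq> 0)"
    using Cons.IH[OF sub(1)] Cons.prems by auto
  then obtain a where a: "a \<in> A - {0}" "\<And>\<phi>. ring_hom_on A \<phi> \<Longrightarrow> \<phi> a \<noteq> 0 \<Longrightarrow>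
      (\<exists>\<psi>. ring_hom_on (adjoin A b) \<psi> \<and> (\<forall>x\<in>A. \<psi> x = \<phi> x) \<and> \<psi> a1 \<noteq> 0)"
    using hom_extend_step[OF Cons.prems(1), of a1 b] by blast
  show ?case
  proof (intro bexI[of _ a] allI impI, goal_cases)
    case (1 \<phi>)
    then obtain \<psi> where \<psi>: "ring_hom_on (adjoin A b) \<psi>" "\<forall>x\<in>A. \<psi> x = \<phi> x" "\<psi> a1 \<noteq> 0"
      using a by blast
    from a1(2)[OF \<psi>(1,3)] \<psi>(2) sub(2) show ?case by (metis adjoins.simps(2) subsetD)
  qed (use a in auto)
qed


section \<open>Images of polynomial maps\<close>

lemma peval_eqI:
  fixes f g :: "nat cpoly"
  shows "(\<And>z. peval f z = peval g z) \<Longrightarrow> f = g"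
  using exists_peval_nonzero[of "f - g"] by auto

abbreviation pvar :: "'x \<Rightarrow> 'x cpoly" where
  "pvar i \<equiv> Poly_Mapping.single (Poly_Mapping.single i 1) 1"

abbreviation pconst :: "complex \<Rightarrow> 'x cpoly" where
  "pconst c \<equiv> Poly_Mapping.single 0 c"

definition pvars :: "'x cpoly \<Rightarrow> 'x set" where
  "pvars f = (\<Union>a\<in>Poly_Mapping.keys f. Poly_Mapping.keys a)"

lemma finite_pvars: "finite (pvars f)"
  by (simp add: pvars_def)

lemma pvar_expansion:
  fixes f :: "nat cpoly"
  shows "f = (\<Sum>a\<in>Poly_Mapping.keys f. pconst (Poly_Mapping.lookup f a) *
    (\<Prod>i\<in>Poly_Mapping.keys a. pvar i ^ Poly_Mapping.lookup a i))"
  by (rule peval_eqI, subst peval_def[of f]) simp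

text \<open>This turns an extended homomorphism back into a point: if it fixes the constants, it is
  evaluation at the images of the variables. Only the variables occurring in \<open>f\<close> are
  asked to lie in \<open>A\<close>, since only finitely many get adjoined.\<close>

lemma pvar_expansion_hom:
  fixes f :: "nat cpoly"
  assumes A: "is_subring A" "\<And>c. pconst c \<in> A" "pvar ` pvars f \<subseteq> A"
    and \<psi>: "ring_hom_on A \<psi>" "\<And>c. \<psi> (pconst c) = c"
  shows "f \<in> A" "\<psi> f = peval f (\<lambda>i. \<psi> (pvar i))"
proof -
  let ?m = "\<lambda>a. \<Prod>i\<in>Poly_Mapping.keys a. pvar i ^ Poly_Mapping.lookup a i"
  let ?t = "\<lambda>a. pconst (Poly_Mapping.lookup f a) * ?m a"
  have v: "pvar i \<in> A" if "a \<in> Poly_Mapping.keys f" "i \<in> Poly_Mapping.keys a" for a i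
    using A(3) that by (auto simp: pvars_def)
  have m: "?m a \<in> A" if "a \<in> Poly_Mapping.keys f" for a
    using v[OF that] A by (intro subring_prod subring_power) auto
  have t: "?t a \<in> A" if "a \<in> Poly_Mapping.keys f" for a
    using m[OF that] A by (intro subring_closed(6)) auto
  have "(\<Sum>a\<in>Poly_Mapping.keys f. ?t a) \<in> A"
    using t A by (intro subring_sum) auto
  then show "f \<in> A" by (simp only: pvar_expansion[symmetric])
  have "\<psi> (?t a) = Poly_Mapping.lookup f a * (\<Prod>i\<in>Poly_Mapping.keys a. \<psi> (pvar i) ^ Poly_Mapping.lookup a i)"
    if a: "a \<in> Poly_Mapping.keys f" for a
  proof -
    have "\<psi> (?t a) = Poly_Mapping.lookup f a * \<psi> (?m a)"
      using \<psi> A m[OF a] by (simp add: ring_hom_on_def)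
    also have "\<psi> (?m a) = (\<Prod>i\<in>Poly_Mapping.keys a. \<psi> (pvar i ^ Poly_Mapping.lookup a i))"
      using v[OF a] A by (intro hom_on_prod[OF \<psi>(1) A(1)] subring_power) auto
    also have "\<dots> = (\<Prod>i\<in>Poly_Mapping.keys a. \<psi> (pvar i) ^ Poly_Mapping.lookup a i)"
      using v[OF a] by (intro prod.cong refl hom_on_power[OF \<psi>(1) A(1)]) auto
    finally show ?thesis .
  qed
  then have "\<psi> (\<Sum>a\<in>Poly_Mapping.keys f. ?t a) = peval f (\<lambda>i. \<psi> (pvar i))"
    using t by (simp add: hom_on_sum[OF \<psi>(1) A(1)] peval_def)
  then show "\<psi> f = peval f (\<lambda>i. \<psi> (pvar i))" by (simp only: pvar_expansion[symmetric])
qed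

text \<open>The case of Chevalley's theorem that is needed: the image of the open set \<open>h \<noteq> 0\<close> under a
  polynomial map contains a nonempty open subset of its closure.\<close>

lemma image_contains_open_of_closure:
  fixes \<Phi> :: "'k \<Rightarrow> nat cpoly" and h :: "nat cpoly"
  assumes fin: "finite {a. \<Phi> a \<noteq> 0}" and h: "h \<noteq> 0"
  obtains Q :: "'k cpoly" where "\<exists>z. peval Q (\<lambda>a. peval (\<Phi> a) z) \<noteq> 0"
    "\<And>y. (\<And>Q'. (\<And>z. peval Q' (\<lambda>a. peval (\<Phi> a) z) = 0) \<Longrightarrow> peval Q' y = 0) \<Longrightarrow> peval Q y \<noteq> 0 \<Longrightarrow>
      \<exists>z. peval h z \<noteq> 0 \<and> (\<forall>a. peval (\<Phi> a) z = y a)"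
proof -
  \<comment> \<open>\<open>A\<close> consists of the polynomials that factor through \<Phi>; it is
    the coordinate ring of the closure of the image. Factoring is expressed by values, which makes
    its stability under ring operations immediate.\<close>
  define rep where "rep f Q \<longleftrightarrow> (\<forall>z. peval f z = peval Q (\<lambda>a. peval (\<Phi> a) z))" for f and Q :: "'k cpoly"
  define A where "A = {f. \<exists>Q. rep f Q}"
  have rep_closed: "rep 1 1" "rep (pconst c) (pconst c)" "rep (\<Phi> a) (pvar a)" for c a
    by (simp_all add: rep_def)
  have rep_op: "rep (f + g) (Q + Q')" "rep (f - g) (Q - Q')" "rep (f * g) (Q * Q')"
    if "rep f Q" "rep g Q'" for f g Q Q'
    using that by (simp_all add: rep_def)
  have A: "is_subring A"
    unfolding is_subring_def
  proof (intro conjI ballI)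
    show "1 \<in> A" unfolding A_def using rep_closed(1) by blast
    fix g g' assume "g \<in> A" "g' \<in> A"
    then obtain R R' where R: "rep g R" "rep g' R'" unfolding A_def by blast
    show "g - g' \<in> A" "g * g' \<in> A" unfolding A_def using rep_op[OF R] by blast+
  qed
  \<comment> \<open>Finitely many variables reach \<open>h\<close> and all nonzero coordinates of
    \<Phi>, so \<open>C\<close> arises from \<open>A\<close> by finitely many adjunctions.\<close>
  define V where "V = (\<Union>f\<in>insert h (\<Phi> ` {a. \<Phi> a \<noteq> 0}). pvars f)"
  have "finite V" unfolding V_def using fin by (auto intro: finite_pvars)
  then obtain vs where V: "set vs = V" using finite_list by blast
  define C where "C = adjoins A (map pvar vs)"
  have C: "is_subring C" "A \<subseteq> C" "pvar ` V \<subseteq> C"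
    using adjoins_closed[OF A, of "map pvar vs"] V by (auto simp: C_def)
  have const: "pconst c \<in> A" for c
    using rep_closed by (auto simp: A_def)
  have "h \<in> C"
  proof -
    have "(\<Sum>a\<in>Poly_Mapping.keys h. pconst (Poly_Mapping.lookup h a) *
        (\<Prod>i\<in>Poly_Mapping.keys a. pvar i ^ Poly_Mapping.lookup a i)) \<in> C"
      using C const
      by (intro subring_sum subring_closed(6) subring_prod subring_power) (auto simp: V_def pvars_def)
    then show ?thesis by (simp only: pvar_expansion[symmetric])
  qed
  from hom_extend[OF A this[unfolded C_def] h, folded C_def]
  obtain f where f: "f \<in> A - {0}" and ext: "\<forall>\<phi>. ring_hom_on A \<phi> \<and> \<phi> f \<noteq> 0 \<longrightarrow>
      (\<exists>\<psi>. ring_hom_on C \<psi> \<and> (\<forall>x\<in>A. \<psi> x = \<phi> x) \<and> \<psi> h \<noteq> 0)"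
    by (elim bexE)
  from f have f: "f \<in> A" "f \<noteq> 0" by simp_all
  obtain Q where Q: "rep f Q" using f by (auto simp: A_def)
  show ?thesis
  proof (rule that)
    show "\<exists>z. peval Q (\<lambda>a. peval (\<Phi> a) z) \<noteq> 0"
      using exists_peval_nonzero[OF f(2)] Q by (auto simp: rep_def)
    fix y assume y: "\<And>Q'. (\<And>z. peval Q' (\<lambda>a. peval (\<Phi> a) z) = 0) \<Longrightarrow> peval Q' y = 0"
      and Qy: "peval Q y \<noteq> 0"
    \<comment> \<open>A point \<open>y\<close> satisfying all relations among the coordinates of
      \<Phi> is a homomorphism on \<open>A\<close>: two representatives of \<open>g\<close> differ
      by a relation, so the choice made here does not affect the value at \<open>y\<close>.\<close>
    define \<phi> where "\<phi> g = peval (SOME Q. rep g Q) y" for g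
    have \<phi>: "\<phi> g = peval Q' y" if "rep g Q'" for g Q'
    proof -
      define R where "R = (SOME Q. rep g Q)"
      have "rep g R" unfolding R_def using that by (rule someI)
      then have "peval (R - Q') (\<lambda>a. peval (\<Phi> a) z) = 0" for z
        using that by (simp add: rep_def)
      then have "peval (R - Q') y = 0" by (rule y)
      then show ?thesis by (simp add: \<phi>_def flip: R_def)
    qed
    have "ring_hom_on A \<phi>"
      unfolding ring_hom_on_def
    proof (intro conjI ballI)
      show "\<phi> 1 = 1" by (subst \<phi>[OF rep_closed(1)]) simp
      fix g g' assume "g \<in> A" "g' \<in> A"
      then obtain R R' where R: "rep g R" "rep g' R'" unfolding A_def by blast
      show "\<phi> (g + g') = \<phi> g + \<phi> g'" "\<phi> (g * g') = \<phi> g * \<phi> g'"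
        by (simp_all only: \<phi>[OF R(1)] \<phi>[OF R(2)] \<phi>[OF rep_op(1)[OF R]] \<phi>[OF rep_op(3)[OF R]]
            peval_add peval_mult)
    qed
    moreover have "\<phi> f \<noteq> 0" using \<phi>[OF Q] Qy by simp
    ultimately obtain \<psi> where \<psi>: "ring_hom_on C \<psi>" "\<And>x. x \<in> A \<Longrightarrow> \<psi> x = \<phi> x" "\<psi> h \<noteq> 0"
      using ext[rule_format, of \<phi>] by metis
    have \<psi>const: "\<psi> (pconst c) = c" for c
      using \<psi>(2)[OF const] \<phi>[OF rep_closed(2)] by simp
    have eval: "\<psi> g = peval g (\<lambda>i. \<psi> (pvar i))" if "pvars g \<subseteq> V" for g
    proof (rule pvar_expansion_hom(2)[OF C(1) _ _ \<psi>(1) \<psi>const])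
      show "pconst c \<in> C" for c using const C(2) by blast
      show "pvar ` pvars g \<subseteq> C" using that C(3) by blast
    qed
    show "\<exists>z. peval h z \<noteq> 0 \<and> (\<forall>a. peval (\<Phi> a) z = y a)"
    proof (intro exI conjI allI)
      show "peval h (\<lambda>i. \<psi> (pvar i)) \<noteq> 0"
        using eval[of h] \<psi>(3) by (auto simp: V_def)
      fix a
      have "pvars (\<Phi> a) \<subseteq> V"
        unfolding V_def pvars_def by (cases "\<Phi> a = 0") auto
      then have 1: "peval (\<Phi> a) (\<lambda>i. \<psi> (pvar i)) = \<psi> (\<Phi> a)"
        by (rule eval[symmetric])
      have "\<Phi> a \<in> A" unfolding A_def by (intro CollectI exI) (rule rep_closed(3))
      then have 2: "\<psi> (\<Phi> a) = \<phi> (\<Phi> a)" by (rule \<psi>(2))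
      have 3: "\<phi> (\<Phi> a) = y a" by (subst \<phi>[OF rep_closed(3)]) simp
      show "peval (\<Phi> a) (\<lambda>i. \<psi> (pvar i)) = y a"
        by (simp only: 1 2 3)
    qed
  qed
qed


section \<open>Smooth complete fans\<close>

lemma inner_lattice_vec: "inner (lattice_vec m) (lattice_vec w) = of_int (dual_pairing m w)"
  by (simp add: lattice_vec_def dual_pairing_def inner_vec_def)

lemma lattice_vec_nth [simp]: "vec_nth (lattice_vec m) j = of_int (vec_nth m j)"
  by (simp add: lattice_vec_def)

text \<open>The matrix expressing the standard basis in terms of \<open>e\<close> is the inverse of
  \<open>e\<close>, and its columns are the dual basis. The last two facts are the coordinate
  expansions of integral and of real vectors; the first follows from uniqueness of
  coordinates.\<close>

lemma lattice_basis_dual: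
  fixes e :: "'d::finite \<Rightarrow> int^'d"
  assumes "lattice_basis e"
  obtains \<delta> :: "'d \<Rightarrow> int^'d" where
    "\<And>j k. dual_pairing (\<delta> k) (e j) = (if j = k then 1 else 0)"
    "\<And>x. x = (\<Sum>k\<in>UNIV. dual_pairing (\<delta> k) x *s e k)"
    "\<And>x. x = (\<Sum>k\<in>UNIV. (inner (lattice_vec (\<delta> k)) x) *\<^sub>R lattice_vec (e k))"
proof -
  have ex: "\<exists>!c. x = (\<Sum>j\<in>UNIV. c j *s e j)" for x :: "int^'d"
    using assms by (simp add: lattice_basis_def)
  then have "\<exists>c. \<forall>i. (axis i 1 :: int^'d) = (\<Sum>j\<in>UNIV. c i j *s e j)"
    by (intro choice allI ex1_implies_ex)
  then obtain c where c: "\<And>i. (axis i 1 :: int^'d) = (\<Sum>j\<in>UNIV. c i j *s e j)" by (elim exE) (rule that, simp)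
  define \<delta> :: "'d \<Rightarrow> int^'d" where "\<delta> k = (\<chi> i. c i k)" for k
  have comp: "(if i = l then 1 else 0) = (\<Sum>k\<in>UNIV. c i k * vec_nth (e k) l)" for i l
    using arg_cong[OF c[of i], of "\<lambda>x. vec_nth x l"] by (auto simp: axis_def)
  have expand: "x = (\<Sum>k\<in>UNIV. dual_pairing (\<delta> k) x *s e k)" for x
  proof (rule Finite_Cartesian_Product.vec_eq_iff[THEN iffD2], rule allI)
    fix l
    have "vec_nth (\<Sum>k\<in>UNIV. dual_pairing (\<delta> k) x *s e k) l = (\<Sum>k\<in>UNIV. \<Sum>i\<in>UNIV. vec_nth x i * (c i k * vec_nth (e k) l))"
      by (simp add: dual_pairing_def \<delta>_def sum_distrib_right sum_distrib_left mult_ac)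
    also have "\<dots> = (\<Sum>i\<in>UNIV. vec_nth x i * (\<Sum>k\<in>UNIV. c i k * vec_nth (e k) l))"
      by (subst sum.swap) (simp add: sum_distrib_left)
    also have "\<dots> = vec_nth x l" by (simp add: if_distrib[of "(*) _"] cong: if_cong flip: comp)
    finally show "vec_nth x l = vec_nth (\<Sum>k\<in>UNIV. dual_pairing (\<delta> k) x *s e k) l" ..
  qed
  have expand_real: "x = (\<Sum>k\<in>UNIV. (inner (lattice_vec (\<delta> k)) x) *\<^sub>R lattice_vec (e k))" for x
  proof (rule Finite_Cartesian_Product.vec_eq_iff[THEN iffD2], rule allI)
    fix l
    have "vec_nth (\<Sum>k\<in>UNIV. (inner (lattice_vec (\<delta> k)) x) *\<^sub>R lattice_vec (e k)) l
        = (\<Sum>k\<in>UNIV. \<Sum>i\<in>UNIV. vec_nth x i * of_int (c i k * vec_nth (e k) l))"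
      by (simp add: inner_vec_def \<delta>_def sum_distrib_right sum_distrib_left mult_ac)
    also have "\<dots> = (\<Sum>i\<in>UNIV. vec_nth x i * of_int (\<Sum>k\<in>UNIV. c i k * vec_nth (e k) l))"
      by (subst sum.swap) (simp add: sum_distrib_left)
    also have "\<dots> = vec_nth x l" by (simp add: if_distrib cong: if_cong flip: comp)
    finally show "vec_nth x l = vec_nth (\<Sum>k\<in>UNIV. (inner (lattice_vec (\<delta> k)) x) *\<^sub>R lattice_vec (e k)) l" ..
  qed
  have "dual_pairing (\<delta> k) (e j) = (if j = k then 1 else 0)" for j k
  proof -
    have indicator: "e j = (\<Sum>k\<in>UNIV. (if j = k then 1 else 0) *s e k)"
      by (simp add: if_distrib[of "\<lambda>a. a *s _"] cong: if_cong)
    obtain c0 where "\<And>c. e j = (\<Sum>k\<in>UNIV. c k *s e k) \<Longrightarrow> c = c0"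
      using ex[of "e j"] by (elim ex1E) blast
    from this[of "\<lambda>k. dual_pairing (\<delta> k) (e j)", OF expand] this[of "\<lambda>k. if j = k then 1 else 0", OF indicator]
    have "(\<lambda>k. dual_pairing (\<delta> k) (e j)) = (\<lambda>k. if j = k then 1 else 0)" by simp
    then show ?thesis by (rule fun_cong)
  qed
  with expand expand_real show ?thesis using that by blast
qed

lemma convex_cone_hull_singleton:
  fixes w :: "'a::real_vector"
  shows "convex_cone hull {w} = {c *\<^sub>R w |c. c \<ge> 0}"
  by (subst convex_cone_hull_convex_hull) (force simp: intro: exI[of _ 0])

lemma smooth_cone_nonneg:
  fixes e :: "'d::finite \<Rightarrow> int^'d"
  assumes dual: "\<And>j k. dual_pairing (\<delta> k) (e j) = (if j = k then 1 else 0)"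
    and x: "x \<in> convex_cone hull (lattice_vec ` e ` A)"
  shows "inner (lattice_vec (\<delta> k)) x \<ge> 0" "k \<notin> A \<Longrightarrow> inner (lattice_vec (\<delta> k)) x = 0"
proof -
  have *: "inner (lattice_vec (\<delta> k)) (lattice_vec (e j)) = (if j = k then 1 else 0)" for j
    by (simp add: inner_lattice_vec dual)
  have "convex_cone hull (lattice_vec ` e ` A) \<subseteq> {x. inner (lattice_vec (\<delta> k)) x \<ge> 0}"
    by (rule hull_minimal) (auto simp: * convex_cone_iff inner_add_right)
  then show "inner (lattice_vec (\<delta> k)) x \<ge> 0" using x by blast
  have "convex_cone hull (lattice_vec ` e ` A) \<subseteq> {x. inner (lattice_vec (\<delta> k)) x = 0}" if "k \<notin> A"
    by (rule hull_minimal) (use that in \<open>auto simp: * convex_cone_iff inner_add_right\<close>)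
  then show "inner (lattice_vec (\<delta> k)) x = 0" if "k \<notin> A" using x that by blast
qed

text \<open>A single generator of a smooth cone spans a face, hence a ray of the fan, which some
  \<open>u i\<close> generates as well. Since \<open>u i\<close> is primitive and a nonnegative
  integral multiple of \<open>e j\<close>, the two agree.\<close>

lemma ray_of_smooth_cone:
  fixes e :: "'d::finite \<Rightarrow> int^'d" and u :: "'n \<Rightarrow> int^'d"
  assumes fan: "is_fan \<Delta>" and rays: "ray_generators \<Delta> u" and basis: "lattice_basis e"
    and \<sigma>: "\<sigma> \<in> \<Delta>" "\<sigma> = convex_cone hull (lattice_vec ` e ` A)" and j: "j \<in> A"
  obtains i where "u i = e j"
proof -
  obtain \<delta> where dual: "\<And>j k. dual_pairing (\<delta> k) (e j) = (if j = k then 1 else 0)"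
    and expand: "\<And>x. x = (\<Sum>k\<in>UNIV. (inner (lattice_vec (\<delta> k)) x) *\<^sub>R lattice_vec (e k))"
    using lattice_basis_dual[OF basis] by metis
  have dual': "inner (lattice_vec (\<delta> k)) (lattice_vec (e j)) = (if j = k then 1 else 0)" for j k
    by (simp add: inner_lattice_vec dual)
  define w where "w = lattice_vec (e j)"
  have "w \<noteq> 0" using dual'[of j j] by (auto simp: w_def)
  \<comment> \<open>The sum of the other dual coordinates: it is nonnegative on the cone and
    vanishes there only along the ray of \<open>e j\<close>.\<close>
  define a where "a = (\<Sum>k\<in>A - {j}. lattice_vec (\<delta> k))"
  define T where "T = convex_cone hull {w}"
  have "T = \<sigma> \<inter> {x. inner a x = 0}"
  proof (intro subset_antisym subsetI)
    fix x assume "x \<in> T"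
    then obtain c where c: "c \<ge> 0" "x = c *\<^sub>R w" by (auto simp: T_def convex_cone_hull_singleton)
    have "w \<in> \<sigma>" using j unfolding \<sigma>(2) w_def by (intro hull_inc) auto
    then have "x \<in> \<sigma>" using c unfolding \<sigma>(2) by (simp add: convex_cone_hull_mul)
    moreover have "inner a w = 0" by (simp add: a_def w_def inner_sum_left dual')
    ultimately show "x \<in> \<sigma> \<inter> {x. inner a x = 0}" using c by simp
  next
    fix x assume x: "x \<in> \<sigma> \<inter> {x. inner a x = 0}"
    note nonneg = smooth_cone_nonneg[OF dual, of x A]
    have "(\<Sum>k\<in>A - {j}. inner (lattice_vec (\<delta> k)) x) = 0"
      using x by (simp add: a_def inner_sum_left)
    then have "inner (lattice_vec (\<delta> k)) x = 0" if "k \<in> A - {j}" for k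
      using that x nonneg by (subst (asm) sum_nonneg_eq_0_iff) (auto simp: \<sigma>(2))
    then have "inner (lattice_vec (\<delta> k)) x = 0" if "k \<noteq> j" for k
      using that x nonneg(2)[of k] \<sigma>(2) by (cases "k \<in> A") auto
    then have "(\<Sum>k\<in>UNIV. (inner (lattice_vec (\<delta> k)) x) *\<^sub>R lattice_vec (e k))
        = (\<Sum>k\<in>{j}. (inner (lattice_vec (\<delta> k)) x) *\<^sub>R lattice_vec (e k))"
      by (intro sum.mono_neutral_right) auto
    then have "x = (inner (lattice_vec (\<delta> j)) x) *\<^sub>R w" using expand[of x] by (simp add: w_def)
    then show "x \<in> T" using nonneg(1)[of j] x \<sigma>(2) unfolding T_def convex_cone_hull_singleton by blast
  qed
  moreover have "(\<sigma> \<inter> {x. inner a x = 0}) face_of \<sigma>"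
  proof (rule face_of_Int_supporting_hyperplane_ge)
    show "convex \<sigma>" unfolding \<sigma>(2) by (rule convex_convex_cone_hull)
    show "inner a x \<ge> 0" if "x \<in> \<sigma>" for x
      unfolding a_def inner_sum_left using that smooth_cone_nonneg(1)[OF dual, of x A] \<sigma>(2)
      by (intro sum_nonneg) auto
  qed
  moreover have "T \<noteq> {}" by (simp add: T_def convex_cone_hull_nonempty)
  ultimately have "T \<in> \<Delta>" using fan \<sigma>(1) by (auto simp: is_fan_def)
  have "w \<in> T" unfolding T_def by (rule hull_inc) simp
  have "dim T = 1"
  proof (rule dim_unique)
    show "{w} \<subseteq> T" using \<open>w \<in> T\<close> by simp
    show "T \<subseteq> span {w}" by (auto simp: T_def convex_cone_hull_singleton span_singleton)
    show "independent {w}" using \<open>w \<noteq> 0\<close> by simp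
  qed simp
  moreover have "0 \<in> T" unfolding T_def by (rule convex_cone_hull_contains_0)
  ultimately have "aff_dim T = 1" by (simp add: aff_dim_zero hull_inc)
  then obtain i where i: "convex_cone hull {lattice_vec (u i)} = T"
  proof -
    have "T \<in> range (\<lambda>i. convex_cone hull {lattice_vec (u i)})"
      using rays \<open>T \<in> \<Delta>\<close> \<open>aff_dim T = 1\<close> unfolding ray_generators_def bij_betw_def by simp
    then show ?thesis using that by blast
  qed
  have "lattice_vec (u i) \<in> T" unfolding i[symmetric] by (rule hull_inc) simp
  then obtain c where c: "c \<ge> 0" "lattice_vec (u i) = c *\<^sub>R w"
    by (auto simp: T_def convex_cone_hull_singleton)
  define n where "n = dual_pairing (\<delta> j) (u i)"
  have "c = inner (lattice_vec (\<delta> j)) (lattice_vec (u i))" by (simp add: c w_def dual')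
  then have cn: "c = of_int n" by (simp add: inner_lattice_vec n_def)
  have ui: "vec_nth (u i) k = n * vec_nth (e j) k" for k
  proof -
    have "lattice_vec (u i) = of_int n *\<^sub>R lattice_vec (e j)"
      using c(2) by (simp only: cn w_def)
    then have "vec_nth (lattice_vec (u i)) k = vec_nth (of_int n *\<^sub>R lattice_vec (e j)) k"
      by (rule arg_cong)
    then have "real_of_int (vec_nth (u i) k) = of_int (n * vec_nth (e j) k)"
      by (simp only: lattice_vec_nth vector_scaleR_component real_scaleR_def of_int_mult)
    then show ?thesis by (simp only: of_int_eq_iff)
  qed
  then have "n dvd Gcd (range (vec_nth (u i)))" by (intro Gcd_greatest) auto
  then have "n dvd 1" using rays by (simp add: ray_generators_def)
  then have "n = 1" using c(1) cn by auto
  then have "u i = e j" using ui by (simp add: Finite_Cartesian_Product.vec_eq_iff)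
  then show ?thesis using that by blast
qed

lemma finite_int_vec_box: "finite {m :: int^'d::finite. \<forall>k. lo k \<le> vec_nth m k \<and> vec_nth m k \<le> hi k}"
proof (rule finite_subset)
  show "{m :: int^'d. \<forall>k. lo k \<le> vec_nth m k \<and> vec_nth m k \<le> hi k} \<subseteq> vec_lambda ` (PiE UNIV (\<lambda>k. {lo k..hi k}))"
    by (auto intro!: rev_image_eqI[of "vec_nth _"])
  show "finite (vec_lambda ` (PiE UNIV (\<lambda>k. {lo k..hi k})) :: (int^'d) set)"
    by (intro finite_imageI finite_PiE) auto
qed

text \<open>Monomials of degree \<alpha> correspond to the lattice points \<open>M\<close> of a
  polyhedron. Completeness puts each real \<open>x\<close> into a cone, where it is a nonnegative
  combination of ray generators, and the inequalities defining \<open>M\<close> bound its pairing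
  with \<open>m\<close> from below. Applied to both signs of the coordinate vectors, this confines
  \<open>M\<close> to a box.\<close>

lemma finite_monomials:
  fixes u :: "'n::finite \<Rightarrow> int^'d::finite"
  assumes fan: "is_fan \<Delta>" "smooth_fan \<Delta>" "complete_fan \<Delta>" "ray_generators \<Delta> u"
    and \<alpha>: "\<alpha> \<in> Pic u"
  shows "finite (monomials \<alpha>)"
proof -
  obtain D where D: "\<alpha> = div_class u D" using \<alpha> by (auto simp: Pic_def)
  define M where "M = {m. \<forall>i. 0 \<le> D i + dual_pairing m (u i)}"
  have "\<exists>C. \<forall>m\<in>M. C \<le> inner (lattice_vec m) x" for x :: "real^'d"
  proof -
    obtain \<sigma> where "\<sigma> \<in> \<Delta>" "x \<in> \<sigma>" using fan(3) by (auto simp: complete_fan_def)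
    then obtain e A where e: "lattice_basis e" "\<sigma> = convex_cone hull (lattice_vec ` e ` A)"
      using fan(2) unfolding smooth_fan_def by blast
    obtain \<delta> where dual: "\<And>j k. dual_pairing (\<delta> k) (e j) = (if j = k then 1 else 0)"
      and expand: "\<And>x. x = (\<Sum>k\<in>UNIV. (inner (lattice_vec (\<delta> k)) x) *\<^sub>R lattice_vec (e k))"
      using lattice_basis_dual[OF e(1)] by metis
    define c where "c k = inner (lattice_vec (\<delta> k)) x" for k
    have c: "c k \<ge> 0" "k \<notin> A \<Longrightarrow> c k = 0" for k
      using smooth_cone_nonneg[OF dual, of x A k] \<open>x \<in> \<sigma>\<close> e(2) by (auto simp: c_def)
    have "\<forall>j\<in>A. \<exists>i. u i = e j"
      using ray_of_smooth_cone[OF fan(1,4) e(1) \<open>\<sigma> \<in> \<Delta>\<close> e(2)] by metis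
    then obtain \<iota> where \<iota>: "\<And>j. j \<in> A \<Longrightarrow> u (\<iota> j) = e j" by metis
    have "(\<Sum>k\<in>UNIV. c k * - of_int (D (\<iota> k))) \<le> inner (lattice_vec m) x" if m: "m \<in> M" for m
    proof -
      have "c k * - of_int (D (\<iota> k)) \<le> c k * of_int (dual_pairing m (e k))" for k
      proof (cases "k \<in> A")
        case True
        have "- D (\<iota> k) \<le> dual_pairing m (u (\<iota> k))" using m by (simp add: M_def minus_le_iff add.commute algebra_simps) (smt (verit))
        then have "- D (\<iota> k) \<le> dual_pairing m (e k)" using \<iota> True by simp
        then have "real_of_int (- D (\<iota> k)) \<le> of_int (dual_pairing m (e k))" by (rule of_int_le_iff[THEN iffD2])
        then show ?thesis using c(1)[of k] by (intro mult_left_mono) auto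
      qed (simp add: c)
      then have "(\<Sum>k\<in>UNIV. c k * - of_int (D (\<iota> k))) \<le> (\<Sum>k\<in>UNIV. c k * of_int (dual_pairing m (e k)))"
        by (rule sum_mono)
      also have "\<dots> = inner (lattice_vec m) (\<Sum>k\<in>UNIV. c k *\<^sub>R lattice_vec (e k))"
        by (simp add: inner_sum_right inner_lattice_vec)
      also have "\<dots> = inner (lattice_vec m) x" using expand[of x] by (simp add: c_def)
      finally show ?thesis .
    qed
    then show ?thesis by blast
  qed
  then have "\<exists>C. \<forall>x. \<forall>m\<in>M. C x \<le> inner (lattice_vec m) x" by (intro choice allI)
  then obtain C where C: "\<And>m x. m \<in> M \<Longrightarrow> C x \<le> inner (lattice_vec m) x" by blast
  define lo where "lo k = \<lfloor>C (axis k 1)\<rfloor>" for k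
  define hi where "hi k = \<lceil>- C (- axis k 1)\<rceil>" for k
  have "M \<subseteq> {m. \<forall>k. lo k \<le> vec_nth m k \<and> vec_nth m k \<le> hi k}"
  proof (intro subsetI CollectI allI)
    fix m k assume "m \<in> M"
    then have "C (axis k 1) \<le> of_int (vec_nth m k)" "C (- axis k 1) \<le> - of_int (vec_nth m k)"
      using C[of m "axis k 1"] C[of m "- axis k 1"] by (simp_all add: inner_axis)
    then show "lo k \<le> vec_nth m k \<and> vec_nth m k \<le> hi k" unfolding lo_def hi_def by linarith
  qed
  then have "finite M" using finite_int_vec_box finite_subset by blast
  moreover have "monomials \<alpha> \<subseteq> (\<lambda>m. Abs_poly_mapping (\<lambda>i. nat (D i + dual_pairing m (u i)))) ` M"
  proof
    fix a assume "a \<in> monomials \<alpha>"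
    then obtain m where m: "\<And>i. int (Poly_Mapping.lookup a i) = D i + dual_pairing m (u i)"
      by (auto simp: monomials_def D div_class_def)
    then have "m \<in> M" by (simp add: M_def flip: m)
    moreover have "a = Abs_poly_mapping (\<lambda>i. nat (D i + dual_pairing m (u i)))"
      by (simp flip: m)
    ultimately show "a \<in> (\<lambda>m. Abs_poly_mapping (\<lambda>i. nat (D i + dual_pairing m (u i)))) ` M" by blast
  qed
  ultimately show ?thesis by (meson finite_imageI finite_subset)
qed

text \<open>Finitely many negligible sets cannot cover the space, so some cone is not negligible; a
  basis vector missing among its generators would put it inside a hyperplane.\<close>

lemma exists_maximal_cone:
  assumes fan: "is_fan \<Delta>" "smooth_fan \<Delta>" "complete_fan \<Delta>"
  obtains e where "lattice_basis e" "convex_cone hull (lattice_vec ` range e) \<in> \<Delta>"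
proof -
  have "\<exists>\<sigma>\<in>\<Delta>. \<not> negligible \<sigma>"
  proof (rule ccontr)
    assume "\<not> ?thesis"
    then have "negligible (\<Union>\<Delta>)" using fan(1) by (intro negligible_Union) (auto simp: is_fan_def)
    then show False using fan(3) by (simp add: complete_fan_def)
  qed
  then obtain \<sigma> where \<sigma>: "\<sigma> \<in> \<Delta>" "\<not> negligible \<sigma>" by blast
  then obtain e A where e: "lattice_basis e" "\<sigma> = convex_cone hull (lattice_vec ` e ` A)"
    using fan(2) unfolding smooth_fan_def by blast
  obtain \<delta> where dual: "\<And>j k. dual_pairing (\<delta> k) (e j) = (if j = k then 1 else 0)"
    using lattice_basis_dual[OF e(1)] by metis
  have "k \<in> A" for k
  proof (rule ccontr)
    assume k: "k \<notin> A"
    have "inner (lattice_vec (\<delta> k)) (lattice_vec (e k)) = 1" by (simp add: inner_lattice_vec dual)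
    then have "lattice_vec (\<delta> k) \<noteq> 0" by auto
    then have "negligible {x. inner (lattice_vec (\<delta> k)) x = 0}" by (intro negligible_hyperplane) auto
    moreover have "\<sigma> \<subseteq> {x. inner (lattice_vec (\<delta> k)) x = 0}"
      using smooth_cone_nonneg(2)[OF dual _ k] e(2) by blast
    ultimately show False using \<sigma>(2) negligible_subset by blast
  qed
  then have "A = UNIV" by blast
  then show ?thesis using that e \<sigma>(1) by blast
qed

section \<open>Characters of the Cox torus\<close>

lemma dual_pairing_linear:
  "dual_pairing m (a + b) = dual_pairing m a + dual_pairing m b"
  "dual_pairing (m + m') a = dual_pairing m a + dual_pairing m' a"
  "dual_pairing (m - m') a = dual_pairing m a - dual_pairing m' a"
  "dual_pairing m (c *s a) = c * dual_pairing m a"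
  "dual_pairing (c *s m) a = c * dual_pairing m a"
  "dual_pairing m 0 = 0" "dual_pairing 0 a = 0"
  by (simp_all add: dual_pairing_def algebra_simps sum.distrib sum_distrib_left sum_subtractf)

lemma dual_pairing_sum:
  "dual_pairing m (\<Sum>x\<in>A. f x) = (\<Sum>x\<in>A. dual_pairing m (f x))"
  "dual_pairing (\<Sum>x\<in>A. g x) w = (\<Sum>x\<in>A. dual_pairing (g x) w)"
  by (induction A rule: infinite_finite_induct) (simp_all add: dual_pairing_linear)

lemma prod_powi_base: "(b::complex) \<noteq> 0 \<Longrightarrow> (\<Prod>i\<in>A. (b powi s i) powi c i) = b powi (\<Sum>i\<in>A. s i * c i)"
  by (induction A rule: infinite_finite_induct) (simp_all add: power_int_add power_int_mult)

lemma prod_powi_add: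
  "(\<And>i. t i \<noteq> (0::complex)) \<Longrightarrow> (\<Prod>i\<in>A. t i powi (c i + d i)) = (\<Prod>i\<in>A. t i powi c i) * (\<Prod>i\<in>A. t i powi d i)"
  by (simp add: power_int_add prod.distrib)

text \<open>The columns of a maximal smooth cone are a lattice basis, so modulo characters of \<open>M\<close> an
  exponent vector can be cleared there; the one parameter subgroup of a remaining nonzero entry then
  detects it.\<close>

lemma cox_torus_separates:
  fixes u :: "'n::finite \<Rightarrow> int^'d::finite"
  assumes fan: "is_fan \<Delta>" "smooth_fan \<Delta>" "complete_fan \<Delta>" "ray_generators \<Delta> u"
    and c: "\<nexists>m. \<forall>i. c i = dual_pairing m (u i)"
  shows "\<exists>t\<in>cox_torus u. (\<Prod>i\<in>UNIV. t i powi c i) \<noteq> 1"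
proof -
  obtain e where e: "lattice_basis e" "convex_cone hull (lattice_vec ` range e) \<in> \<Delta>"
    using exists_maximal_cone[OF fan(1-3)] by blast
  obtain \<delta> where dual: "\<And>j k. dual_pairing (\<delta> k) (e j) = (if j = k then 1 else 0)"
    and expand: "\<And>x. x = (\<Sum>k\<in>UNIV. dual_pairing (\<delta> k) x *s e k)"
    using lattice_basis_dual[OF e(1)] by metis
  have "\<forall>j. \<exists>i. u i = e j"
    using ray_of_smooth_cone[OF fan(1,4) e(1) e(2) refl] by (metis UNIV_I)
  then obtain \<iota> where \<iota>: "\<And>j. u (\<iota> j) = e j" by metis
  have inj: "inj \<iota>"
    by (rule injI) (metis \<iota> dual zero_neq_one)
  define m where "m = (\<Sum>k\<in>UNIV. c (\<iota> k) *s \<delta> k)"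
  define c' where "c' i = c i - dual_pairing m (u i)" for i
  have c'0: "c' (\<iota> j) = 0" for j
    by (simp add: c'_def m_def \<iota> dual_pairing_sum dual_pairing_linear dual
        if_distrib[of "(*) _"] cong: if_cong)
  obtain i0 where i0: "c' i0 \<noteq> 0"
    using c by (auto simp: c'_def)
  then have i0_notin: "i0 \<notin> range \<iota>" using c'0 by auto
  \<comment> \<open>The coefficients of the relation that expresses \<open>u i0\<close> through the
    basis vectors \<open>u (\<iota> j)\<close>. This relation pairs to zero with every
    \<open>m\<close>, which is the condition for powers with exponents \<open>s\<close> to lie in
    the Cox torus.\<close>
  define s where "s i = (if i = i0 then 1 else if i \<in> range \<iota>
    then - dual_pairing (\<delta> (inv_into UNIV \<iota> i)) (u i0) else 0)" for i
  have s_sum: "(\<Sum>i\<in>UNIV. s i * f i) = f i0 - (\<Sum>j\<in>UNIV. dual_pairing (\<delta> j) (u i0) * f (\<iota> j))" for f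
  proof -
    have "(\<Sum>i\<in>UNIV. s i * f i) = (\<Sum>i\<in>insert i0 (range \<iota>). s i * f i)"
      by (rule sum.mono_neutral_right) (auto simp: s_def)
    also have "\<dots> = f i0 + (\<Sum>j\<in>UNIV. s (\<iota> j) * f (\<iota> j))"
      using i0_notin inj by (simp add: sum.reindex s_def[of i0])
    also have "(\<Sum>j\<in>UNIV. s (\<iota> j) * f (\<iota> j)) = (\<Sum>j\<in>UNIV. - (dual_pairing (\<delta> j) (u i0) * f (\<iota> j)))"
      using i0_notin inj by (intro sum.cong) (auto simp: s_def)
    finally show ?thesis by (simp add: sum_negf)
  qed
  \<comment> \<open>Since 2 is not a root of unity, the surviving power \<open>2 powi c' i0\<close>
    differs from 1.\<close>
  define t where "t i = (2::complex) powi s i" for i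
  have t0: "t i \<noteq> 0" for i by (simp add: t_def)
  have kernel: "(\<Prod>i\<in>UNIV. t i powi dual_pairing m (u i)) = 1" for m
  proof -
    have "(\<Sum>i\<in>UNIV. s i * dual_pairing m (u i)) = 0"
      using arg_cong[OF expand[of "u i0"], of "dual_pairing m"]
      by (simp add: s_sum \<iota> dual_pairing_sum dual_pairing_linear)
    then show ?thesis unfolding t_def by (subst prod_powi_base) auto
  qed
  then have "t \<in> cox_torus u" using t0 by (simp add: cox_torus_def)
  moreover have "(\<Prod>i\<in>UNIV. t i powi c i) \<noteq> 1"
  proof -
    have "(\<Prod>i\<in>UNIV. t i powi c i) = (\<Prod>i\<in>UNIV. t i powi (c' i + dual_pairing m (u i)))"
      by (simp add: c'_def)
    also have "\<dots> = (\<Prod>i\<in>UNIV. t i powi c' i)"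
      using t0 kernel[of m] by (subst prod_powi_add) auto
    also have "\<dots> = 2 powi c' i0"
      unfolding t_def by (subst prod_powi_base) (auto simp: s_sum c'0)
    finally have eq: "(\<Prod>i\<in>UNIV. t i powi c i) = 2 powi c' i0" .
    have "norm ((2::complex) powi c' i0) \<noteq> 1"
      using i0 powr_real_of_int'[of 2 "c' i0"] powr_eq_one_iff[of 2 "of_int (c' i0)"]
      by (simp add: norm_power_int)
    then show ?thesis unfolding eq by (metis norm_one)
  qed
  ultimately show ?thesis by blast
qed


section \<open>Homogeneity and apolarity\<close>

definition mono_class :: "('n \<Rightarrow> int^'d::finite) \<Rightarrow> ('n \<Rightarrow>\<^sub>0 nat) \<Rightarrow> ('n \<Rightarrow> int) set" where
  "mono_class u a = div_class u (\<lambda>i. int (Poly_Mapping.lookup a i))"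

lemma mem_div_class_self: "D \<in> div_class u D"
  by (auto simp: div_class_def dual_pairing_linear intro!: exI[of _ 0])

lemma div_class_eq_iff: "div_class u D = div_class u D' \<longleftrightarrow> (\<exists>m. \<forall>i. D' i = D i + dual_pairing m (u i))"
proof
  assume "div_class u D = div_class u D'"
  then have "D' \<in> div_class u D" by (simp only: mem_div_class_self)
  then show "\<exists>m. \<forall>i. D' i = D i + dual_pairing m (u i)" by (simp add: div_class_def)
next
  assume "\<exists>m. \<forall>i. D' i = D i + dual_pairing m (u i)"
  then obtain m where m: "\<And>i. D' i = D i + dual_pairing m (u i)" by blast
  have "(\<exists>m. \<forall>i. E i = D i + dual_pairing m (u i)) \<longleftrightarrow> (\<exists>m. \<forall>i. E i = D' i + dual_pairing m (u i))" for E
  proof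
    assume "\<exists>m. \<forall>i. E i = D i + dual_pairing m (u i)"
    then obtain m' where "\<And>i. E i = D i + dual_pairing m' (u i)" by blast
    then show "\<exists>m. \<forall>i. E i = D' i + dual_pairing m (u i)"
      by (intro exI[of _ "m' - m"]) (simp add: m dual_pairing_linear)
  next
    assume "\<exists>m. \<forall>i. E i = D' i + dual_pairing m (u i)"
    then obtain m' where "\<And>i. E i = D' i + dual_pairing m' (u i)" by blast
    then show "\<exists>m. \<forall>i. E i = D i + dual_pairing m (u i)"
      by (intro exI[of _ "m + m'"]) (simp add: m dual_pairing_linear)
  qed
  then show "div_class u D = div_class u D'" by (simp add: div_class_def)
qed

lemma mono_class_Pic [simp]: "mono_class u a \<in> Pic u"
  by (simp add: mono_class_def Pic_def)

lemma monomials_iff: "\<alpha> \<in> Pic u \<Longrightarrow> a \<in> monomials \<alpha> \<longleftrightarrow> mono_class u a = \<alpha>"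
proof -
  assume "\<alpha> \<in> Pic u"
  then obtain D where D: "\<alpha> = div_class u D" by (auto simp: Pic_def)
  have "a \<in> monomials \<alpha> \<longleftrightarrow> div_class u D = div_class u (\<lambda>i. int (Poly_Mapping.lookup a i))"
    unfolding div_class_eq_iff by (simp add: monomials_def D div_class_def)
  then show ?thesis by (auto simp: D mono_class_def)
qed

lemma mono_class_add_cancel: "mono_class u (a + c) = mono_class u (b + c) \<longleftrightarrow> mono_class u a = mono_class u b"
  by (simp add: mono_class_def div_class_eq_iff lookup_add algebra_simps)

lemma mono_eval_powi: "mono_eval t a = (\<Prod>i\<in>UNIV. t i powi int (Poly_Mapping.lookup a i))"
  for t :: "'x::finite \<Rightarrow> complex"
  by (simp add: mono_eval_finite)

lemma cox_torus_nonzero: "t \<in> cox_torus u \<Longrightarrow> t i \<noteq> 0"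
  by (simp add: cox_torus_def)

lemma cox_torus_one: "(\<lambda>_. 1) \<in> cox_torus u"
  by (simp add: cox_torus_def)

lemma cox_torus_mult: "s \<in> cox_torus u \<Longrightarrow> t \<in> cox_torus u \<Longrightarrow> (\<lambda>i. s i * t i) \<in> cox_torus u"
  by (simp add: cox_torus_def power_int_mult_distrib prod.distrib)

lemma cox_torus_mono_eval_cong:
  fixes u :: "'n::finite \<Rightarrow> int^'d::finite"
  assumes t: "t \<in> cox_torus u" and eq: "mono_class u a = mono_class u b"
  shows "mono_eval t a = mono_eval t b"
proof -
  obtain m where m: "\<And>i. int (Poly_Mapping.lookup b i) = int (Poly_Mapping.lookup a i) + dual_pairing m (u i)"
    using eq by (auto simp: mono_class_def div_class_eq_iff)
  have "mono_eval t b = (\<Prod>i\<in>UNIV. t i powi (int (Poly_Mapping.lookup a i) + dual_pairing m (u i)))"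
    unfolding mono_eval_powi m ..
  also have "\<dots> = mono_eval t a * (\<Prod>i\<in>UNIV. t i powi dual_pairing m (u i))"
    unfolding mono_eval_powi using cox_torus_nonzero[OF t] by (rule prod_powi_add)
  also have "\<dots> = mono_eval t a" using t by (simp add: cox_torus_def)
  finally show ?thesis ..
qed

lemma cox_torus_separates_monomials:
  fixes u :: "'n::finite \<Rightarrow> int^'d::finite"
  assumes fan: "is_fan \<Delta>" "smooth_fan \<Delta>" "complete_fan \<Delta>" "ray_generators \<Delta> u"
    and neq: "mono_class u a \<noteq> mono_class u b"
  shows "\<exists>t\<in>cox_torus u. mono_eval t a \<noteq> mono_eval t b"
proof -
  define c where "c i = int (Poly_Mapping.lookup b i) - int (Poly_Mapping.lookup a i)" for i
  have "\<nexists>m. \<forall>i. c i = dual_pairing m (u i)"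
    using neq by (auto simp: mono_class_def div_class_eq_iff c_def algebra_simps)
  then obtain t where t: "t \<in> cox_torus u" "(\<Prod>i\<in>UNIV. t i powi c i) \<noteq> 1"
    using cox_torus_separates[OF fan] by blast
  have "mono_eval t b = (\<Prod>i\<in>UNIV. t i powi (int (Poly_Mapping.lookup a i) + c i))"
    unfolding mono_eval_powi c_def by simp
  also have "\<dots> = mono_eval t a * (\<Prod>i\<in>UNIV. t i powi c i)"
    unfolding mono_eval_powi using cox_torus_nonzero[OF t(1)] by (rule prod_powi_add)
  finally have "mono_eval t b \<noteq> mono_eval t a"
    using t mono_eval_nonzero[OF cox_torus_nonzero[OF t(1)]] by simp
  then show ?thesis using t(1) by metis
qed

text \<open>Dedekind's argument for independence of characters: a character \<open>a0\<close> that
  differs from \<open>b\<close> at some \<open>t0\<close> is eliminated by comparing the relation at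
  the product of \<open>t0\<close> and \<open>t\<close> with a multiple of the relation at
  \<open>t\<close>. Different exponents may restrict to the same character on \<open>G\<close>,
  hence only the sum over a class is determined.\<close>

lemma character_sum_component:
  assumes "(\<lambda>_. 1) \<in> G" "\<And>s t. s \<in> G \<Longrightarrow> t \<in> G \<Longrightarrow> (\<lambda>i. s i * t i) \<in> G" "finite K"
    and "\<And>t. t \<in> G \<Longrightarrow> (\<Sum>a\<in>K. c a * mono_eval t a) = 0"
  shows "(\<Sum>a\<in>{a\<in>K. \<forall>t\<in>G. mono_eval t a = mono_eval t b}. c a) = 0"
  using assms(3,4)
proof (induction "card K" arbitrary: K c rule: less_induct)
  case less
  define S where "S K = {a\<in>K. \<forall>t\<in>G. mono_eval t a = mono_eval t b}" for K
  show ?case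
  proof (cases "\<forall>a\<in>K. \<forall>t\<in>G. mono_eval t a = mono_eval t b")
    case True
    then have "{a\<in>K. \<forall>t\<in>G. mono_eval t a = mono_eval t b} = K" by blast
    moreover have "mono_eval (\<lambda>_. 1) a = 1" for a :: "'a \<Rightarrow>\<^sub>0 nat" by (simp add: mono_eval_def)
    ultimately show ?thesis using less.prems(2)[OF assms(1)] by simp
  next
    case False
    then obtain a0 t0 where a0: "a0 \<in> K" "t0 \<in> G" "mono_eval t0 a0 \<noteq> mono_eval t0 b" by blast
    define c' where "c' a = c a * (mono_eval t0 a - mono_eval t0 a0)" for a
    have van: "(\<Sum>a\<in>K - {a0}. c' a * mono_eval t a) = 0" if t: "t \<in> G" for t
    proof -
      have "(\<Sum>a\<in>K - {a0}. c' a * mono_eval t a) = (\<Sum>a\<in>K. c' a * mono_eval t a)"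
        using less.prems(1) by (intro sum.mono_neutral_left) (auto simp: c'_def)
      also have "\<dots> = (\<Sum>a\<in>K. c a * mono_eval (\<lambda>i. t0 i * t i) a) - mono_eval t0 a0 * (\<Sum>a\<in>K. c a * mono_eval t a)"
        by (simp add: c'_def mono_eval_mult sum_distrib_left algebra_simps flip: sum_subtractf)
      also have "\<dots> = 0"
        using less.prems(2)[OF t] less.prems(2)[OF assms(2)[OF a0(2) t]] by simp
      finally show ?thesis .
    qed
    have "card (K - {a0}) < card K" using a0(1) less.prems(1) by (rule card_Diff1_less[rotated])
    from less.hyps[OF this _ van] less.prems(1) have "(\<Sum>a\<in>S (K - {a0}). c' a) = 0"
      by (simp add: S_def)
    moreover have "S (K - {a0}) = S K" using a0 by (auto simp: S_def)
    moreover have "(\<Sum>a\<in>S K. c' a) = (mono_eval t0 b - mono_eval t0 a0) * (\<Sum>a\<in>S K. c a)"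
      using a0(2) by (simp add: S_def c'_def sum_distrib_left mult.commute)
    ultimately show ?thesis using a0(3) by (simp add: S_def)
  qed
qed

definition component :: "'n cpoly \<Rightarrow> ('n \<Rightarrow> int) set \<Rightarrow> 'n cpoly" where
  "component f \<alpha> = (\<Sum>a\<in>{a \<in> Poly_Mapping.keys f. a \<in> monomials \<alpha>}. Poly_Mapping.single a (Poly_Mapping.lookup f a))"

lemma lookup_sum_single:
  assumes "finite A"
  shows "Poly_Mapping.lookup (\<Sum>a\<in>A. Poly_Mapping.single a (c a)) b = (if b \<in> A then c b else 0)"
  using assms by (simp add: lookup_sum lookup_single when_def)

lemma lookup_component:
  "Poly_Mapping.lookup (component f \<alpha>) b = (if b \<in> monomials \<alpha> then Poly_Mapping.lookup f b else 0)"
  unfolding component_def by (subst lookup_sum_single) (auto simp: in_keys_iff)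

lemma component_graded: "component f \<alpha> \<in> graded_piece \<alpha>"
  by (auto simp: graded_piece_def in_keys_iff lookup_component split: if_splits)

lemma peval_component:
  "peval (component f \<alpha>) z = (\<Sum>a\<in>{a \<in> Poly_Mapping.keys f. a \<in> monomials \<alpha>}. Poly_Mapping.lookup f a * mono_eval z a)"
  by (simp add: component_def)

lemma sum_components: "f = (\<Sum>\<alpha>\<in>mono_class u ` Poly_Mapping.keys f. component f \<alpha>)"
proof (rule poly_mapping_eqI)
  fix b
  have "Poly_Mapping.lookup (\<Sum>\<alpha>\<in>mono_class u ` Poly_Mapping.keys f. component f \<alpha>) b
      = (\<Sum>\<alpha>\<in>mono_class u ` Poly_Mapping.keys f. if mono_class u b = \<alpha> then Poly_Mapping.lookup f b else 0)"
    unfolding lookup_sum lookup_component by (intro sum.cong refl) (auto simp: monomials_iff[of _ u])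
  also have "\<dots> = Poly_Mapping.lookup f b"
    by (auto simp: in_keys_iff)
  finally show "Poly_Mapping.lookup f b
    = Poly_Mapping.lookup (\<Sum>\<alpha>\<in>mono_class u ` Poly_Mapping.keys f. component f \<alpha>) b" ..
qed

lemma vanishing_ideal_iff:
  "f \<in> vanishing_ideal (cox_orbit u ` Z) \<longleftrightarrow> (\<forall>\<xi>\<in>Z. \<forall>t\<in>cox_torus u. peval f (\<lambda>i. t i * \<xi> i) = 0)"
  by (auto simp: vanishing_ideal_def cox_orbit_def)

text \<open>On the orbit of \<xi>, \<open>f\<close> is a combination of characters of the Cox torus,
  and two monomials give the same character exactly when they have the same degree. Independence of
  characters isolates one degree.\<close>

lemma component_vanishes:
  fixes u :: "'n::finite \<Rightarrow> int^'d::finite"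
  assumes fan: "is_fan \<Delta>" "smooth_fan \<Delta>" "complete_fan \<Delta>" "ray_generators \<Delta> u"
    and \<alpha>: "\<alpha> \<in> Pic u" and van: "\<And>t. t \<in> cox_torus u \<Longrightarrow> peval f (\<lambda>i. t i * \<xi> i) = 0"
  shows "peval (component f \<alpha>) \<xi> = 0"
proof (cases "monomials \<alpha> = {}")
  case False
  then obtain b where b: "b \<in> monomials \<alpha>" by blast
  have "a \<in> monomials \<alpha> \<longleftrightarrow> (\<forall>t\<in>cox_torus u. mono_eval t a = mono_eval t b)" for a
  proof (cases "mono_class u a = mono_class u b")
    case True
    then have "\<forall>t\<in>cox_torus u. mono_eval t a = mono_eval t b"
      by (intro ballI cox_torus_mono_eval_cong)
    then show ?thesis using True b by (simp add: monomials_iff[OF \<alpha>])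
  next
    case False
    then have "\<exists>t\<in>cox_torus u. mono_eval t a \<noteq> mono_eval t b"
      by (rule cox_torus_separates_monomials[OF fan])
    then show ?thesis using False b by (auto simp: monomials_iff[OF \<alpha>])
  qed
  then have "{a \<in> Poly_Mapping.keys f. a \<in> monomials \<alpha>}
      = {a \<in> Poly_Mapping.keys f. \<forall>t\<in>cox_torus u. mono_eval t a = mono_eval t b}"
    by simp
  moreover have "(\<Sum>a\<in>{a \<in> Poly_Mapping.keys f. \<forall>t\<in>cox_torus u. mono_eval t a = mono_eval t b}.
      Poly_Mapping.lookup f a * mono_eval \<xi> a) = 0"
  proof (rule character_sum_component)
    fix t assume "t \<in> cox_torus u"
    from van[OF this] show "(\<Sum>a\<in>Poly_Mapping.keys f. Poly_Mapping.lookup f a * mono_eval \<xi> a * mono_eval t a) = 0"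
      by (simp add: peval_alt mono_eval_mult mult_ac)
  qed (auto intro: cox_torus_one cox_torus_mult)
  ultimately show ?thesis by (simp add: peval_component)
qed (simp add: peval_component)

lemma vanishing_ideal_subspace: "ideal.subspace (vanishing_ideal P)"
  by (simp add: ideal.subspace_def vanishing_ideal_def)

lemma vanishing_ideal_radical: "radical_ideal (vanishing_ideal P)"
  by (auto simp: radical_ideal_def vanishing_ideal_subspace) (auto simp: vanishing_ideal_def)

lemma component_in_vanishing_ideal:
  fixes u :: "'n::finite \<Rightarrow> int^'d::finite"
  assumes fan: "is_fan \<Delta>" "smooth_fan \<Delta>" "complete_fan \<Delta>" "ray_generators \<Delta> u"
    and \<alpha>: "\<alpha> \<in> Pic u" and f: "f \<in> vanishing_ideal (cox_orbit u ` Z)"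
  shows "component f \<alpha> \<in> vanishing_ideal (cox_orbit u ` Z)"
  unfolding vanishing_ideal_iff
proof (intro ballI)
  fix \<xi> t assume "\<xi> \<in> Z" "t \<in> cox_torus u"
  then have "peval f (\<lambda>i. s i * (t i * \<xi> i)) = 0" if "s \<in> cox_torus u" for s
    using f cox_torus_mult[OF that, of t] unfolding vanishing_ideal_iff by (simp add: mult.assoc[symmetric])
  then show "peval (component f \<alpha>) (\<lambda>i. t i * \<xi> i) = 0"
    by (rule component_vanishes[OF fan \<alpha>])
qed

lemma vanishing_ideal_homogeneous:
  fixes u :: "'n::finite \<Rightarrow> int^'d::finite"
  assumes fan: "is_fan \<Delta>" "smooth_fan \<Delta>" "complete_fan \<Delta>" "ray_generators \<Delta> u"
  shows "homogeneous_ideal u (vanishing_ideal (cox_orbit u ` Z))"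
proof -
  let ?I = "vanishing_ideal (cox_orbit u ` Z)"
  let ?H = "{f \<in> ?I. \<exists>\<alpha>\<in>Pic u. f \<in> graded_piece \<alpha>}"
  have "f \<in> ideal.span ?H" if "f \<in> ?I" for f
  proof -
    have "(\<Sum>\<alpha>\<in>mono_class u ` Poly_Mapping.keys f. component f \<alpha>) \<in> ideal.span ?H"
    proof (intro ideal.span_sum ideal.span_base CollectI conjI bexI)
      fix \<alpha> assume "\<alpha> \<in> mono_class u ` Poly_Mapping.keys f"
      then show \<alpha>: "\<alpha> \<in> Pic u" by auto
      show "component f \<alpha> \<in> ?I" by (rule component_in_vanishing_ideal[OF fan \<alpha> that])
    qed (rule component_graded)
    then show ?thesis by (simp only: sum_components[symmetric])
  qed
  moreover have "ideal.span ?H \<subseteq> ?I"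
    by (rule ideal.span_minimal) (auto intro: vanishing_ideal_subspace)
  ultimately show ?thesis unfolding homogeneous_ideal_def using vanishing_ideal_subspace by blast
qed

section \<open>Apolarity between evaluation functionals and vanishing ideals\<close>

lemma lookup_diff_act:
  "Poly_Mapping.lookup (diff_act g F) c = (\<Sum>a\<in>Poly_Mapping.keys g. Poly_Mapping.lookup g a * Poly_Mapping.lookup F (a + c) *
     (\<Prod>i\<in>UNIV. of_nat ((Poly_Mapping.lookup (a + c) i choose Poly_Mapping.lookup a i) * fact (Poly_Mapping.lookup a i))))"
proof -
  define k :: "('a \<Rightarrow>\<^sub>0 nat) \<Rightarrow> ('a \<Rightarrow>\<^sub>0 nat) \<Rightarrow> complex" where
    "k a b = (\<Prod>i\<in>UNIV. of_nat ((Poly_Mapping.lookup b i choose Poly_Mapping.lookup a i) * fact (Poly_Mapping.lookup a i)))" for a b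
  have inner: "(\<Sum>b\<in>Poly_Mapping.keys F. (Poly_Mapping.lookup g a * Poly_Mapping.lookup F b * k a b when b - a = c))
     = Poly_Mapping.lookup g a * Poly_Mapping.lookup F (a + c) * k a (a + c)" for a
  proof -
    \<comment> \<open>Subtraction of exponent vectors is truncated, so \<open>b - a = c\<close> can
      also hold for some \<open>b\<close> not above \<open>a\<close>; the binomial factor removes
      these.\<close>
    have "b = a + c" if "b - a = c" "k a b \<noteq> 0" for b
    proof (rule poly_mapping_eqI)
      fix i
      have "Poly_Mapping.lookup b i choose Poly_Mapping.lookup a i \<noteq> 0"
        using that(2) by (auto simp: k_def)
      then have "Poly_Mapping.lookup a i \<le> Poly_Mapping.lookup b i" by (meson binomial_eq_0 not_le)
      then show "Poly_Mapping.lookup b i = Poly_Mapping.lookup (a + c) i"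
        using that(1) by (auto simp: lookup_add lookup_minus)
    qed
    then have "(\<Sum>b\<in>Poly_Mapping.keys F. (Poly_Mapping.lookup g a * Poly_Mapping.lookup F b * k a b when b - a = c))
      = (\<Sum>b\<in>Poly_Mapping.keys F. if b = a + c then Poly_Mapping.lookup g a * Poly_Mapping.lookup F b * k a b else 0)"
      by (intro sum.cong) (auto simp: when_def)
    also have "\<dots> = Poly_Mapping.lookup g a * Poly_Mapping.lookup F (a + c) * k a (a + c)"
      by (auto simp: in_keys_iff)
    finally show ?thesis .
  qed
  show ?thesis
    unfolding diff_act_def lookup_sum lookup_single k_def[symmetric] inner ..
qed

lemma lookup_eval_point:
  assumes "finite (monomials v)"
  shows "Poly_Mapping.lookup (eval_point v \<xi>) b =
    (if b \<in> monomials v then mono_eval \<xi> b / (\<Prod>i\<in>UNIV. fact (Poly_Mapping.lookup b i)) else 0)"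
  unfolding eval_point_def using assms
  by (subst lookup_sum_single) (auto simp: prod_dividef mono_eval_finite)

text \<open>Differentiation by \<open>y^a\<close> turns the coefficient
  \<open>\<xi>^(a+c) / (a+c)!\<close> into \<open>\<xi>^a\<close> times \<open>\<xi>^c / c!\<close>.
  The coefficient at \<open>c\<close> is therefore the value at \<xi> of a single homogeneous
  component of \<open>g\<close>, up to a factor independent of \<open>a\<close>.\<close>

lemma eval_point_apolar:
  fixes u :: "'n::finite \<Rightarrow> int^'d::finite"
  assumes fin: "finite (monomials v)" and v: "v \<in> Pic u"
    and van: "\<And>\<alpha>. \<alpha> \<in> Pic u \<Longrightarrow> peval (component g \<alpha>) \<xi> = 0"
  shows "diff_act g (eval_point v \<xi>) = 0"
proof (rule poly_mapping_eqI)
  fix c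
  define K where "K = {a \<in> Poly_Mapping.keys g. a + c \<in> monomials v}"
  define q where "q = mono_eval \<xi> c / (\<Prod>i\<in>UNIV. fact (Poly_Mapping.lookup c i))"
  have coeff: "Poly_Mapping.lookup (eval_point v \<xi>) (a + c) * (\<Prod>i\<in>UNIV. of_nat ((Poly_Mapping.lookup (a + c) i choose Poly_Mapping.lookup a i) * fact (Poly_Mapping.lookup a i)))
      = mono_eval \<xi> a * q" if "a + c \<in> monomials v" for a
  proof -
    have "(\<Prod>i\<in>UNIV. of_nat ((Poly_Mapping.lookup (a + c) i choose Poly_Mapping.lookup a i) * fact (Poly_Mapping.lookup a i)))
      = (\<Prod>i\<in>UNIV. fact (Poly_Mapping.lookup (a + c) i) / fact (Poly_Mapping.lookup c i) :: complex)"
      by (intro prod.cong refl) (simp add: lookup_add binomial_fact)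
    then show ?thesis
      using that by (simp add: lookup_eval_point[OF fin] prod_dividef q_def mono_eval_add)
  qed
  have "Poly_Mapping.lookup (diff_act g (eval_point v \<xi>)) c = (\<Sum>a\<in>K. Poly_Mapping.lookup g a * (mono_eval \<xi> a * q))"
    unfolding lookup_diff_act K_def
  proof (rule sum.mono_neutral_cong_right)
    fix a assume "a \<in> {a \<in> Poly_Mapping.keys g. a + c \<in> monomials v}"
    then have "a + c \<in> monomials v" by simp
    from coeff[OF this] show "Poly_Mapping.lookup g a * Poly_Mapping.lookup (eval_point v \<xi>) (a + c) *
      (\<Prod>i\<in>UNIV. of_nat ((Poly_Mapping.lookup (a + c) i choose Poly_Mapping.lookup a i) * fact (Poly_Mapping.lookup a i)))
      = Poly_Mapping.lookup g a * (mono_eval \<xi> a * q)" by (simp only: mult.assoc)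
  qed (auto simp: lookup_eval_point[OF fin])
  also have "\<dots> = 0"
  proof (cases "K = {}")
    case False
    then obtain a0 where a0: "a0 \<in> K" by blast
    \<comment> \<open>Adding \<open>c\<close> is injective on degrees, so the exponents
      \<open>a\<close> with \<open>a + c\<close> of degree \<open>v\<close> all share one
      degree.\<close>
    have "K = {a \<in> Poly_Mapping.keys g. a \<in> monomials (mono_class u a0)}"
      using a0 by (auto simp: K_def monomials_iff[OF v] monomials_iff[of _ u] mono_class_add_cancel
          simp flip: mono_class_add_cancel[of u _ c a0])
    then have "(\<Sum>a\<in>K. Poly_Mapping.lookup g a * (mono_eval \<xi> a * q)) = peval (component g (mono_class u a0)) \<xi> * q"
      by (simp add: peval_component sum_distrib_right mult.assoc)
    then show ?thesis using van by simp
  qed simp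
  finally show "Poly_Mapping.lookup (diff_act g (eval_point v \<xi>)) c = Poly_Mapping.lookup 0 c" by simp
qed

lemma subspace_apolar: "cp.subspace {F. diff_act g F = 0}"
proof -
  have "diff_act g (F + G) = diff_act g F + diff_act g G" for F G
    by (rule poly_mapping_eqI) (simp add: lookup_diff_act lookup_add algebra_simps sum.distrib)
  moreover have "diff_act g (cscale c F) = cscale c (diff_act g F)" for c F
    by (rule poly_mapping_eqI) (simp add: lookup_diff_act sum_distrib_left mult_ac)
  moreover have "diff_act g 0 = 0" by (simp add: diff_act_def)
  ultimately show ?thesis by (simp add: cp.subspace_def)
qed

lemma vanishing_ideal_apolar:
  fixes u :: "'n::finite \<Rightarrow> int^'d::finite"
  assumes fan: "is_fan \<Delta>" "smooth_fan \<Delta>" "complete_fan \<Delta>" "ray_generators \<Delta> u"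
    and v: "v \<in> Pic u" and F: "F \<in> cp.span (eval_point v ` Z)"
  shows "vanishing_ideal (cox_orbit u ` Z) \<subseteq> Ann F"
proof
  fix g assume g: "g \<in> vanishing_ideal (cox_orbit u ` Z)"
  have "cp.span (eval_point v ` Z) \<subseteq> {F. diff_act g F = 0}"
  proof (rule cp.span_minimal[OF _ subspace_apolar], clarify)
    fix \<xi> assume "\<xi> \<in> Z"
    then have "peval g (\<lambda>i. t i * \<xi> i) = 0" if "t \<in> cox_torus u" for t
      using g that unfolding vanishing_ideal_iff by blast
    then show "diff_act g (eval_point v \<xi>) = 0"
      by (intro eval_point_apolar[OF finite_monomials[OF fan v] v] component_vanishes[OF fan])
  qed
  then show "g \<in> Ann F" using F by (auto simp: Ann_def)
qed


section \<open>Saturation and Hilbert functions\<close>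

lemma ray_monomial_in_irrelevant_ideal:
  assumes "\<sigma> \<in> \<Delta>"
  shows "(\<Prod>i\<in>{i. lattice_vec (u i) \<notin> \<sigma>}. pvar i) \<in> irrelevant_ideal \<Delta> u"
  unfolding irrelevant_ideal_def using assms by (intro ideal.span_base) blast

lemma torus_point_stable:
  assumes "is_fan \<Delta>" "\<And>i. \<xi> i \<noteq> 0"
  shows "\<xi> \<in> stable_locus \<Delta> u"
proof -
  obtain \<sigma> where "\<sigma> \<in> \<Delta>" using assms(1) by (auto simp: is_fan_def)
  from ray_monomial_in_irrelevant_ideal[OF this, of u] show ?thesis
    unfolding stable_locus_def using assms(2) by (intro CollectI bexI) auto
qed

text \<open>A generator of the irrelevant ideal is a product of variables and has no zero on the
  torus. If \<open>f\<close> times a power of it vanishes on the orbit of a torus point, then so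
  does \<open>f\<close>.\<close>

lemma torus_vanishing_ideal_B_saturated:
  fixes u :: "'n::finite \<Rightarrow> int^'d"
  assumes fan: "is_fan \<Delta>" and Z: "\<And>\<xi> i. \<xi> \<in> Z \<Longrightarrow> \<xi> i \<noteq> 0"
  shows "B_saturated \<Delta> u (vanishing_ideal (cox_orbit u ` Z))"
  unfolding B_saturated_def
proof (intro subset_antisym subsetI)
  fix f assume "f \<in> vanishing_ideal (cox_orbit u ` Z)"
  then show "f \<in> saturation (vanishing_ideal (cox_orbit u ` Z)) (irrelevant_ideal \<Delta> u)"
    unfolding saturation_def vanishing_ideal_iff by (intro CollectI exI[of _ 0]) simp
next
  fix f assume f: "f \<in> saturation (vanishing_ideal (cox_orbit u ` Z)) (irrelevant_ideal \<Delta> u)"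
  obtain \<sigma> where \<sigma>: "\<sigma> \<in> \<Delta>" using fan by (auto simp: is_fan_def)
  define g :: "'n cpoly" where "g = (\<Prod>i\<in>{i. lattice_vec (u i) \<notin> \<sigma>}. pvar i)"
  have g: "g \<in> irrelevant_ideal \<Delta> u" unfolding g_def by (rule ray_monomial_in_irrelevant_ideal[OF \<sigma>])
  have pow: "g ^ k \<in> ideal_power (irrelevant_ideal \<Delta> u) k" for k
  proof (induction k)
    case (Suc k)
    have "g * g ^ k \<in> {f * h |f h. f \<in> irrelevant_ideal \<Delta> u \<and> h \<in> ideal_power (irrelevant_ideal \<Delta> u) k}"
      using g Suc by blast
    then show ?case by (simp add: ideal.span_base)
  qed simp
  obtain k where "\<forall>h\<in>ideal_power (irrelevant_ideal \<Delta> u) k. f * h \<in> vanishing_ideal (cox_orbit u ` Z)"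
    using f by (auto simp: saturation_def)
  then have van: "f * g ^ k \<in> vanishing_ideal (cox_orbit u ` Z)" using pow by blast
  show "f \<in> vanishing_ideal (cox_orbit u ` Z)"
    unfolding vanishing_ideal_iff
  proof (intro ballI)
    fix \<xi> t assume *: "\<xi> \<in> Z" "t \<in> cox_torus u"
    then have "peval f (\<lambda>i. t i * \<xi> i) * peval g (\<lambda>i. t i * \<xi> i) ^ k = 0"
      using van unfolding vanishing_ideal_iff by simp
    moreover have "peval g (\<lambda>i. t i * \<xi> i) \<noteq> 0"
      using Z[OF *(1)] cox_torus_nonzero[OF *(2)] by (simp add: g_def)
    ultimately show "peval f (\<lambda>i. t i * \<xi> i) = 0" by simp
  qed
qed

section \<open>Hilbert function of a finite set of points\<close>

lemma nonsingular_inverse: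
  fixes M :: "nat \<Rightarrow> nat \<Rightarrow> complex"
  assumes "Determinant.det (mat m m (\<lambda>(i, k). M i k)) \<noteq> 0"
  obtains N where "\<And>i j. i < m \<Longrightarrow> j < m \<Longrightarrow> (\<Sum>k<m. M i k * N k j) = (if i = j then 1 else 0)"
    "\<And>i j. i < m \<Longrightarrow> j < m \<Longrightarrow> (\<Sum>k<m. N i k * M k j) = (if i = j then 1 else 0)"
proof -
  define A where "A = mat m m (\<lambda>(i, k). M i k)"
  have A: "A \<in> carrier_mat m m" by (simp add: A_def)
  define N where "N k j = adj_mat A $$ (k, j) / Determinant.det A" for k j
  have det: "Determinant.det A \<noteq> 0" using assms by (simp add: A_def)
  note adj = adj_mat[OF A]
  show ?thesis
  proof (rule that)
    fix i j assume ij: "i < m" "j < m"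
    have "(\<Sum>k<m. M i k * adj_mat A $$ (k, j)) = (A * adj_mat A) $$ (i, j)"
      using ij adj(1) A by (simp add: scalar_prod_def A_def lessThan_atLeast0)
    also have "\<dots> = (if i = j then Determinant.det A else 0)" using ij by (simp add: adj(2))
    finally show "(\<Sum>k<m. M i k * N k j) = (if i = j then 1 else 0)"
      using det by (simp add: N_def flip: sum_divide_distrib)
    have "(\<Sum>k<m. adj_mat A $$ (i, k) * M k j) = (adj_mat A * A) $$ (i, j)"
      using ij adj(1) A by (simp add: scalar_prod_def A_def lessThan_atLeast0)
    also have "\<dots> = (if i = j then Determinant.det A else 0)" using ij by (simp add: adj(3))
    finally show "(\<Sum>k<m. N i k * M k j) = (if i = j then 1 else 0)"
      using det by (simp add: N_def flip: sum_divide_distrib)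
  qed
qed

lemma independent_triangular_family:
  fixes f :: "('n \<Rightarrow>\<^sub>0 nat) \<Rightarrow> 'n cpoly"
  assumes "finite J" and diag: "\<And>b b'. b \<in> J \<Longrightarrow> b' \<in> J \<Longrightarrow> Poly_Mapping.lookup (f b) b' = (if b = b' then 1 else 0)"
  shows "inj_on f J" "cp.independent (f ` J)"
proof -
  show inj: "inj_on f J"
    by (rule inj_onI) (metis diag zero_neq_one)
  show "cp.independent (f ` J)"
    unfolding cp.dependent_finite[OF finite_imageI[OF assms(1)]]
  proof clarify
    fix c b assume b: "b \<in> J" "c (f b) \<noteq> 0" and sum: "(\<Sum>v\<in>f ` J. cscale (c v) v) = 0"
    have "0 = Poly_Mapping.lookup (\<Sum>v\<in>f ` J. cscale (c v) v) b" by (simp add: sum)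
    also have "\<dots> = (\<Sum>b'\<in>J. c (f b') * Poly_Mapping.lookup (f b') b)"
      using inj by (simp add: sum.reindex lookup_sum)
    also have "\<dots> = (\<Sum>b'\<in>J. if b' = b then c (f b) else 0)"
      using b(1) by (intro sum.cong) (auto simp: diag)
    also have "\<dots> = c (f b)" using assms(1) b(1) by simp
    finally show False using b(2) by simp
  qed
qed

lemma subspace_graded_piece: "cp.subspace (graded_piece \<alpha>)"
  unfolding cp.subspace_def graded_piece_def
  by (auto simp: in_keys_iff lookup_add subset_iff) (metis add_0)

lemma graded_piece_expansion:
  assumes "finite (monomials \<alpha>)" "f \<in> graded_piece \<alpha>"
  shows "f = (\<Sum>a\<in>monomials \<alpha>. Poly_Mapping.single a (Poly_Mapping.lookup f a))"
proof (rule poly_mapping_eqI)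
  fix b
  have "b \<notin> monomials \<alpha> \<Longrightarrow> Poly_Mapping.lookup f b = 0"
    using assms(2) by (auto simp: graded_piece_def in_keys_iff)
  then show "Poly_Mapping.lookup f b = Poly_Mapping.lookup (\<Sum>a\<in>monomials \<alpha>. Poly_Mapping.single a (Poly_Mapping.lookup f a)) b"
    by (simp add: lookup_sum_single[OF assms(1)])
qed

lemma cscale_single: "cscale c (Poly_Mapping.single a d) = Poly_Mapping.single a (c * d)"
  by (simp add: cscale_def mult_single)

lemma graded_piece_span:
  assumes "finite (monomials \<alpha>)"
  shows "graded_piece \<alpha> \<subseteq> cp.span ((\<lambda>a. Poly_Mapping.single a 1) ` monomials \<alpha>)"
proof
  fix f assume f: "f \<in> graded_piece \<alpha>"
  have "(\<Sum>a\<in>monomials \<alpha>. cscale (Poly_Mapping.lookup f a) (Poly_Mapping.single a 1))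
      \<in> cp.span ((\<lambda>a. Poly_Mapping.single a 1) ` monomials \<alpha>)"
    by (intro cp.span_sum cp.span_scale cp.span_base) auto
  then show "f \<in> cp.span ((\<lambda>a. Poly_Mapping.single a 1) ` monomials \<alpha>)"
    by (simp add: cscale_single flip: graded_piece_expansion[OF assms f])
qed

lemma dim_graded_piece:
  assumes "finite (monomials \<alpha>)"
  shows "cp.dim (graded_piece \<alpha> :: 'n cpoly set) = card (monomials \<alpha>)"
proof (rule cp.dim_unique)
  let ?f = "\<lambda>a. Poly_Mapping.single a 1 :: 'n cpoly"
  note ind = independent_triangular_family[OF assms, of ?f]
  show "?f ` monomials \<alpha> \<subseteq> graded_piece \<alpha>" by (auto simp: graded_piece_def)
  show "cp.independent (?f ` monomials \<alpha>)" by (rule ind) (simp add: lookup_single when_def)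
  show "card (?f ` monomials \<alpha>) = card (monomials \<alpha>)"
    by (rule card_image, rule ind) (simp add: lookup_single when_def)
qed (rule graded_piece_span[OF assms])

lemma graded_vanishing_iff:
  fixes u :: "'n::finite \<Rightarrow> int^'d::finite"
  assumes \<alpha>: "\<alpha> \<in> Pic u" and f: "f \<in> graded_piece \<alpha>"
  shows "f \<in> vanishing_ideal (cox_orbit u ` Z) \<longleftrightarrow> (\<forall>\<xi>\<in>Z. peval f \<xi> = 0)"
proof
  assume "f \<in> vanishing_ideal (cox_orbit u ` Z)"
  then show "\<forall>\<xi>\<in>Z. peval f \<xi> = 0"
    unfolding vanishing_ideal_iff using cox_torus_one[of u] by fastforce
next
  assume van: "\<forall>\<xi>\<in>Z. peval f \<xi> = 0"
  show "f \<in> vanishing_ideal (cox_orbit u ` Z)"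
    unfolding vanishing_ideal_iff
  proof (intro ballI)
    fix \<xi> t assume *: "\<xi> \<in> Z" "t \<in> cox_torus u"
    show "peval f (\<lambda>i. t i * \<xi> i) = 0"
    proof (cases "Poly_Mapping.keys f = {}")
      case False
      then obtain a0 where a0: "a0 \<in> Poly_Mapping.keys f" by blast
      have "mono_eval t a = mono_eval t a0" if "a \<in> Poly_Mapping.keys f" for a
        using f a0 that
        by (intro cox_torus_mono_eval_cong[OF *(2)]) (auto simp: graded_piece_def subset_iff monomials_iff[OF \<alpha>])
      then have "peval f (\<lambda>i. t i * \<xi> i) = mono_eval t a0 * peval f \<xi>"
        by (simp add: peval_alt mono_eval_mult sum_distrib_left mult_ac)
      then show ?thesis using van * by simp
    qed (simp add: peval_def)
  qed
qed

text \<open>Since evaluation of the monomials \<open>as\<close> at the first \<open>m\<close> points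
  is invertible, every other monomial \<open>b\<close> of degree \<alpha> agrees on these points
  with a combination of \<open>as\<close>. The differences \<open>f b\<close> form a basis of the
  ideal in degree \<alpha>, whose codimension is thus \<open>m\<close>.\<close>

lemma hilbert_fun_vanishing_ideal:
  fixes u :: "'n::finite \<Rightarrow> int^'d::finite" and \<xi> :: "nat \<Rightarrow> 'n \<Rightarrow> complex"
  assumes \<alpha>: "\<alpha> \<in> Pic u" and fin: "finite (monomials \<alpha>)"
    and as: "distinct as" "set as \<subseteq> monomials \<alpha>" "length as = min r (card (monomials \<alpha>))"
    and det: "Determinant.det (mat (length as) (length as) (\<lambda>(i, k). mono_eval (\<xi> i) (as ! k))) \<noteq> 0"
  shows "hilbert_fun (vanishing_ideal (cox_orbit u ` \<xi> ` {..<r})) \<alpha> = generic_hilbert_fun r \<alpha>"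
proof -
  define m where "m = length as"
  obtain N where N: "\<And>i j. i < m \<Longrightarrow> j < m \<Longrightarrow> (\<Sum>k<m. mono_eval (\<xi> i) (as ! k) * N k j) = (if i = j then 1 else 0)"
    "\<And>i j. i < m \<Longrightarrow> j < m \<Longrightarrow> (\<Sum>k<m. N i k * mono_eval (\<xi> k) (as ! j)) = (if i = j then 1 else 0)"
    by (rule nonsingular_inverse[OF det, folded m_def]) blast
  define J where "J = monomials \<alpha> - set as"
  have finJ: "finite J" using fin by (simp add: J_def)
  have m_le: "m \<le> r" "m \<le> card (monomials \<alpha>)" using as(3) by (auto simp: m_def)
  have card_as: "card (set as) = m" using as(1) by (simp add: distinct_card m_def)
  \<comment> \<open>A monomial left over forces \<open>m = r\<close>, so that vanishing at the first
    \<open>m\<close> points is vanishing at all of them. For \<open>m < r\<close> no monomial is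
    left over and the piece of the ideal is zero.\<close>
  have m_cases: "m = r" if "b \<in> J" for b
  proof (rule ccontr)
    assume "m \<noteq> r"
    then have "card (set as) = card (monomials \<alpha>)" using as(3) card_as by (simp add: m_def)
    then have "set as = monomials \<alpha>" using as(2) fin by (intro card_subset_eq)
    then show False using that by (simp add: J_def)
  qed
  define c where "c b k = (\<Sum>j<m. N k j * mono_eval (\<xi> j) b)" for b k
  define f where "f b = Poly_Mapping.single b 1 - (\<Sum>k<m. Poly_Mapping.single (as ! k) (c b k))" for b
  let ?I = "vanishing_ideal (cox_orbit u ` \<xi> ` {..<r}) \<inter> graded_piece \<alpha>"
  have nth_mem: "as ! k \<in> set as" if "k < m" for k using that by (simp add: m_def)
  have lookup_f: "Poly_Mapping.lookup (f b) b' = (if b = b' then 1 else 0)" if "b' \<notin> set as" for b b'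
  proof -
    have "(\<Sum>k<m. Poly_Mapping.lookup (Poly_Mapping.single (as ! k) (c b k)) b') = 0"
      using nth_mem that by (intro sum.neutral) (auto simp: lookup_single when_def)
    then show ?thesis by (simp add: f_def lookup_minus lookup_sum lookup_single when_def)
  qed
  have f_graded: "f b \<in> graded_piece \<alpha>" if "b \<in> monomials \<alpha>" for b
  proof -
    have "Poly_Mapping.single b 1 \<in> graded_piece \<alpha>" using that by (simp add: graded_piece_def)
    moreover have "Poly_Mapping.single (as ! k) (c b k) \<in> graded_piece \<alpha>" if "k < m" for k
      using nth_mem[OF that] as(2) by (auto simp: graded_piece_def)
    ultimately show ?thesis
      unfolding f_def by (intro cp.subspace_diff cp.subspace_sum subspace_graded_piece) auto
  qed
  have f_I: "f b \<in> ?I" if b: "b \<in> J" for b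
  proof -
    have "peval (f b) (\<xi> i) = 0" if i: "i < m" for i
    proof -
      have "(\<Sum>k<m. c b k * mono_eval (\<xi> i) (as ! k))
          = (\<Sum>j<m. (\<Sum>k<m. mono_eval (\<xi> i) (as ! k) * N k j) * mono_eval (\<xi> j) b)"
        unfolding c_def sum_distrib_left sum_distrib_right by (subst sum.swap) (simp add: mult_ac)
      also have "\<dots> = (\<Sum>j<m. if i = j then mono_eval (\<xi> i) b else 0)"
        by (intro sum.cong refl) (use N(1)[OF i] in auto)
      also have "\<dots> = mono_eval (\<xi> i) b" using i by simp
      finally show ?thesis by (simp add: f_def)
    qed
    moreover have "f b \<in> graded_piece \<alpha>" using b by (intro f_graded) (simp add: J_def)
    ultimately show ?thesis using m_cases[OF b] by (auto simp: graded_vanishing_iff[OF \<alpha>])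
  qed
  have "cp.dim ?I = card J"
  proof (rule cp.dim_unique)
    show "f ` J \<subseteq> ?I" using f_I by blast
    note ind = independent_triangular_family[OF finJ, of f]
    show "cp.independent (f ` J)" by (rule ind) (simp add: lookup_f J_def)
    show "card (f ` J) = card J" by (rule card_image, rule ind) (simp add: lookup_f J_def)
    show "?I \<subseteq> cp.span (f ` J)"
    proof
      fix h assume h: "h \<in> ?I"
      \<comment> \<open>Subtracting \<open>s\<close> removes all coefficients outside
        \<open>as\<close>; what remains is in the kernel of the invertible evaluation
        matrix.\<close>
      define s where "s = (\<Sum>b\<in>J. cscale (Poly_Mapping.lookup h b) (f b))"
      define g where "g = h - s"
      have s: "s \<in> graded_piece \<alpha>"
        unfolding s_def using f_I by (intro cp.subspace_sum cp.subspace_scale subspace_graded_piece) auto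
      have g: "g \<in> graded_piece \<alpha>"
        unfolding g_def using h s by (intro cp.subspace_diff subspace_graded_piece) auto
      have "peval (f b) (\<xi> i) = 0" if "b \<in> J" "i < m" for b i
        using f_I[OF that(1)] that(2) m_le by (auto simp: graded_vanishing_iff[OF \<alpha>])
      moreover have "peval h (\<xi> i) = 0" if "i < m" for i
        using h that m_le by (auto simp: graded_vanishing_iff[OF \<alpha>])
      ultimately have g0: "peval g (\<xi> i) = 0" if "i < m" for i
        using that by (simp add: g_def s_def)
      have g_J: "Poly_Mapping.lookup g b = 0" if b: "b \<notin> set as" for b
      proof (cases "b \<in> J")
        case True
        have "Poly_Mapping.lookup s b = (\<Sum>b'\<in>J. if b' = b then Poly_Mapping.lookup h b else 0)"
          unfolding s_def lookup_sum by (intro sum.cong) (auto simp: lookup_f[OF b])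
        also have "\<dots> = Poly_Mapping.lookup h b" using True finJ by simp
        finally show ?thesis by (simp add: g_def lookup_minus)
      next
        case False
        then have "b \<notin> monomials \<alpha>" using b by (simp add: J_def)
        then show ?thesis using g by (auto simp: graded_piece_def in_keys_iff)
      qed
      have g_eval: "(\<Sum>k<m. Poly_Mapping.lookup g (as ! k) * mono_eval (\<xi> i) (as ! k)) = 0" if "i < m" for i
      proof -
        have "Poly_Mapping.keys g \<subseteq> set as" using g_J by (auto simp: in_keys_iff)
        then have "peval g (\<xi> i) = (\<Sum>a\<in>set as. Poly_Mapping.lookup g a * mono_eval (\<xi> i) a)"
          by (intro peval_superset) auto
        also have "\<dots> = (\<Sum>k<m. Poly_Mapping.lookup g (as ! k) * mono_eval (\<xi> i) (as ! k))"
          using sum.reindex_bij_betw[OF bij_betw_nth[OF as(1) refl refl], of "\<lambda>a. Poly_Mapping.lookup g a * mono_eval (\<xi> i) a"]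
          by (simp add: m_def)
        finally show ?thesis using g0[OF that] by simp
      qed
      have "Poly_Mapping.lookup g (as ! l) = 0" if l: "l < m" for l
      proof -
        have "0 = (\<Sum>i<m. N l i * (\<Sum>k<m. Poly_Mapping.lookup g (as ! k) * mono_eval (\<xi> i) (as ! k)))"
          using g_eval by simp
        also have "\<dots> = (\<Sum>k<m. (\<Sum>i<m. N l i * mono_eval (\<xi> i) (as ! k)) * Poly_Mapping.lookup g (as ! k))"
          unfolding sum_distrib_left sum_distrib_right by (subst sum.swap) (simp add: mult_ac)
        also have "\<dots> = (\<Sum>k<m. if l = k then Poly_Mapping.lookup g (as ! l) else 0)"
          by (intro sum.cong refl) (use N(2)[OF l] in auto)
        also have "\<dots> = Poly_Mapping.lookup g (as ! l)" using l by simp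
        finally show ?thesis ..
      qed
      then have "Poly_Mapping.lookup g b = 0" for b
        using g_J[of b] by (cases "b \<in> set as") (auto simp: in_set_conv_nth m_def)
      then have "g = 0" by (intro poly_mapping_eqI) simp
      then have "h = s" by (simp add: g_def)
      moreover have "s \<in> cp.span (f ` J)"
        unfolding s_def by (intro cp.span_sum cp.span_scale cp.span_base) auto
      ultimately show "h \<in> cp.span (f ` J)" by simp
    qed
  qed
  moreover have "card J = card (monomials \<alpha>) - m"
    unfolding J_def using as(2) card_as by (simp add: card_Diff_subset)
  ultimately show ?thesis
    using m_le as(3) by (simp add: hilbert_fun_def generic_hilbert_fun_def dim_graded_piece[OF fin] m_def)
qed

section \<open>The space underlying the Zariski topology of the Hilbert scheme\<close>

lemma exists_basis_list:
  fixes V :: "'n cpoly set"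
  assumes "cp.subspace V" "finite T" "V \<subseteq> cp.span T"
  shows "\<exists>ws. basis_list V ws"
proof -
  obtain B where B: "B \<subseteq> V" "cp.independent B" "V \<subseteq> cp.span B"
    using cp.maximal_independent_subset[of V] by blast
  have "finite B"
    using cp.independent_span_bound[OF assms(2) B(2)] B(1) assms(3) by blast
  then obtain ws where ws: "set ws = B" "distinct ws" using finite_distinct_list by blast
  have "cp.span B = V" using B assms(1) by (intro cp.span_subspace)
  then show ?thesis using ws B by (auto simp: basis_list_def)
qed

lemma ideal_subspace_imp_subspace:
  assumes "ideal.subspace I"
  shows "cp.subspace I"
  using assms by (auto simp: cp.subspace_def ideal.subspace_def cscale_def)

text \<open>A closure is formed inside the topological space, so that \<open>Sip\<close> lies in its
  closure only if the basic open sets cover it. The set given by the constant polynomial 1 covers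
  all of \<open>Hilb\<close>, once every graded piece has a basis list.\<close>

lemma topspace_hilb_zariski:
  fixes u :: "'n::finite \<Rightarrow> int^'d::finite"
  assumes fin: "\<And>\<alpha>. \<alpha> \<in> Pic u \<Longrightarrow> finite (monomials \<alpha>)"
  shows "Hilb u r \<subseteq> topspace (hilb_zariski u r)"
proof
  fix I assume I: "I \<in> Hilb u r"
  have "\<exists>ws. basis_list (I \<inter> graded_piece \<alpha>) ws" if "\<alpha> \<in> Pic u" for \<alpha>
  proof (rule exists_basis_list)
    show "cp.subspace (I \<inter> graded_piece \<alpha>)"
      using I by (intro cp.subspace_inter subspace_graded_piece ideal_subspace_imp_subspace)
        (simp add: Hilb_def homogeneous_ideal_def)
    show "I \<inter> graded_piece \<alpha> \<subseteq> cp.span ((\<lambda>a. Poly_Mapping.single a 1) ` monomials \<alpha>)"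
      using graded_piece_span[OF fin[OF that]] by blast
    show "finite ((\<lambda>a. Poly_Mapping.single a (1::complex)) ` monomials \<alpha>)" using fin[OF that] by simp
  qed
  then have "\<exists>ws. \<forall>\<alpha>\<in>Pic u. basis_list (I \<inter> graded_piece \<alpha>) (ws \<alpha>)" by (intro bchoice ballI)
  then have mem: "I \<in> {I \<in> Hilb u r. \<exists>ws. (\<forall>\<alpha>\<in>Pic u. basis_list (I \<inter> graded_piece \<alpha>) (ws \<alpha>)) \<and>
      peval 1 (\<lambda>(\<alpha>, as). pluecker (ws \<alpha>) as) \<noteq> 0}"
    using I by simp
  have hom: "multihomogeneous u 1" by (simp add: multihomogeneous_def)
  show "I \<in> topspace (hilb_zariski u r)"
    unfolding hilb_zariski_def topology_generated_by_topspace using mem hom by blast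
qed


section \<open>Generic points\<close>

text \<open>Induction on the coordinates. A solution \<open>M\<close> for the old coordinates also
  serves every \<open>a\<close> whose new coordinate is at least a bound \<open>n\<close> for that
  coordinate on \<open>M\<close>; each of the finitely many smaller values is treated as a separate
  slice.\<close>

lemma dickson_on:
  fixes A :: "('n \<Rightarrow>\<^sub>0 nat) set"
  assumes "finite K"
  shows "\<exists>M. finite M \<and> M \<subseteq> A \<and> (\<forall>a\<in>A. \<exists>b\<in>M. \<forall>i\<in>K. Poly_Mapping.lookup b i \<le> Poly_Mapping.lookup a i)"
  using assms
proof (induction K arbitrary: A rule: finite_induct)
  case empty
  show ?case
  proof (cases "A = {}")
    case False
    then obtain a where "a \<in> A" by blast
    then show ?thesis by (intro exI[of _ "{a}"]) auto
  qed simp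
next
  case (insert x K)
  let ?dom = "\<lambda>M A. finite M \<and> M \<subseteq> A \<and> (\<forall>a\<in>A. \<exists>b\<in>M. \<forall>i\<in>K. Poly_Mapping.lookup b i \<le> Poly_Mapping.lookup a i)"
  obtain M where M: "?dom M A" using insert.IH[of A] by blast
  have "\<forall>c. \<exists>M. ?dom M {a\<in>A. Poly_Mapping.lookup a x = c}"
    using insert.IH by blast
  then have "\<exists>Mc. \<forall>c. ?dom (Mc c) {a\<in>A. Poly_Mapping.lookup a x = c}" by (rule choice)
  then obtain Mc where Mc: "\<And>c. ?dom (Mc c) {a\<in>A. Poly_Mapping.lookup a x = c}" by blast
  have Mc_A: "Mc c \<subseteq> A" for c using Mc[of c] by blast
  have "finite ((\<lambda>b. Poly_Mapping.lookup b x) ` M)" using M by blast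
  then obtain n where n: "\<And>b. b \<in> M \<Longrightarrow> Poly_Mapping.lookup b x \<le> n"
    unfolding finite_nat_set_iff_bounded_le by blast
  show ?case
  proof (intro exI[of _ "M \<union> (\<Union>c<n. Mc c)"] conjI ballI)
    show "finite (M \<union> (\<Union>c<n. Mc c))" using M Mc by blast
    show "M \<union> (\<Union>c<n. Mc c) \<subseteq> A" using M Mc_A by blast
    fix a assume a: "a \<in> A"
    show "\<exists>b\<in>M \<union> (\<Union>c<n. Mc c). \<forall>i\<in>insert x K. Poly_Mapping.lookup b i \<le> Poly_Mapping.lookup a i"
    proof (cases "Poly_Mapping.lookup a x < n")
      case True
      then obtain b where "b \<in> Mc (Poly_Mapping.lookup a x)" "\<forall>i\<in>K. Poly_Mapping.lookup b i \<le> Poly_Mapping.lookup a i"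
        using Mc[of "Poly_Mapping.lookup a x"] a by blast
      moreover have "Poly_Mapping.lookup b x = Poly_Mapping.lookup a x"
        using Mc[of "Poly_Mapping.lookup a x"] calculation(1) by blast
      ultimately show ?thesis using True by (intro bexI[of _ b]) auto
    next
      case False
      obtain b where "b \<in> M" "\<forall>i\<in>K. Poly_Mapping.lookup b i \<le> Poly_Mapping.lookup a i"
        using M a by blast
      moreover have "Poly_Mapping.lookup b x \<le> Poly_Mapping.lookup a x"
        using n[OF calculation(1)] False by linarith
      ultimately show ?thesis by (intro bexI[of _ b]) auto
    qed
  qed
qed

lemma dickson:
  fixes A :: "('n::finite \<Rightarrow>\<^sub>0 nat) set"
  obtains M where "finite M" "M \<subseteq> A" "\<And>a. a \<in> A \<Longrightarrow> \<exists>b\<in>M. \<exists>c. a = b + c"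
proof -
  obtain M where M: "finite M" "M \<subseteq> A" "\<forall>a\<in>A. \<exists>b\<in>M. \<forall>i\<in>UNIV. Poly_Mapping.lookup b i \<le> Poly_Mapping.lookup a i"
    using dickson_on[of UNIV A] by auto
  have "a = b + (a - b)" if "\<forall>i\<in>UNIV. Poly_Mapping.lookup b i \<le> Poly_Mapping.lookup a i" for a b :: "'n \<Rightarrow>\<^sub>0 nat"
    using that by (intro poly_mapping_eqI) (simp add: lookup_add lookup_minus)
  then show ?thesis using that M by metis
qed

text \<open>In kernel form, nonzero factors of rows cancel and nonzero factors of columns pass into
  the vector; both kinds of rescaling occur below.\<close>

lemma det_nonzero_iff_kernel:
  fixes M :: "nat \<Rightarrow> nat \<Rightarrow> complex"
  shows "Determinant.det (mat m m (\<lambda>(i, k). M i k)) \<noteq> 0 \<longleftrightarrow>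
    (\<forall>c. (\<forall>i<m. (\<Sum>k<m. M i k * c k) = 0) \<longrightarrow> (\<forall>k<m. c k = 0))"
proof -
  define A where "A = mat m m (\<lambda>(i, k). M i k)"
  have A: "A \<in> carrier_mat m m" by (simp add: A_def)
  have mult: "vec_index (A *\<^sub>v w) i = (\<Sum>k<m. M i k * vec_index w k)" if "w \<in> carrier_vec m" "i < m" for w i
    using that by (simp add: A_def scalar_prod_def lessThan_atLeast0)
  have "Determinant.det A = 0 \<longleftrightarrow> (\<exists>c. (\<forall>i<m. (\<Sum>k<m. M i k * c k) = 0) \<and> (\<exists>k<m. c k \<noteq> 0))"
  proof
    assume "Determinant.det A = 0"
    then obtain w where w: "w \<in> carrier_vec m" "w \<noteq> 0\<^sub>v m" "A *\<^sub>v w = 0\<^sub>v m"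
      using det_0_iff_vec_prod_zero_field[OF A] by blast
    have "\<exists>k<m. vec_index w k \<noteq> 0" using w(1,2) by (auto simp: Matrix.vec_eq_iff)
    moreover have "(\<Sum>k<m. M i k * vec_index w k) = 0" if "i < m" for i
      using mult[OF w(1) that] w(3) that by simp
    ultimately show "\<exists>c. (\<forall>i<m. (\<Sum>k<m. M i k * c k) = 0) \<and> (\<exists>k<m. c k \<noteq> 0)" by blast
  next
    assume "\<exists>c. (\<forall>i<m. (\<Sum>k<m. M i k * c k) = 0) \<and> (\<exists>k<m. c k \<noteq> 0)"
    then obtain c where c: "\<And>i. i < m \<Longrightarrow> (\<Sum>k<m. M i k * c k) = 0" "\<exists>k<m. c k \<noteq> 0" by blast
    define w where "w = Matrix.vec m c"
    have w: "w \<in> carrier_vec m" by (simp add: w_def)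
    have "w \<noteq> 0\<^sub>v m" using c(2) by (auto simp: w_def Matrix.vec_eq_iff)
    moreover have "A *\<^sub>v w = 0\<^sub>v m"
    proof (rule Matrix.eq_vecI)
      fix i assume "i < dim_vec (0\<^sub>v m :: complex Matrix.vec)"
      then have i: "i < m" by simp
      have "(\<Sum>k<m. M i k * vec_index w k) = (\<Sum>k<m. M i k * c k)" by (intro sum.cong) (auto simp: w_def)
      then show "vec_index (A *\<^sub>v w) i = vec_index (0\<^sub>v m) i" using mult[OF w i] c(1)[OF i] i by simp
    qed (simp add: A_def)
    ultimately show "Determinant.det A = 0" using w det_0_iff_vec_prod_zero_field[OF A] by blast
  qed
  then show ?thesis by (auto simp: A_def)
qed

text \<open>A point of \<open>\<complex>\<^sup>\<infinity>\<close> encodes \<open>r\<close> weights and \<open>r\<close> points in Cox coordinates.\<close>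

definition cox_var :: "nat \<Rightarrow> 'n::finite \<Rightarrow> nat" where
  "cox_var j i = prod_encode (j, Suc (to_nat i))"

text \<open>The second component 0 is left free by the \<open>Suc\<close> in \<open>cox_var\<close>,
  so weights and coordinates occupy disjoint variables.\<close>

definition weight_var :: "nat \<Rightarrow> nat" where
  "weight_var j = prod_encode (j, 0)"

definition cox_pt :: "(nat \<Rightarrow> complex) \<Rightarrow> nat \<Rightarrow> 'n::finite \<Rightarrow> complex" where
  "cox_pt z j = (\<lambda>i. z (cox_var j i))"

definition cox_mono :: "nat \<Rightarrow> ('n::finite \<Rightarrow>\<^sub>0 nat) \<Rightarrow> nat cpoly" where
  "cox_mono j a = (\<Prod>i\<in>UNIV. pvar (cox_var j i) ^ Poly_Mapping.lookup a i)"

lemma peval_cox_mono [simp]: "peval (cox_mono j a) z = mono_eval (cox_pt z j) a"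
  by (simp add: cox_mono_def cox_pt_def mono_eval_finite)

text \<open>Since \<open>p\<^sup>a\<close> determines \<open>a\<close> when the coordinates of \<open>p\<close> are distinct primes, the monomials
  at the powers \<open>p, p\<^sup>2, p\<^sup>3, \<dots>\<close> of \<open>p\<close> form Vandermonde matrices. So this one point witnesses that all the
  open conditions below are nonempty.\<close>

definition prime_pt :: "'n::finite \<Rightarrow> complex" where
  "prime_pt i = of_nat (nth_prime (to_nat i))"

text \<open>\<open>l - 1\<close> undoes the \<open>Suc\<close> of \<open>cox_var\<close>, and the
  exponent \<open>Suc j\<close> makes the first point the prime point itself rather than the point
  with all coordinates 1.\<close>

definition base_pt :: "nat \<Rightarrow> complex" where
  "base_pt n = (case prod_decode n of (j, l) \<Rightarrow> of_nat (nth_prime (l - 1)) ^ Suc j)"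

lemma cox_pt_base: "cox_pt base_pt j = (\<lambda>i. prime_pt i ^ Suc j)"
  by (simp add: cox_pt_def base_pt_def cox_var_def prime_pt_def)

lemma prime_pt_nonzero: "prime_pt i \<noteq> 0"
  using prime_gt_0_nat[OF prime_nth_prime[of "to_nat i"]] by (simp add: prime_pt_def)

lemma mono_eval_base: "mono_eval (cox_pt base_pt j) a = mono_eval prime_pt a ^ Suc j"
  unfolding cox_pt_base by (rule mono_eval_power)

lemma inj_mono_eval_prime: "inj (mono_eval (prime_pt :: 'n::finite \<Rightarrow> complex))"
proof (rule injI)
  fix a b :: "'n \<Rightarrow>\<^sub>0 nat" assume "mono_eval (prime_pt :: 'n \<Rightarrow> complex) a = mono_eval prime_pt b"
  then have "mono_eval (\<lambda>i. of_nat ((nth_prime \<circ> to_nat) i)) a = mono_eval (\<lambda>i. of_nat ((nth_prime \<circ> to_nat) i)) b"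
    by (simp add: prime_pt_def[abs_def])
  then show "a = b"
    by (rule primes_mono_inj[OF inj_compose[OF inj_nth_prime inj_to_nat], rotated]) (simp add: prime_nth_prime)
qed

lemma det_base_nonzero:
  fixes as :: "('n::finite \<Rightarrow>\<^sub>0 nat) list"
  assumes "distinct as"
  shows "Determinant.det (mat (length as) (length as) (\<lambda>(i, k). mono_eval (cox_pt base_pt i) (as ! k))) \<noteq> 0"
  unfolding det_nonzero_iff_kernel
proof (intro allI impI)
  fix c k assume c: "\<forall>i<length as. (\<Sum>k<length as. mono_eval (cox_pt base_pt i) (as ! k) * c k) = 0" and k: "k < length as"
  let ?x = "\<lambda>k. mono_eval prime_pt (as ! k)"
  \<comment> \<open>Row \<open>i\<close> holds the powers \<open>?x k ^ Suc i\<close>; moving one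
    factor \<open>?x k\<close> into the coefficient leaves Vandermonde rows starting at exponent
    0.\<close>
  have "c k * ?x k = 0"
  proof (rule vandermonde_kernel[where K = "{..<length as}" and x = ?x and c = "\<lambda>k. c k * ?x k"])
    show "inj_on ?x {..<length as}"
      using assms by (intro inj_onI) (auto dest: injD[OF inj_mono_eval_prime] simp: nth_eq_iff_index_eq)
    fix i assume "i < card {..<length as}"
    then have "(\<Sum>k<length as. mono_eval (cox_pt base_pt i) (as ! k) * c k) = 0" using c by simp
    then show "(\<Sum>k<length as. c k * ?x k * ?x k ^ i) = 0"
      by (simp add: mono_eval_base mult_ac)
  qed (use k in auto)
  moreover have "?x k \<noteq> 0" by (intro mono_eval_nonzero prime_pt_nonzero)
  ultimately show "c k = 0" by simp
qed

text \<open>The product of the witnesses is nonzero at the common point \<open>w\<close>, so it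
  defines a nonempty open set on which all conditions hold.\<close>

lemma open_condition_Ball:
  assumes "finite S" "\<And>s. s \<in> S \<Longrightarrow> \<exists>h. peval h w \<noteq> 0 \<and> (\<forall>z. peval h z \<noteq> 0 \<longrightarrow> Q s z)"
  shows "\<exists>h. peval h w \<noteq> 0 \<and> (\<forall>z. peval h z \<noteq> 0 \<longrightarrow> (\<forall>s\<in>S. Q s z))"
proof -
  have "\<forall>s\<in>S. \<exists>h. peval h w \<noteq> 0 \<and> (\<forall>z. peval h z \<noteq> 0 \<longrightarrow> Q s z)" using assms(2) by blast
  then obtain h where h: "\<forall>s\<in>S. peval (h s) w \<noteq> 0 \<and> (\<forall>z. peval (h s) z \<noteq> 0 \<longrightarrow> Q s z)"
    by (rule bchoice[THEN exE])
  show ?thesis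
    using h assms(1) by (intro exI[of _ "\<Prod>s\<in>S. h s"]) auto
qed

lemma open_condition_conj:
  assumes "\<exists>h. peval h w \<noteq> 0 \<and> (\<forall>z. peval h z \<noteq> 0 \<longrightarrow> Q z)" "\<exists>h. peval h w \<noteq> 0 \<and> (\<forall>z. peval h z \<noteq> 0 \<longrightarrow> R z)"
  shows "\<exists>h. peval h w \<noteq> 0 \<and> (\<forall>z. peval h z \<noteq> 0 \<longrightarrow> Q z \<and> R z)"
proof -
  obtain h h' where "peval h w \<noteq> 0" "\<forall>z. peval h z \<noteq> 0 \<longrightarrow> Q z" "peval h' w \<noteq> 0" "\<forall>z. peval h' z \<noteq> 0 \<longrightarrow> R z"
    using assms by blast
  then show ?thesis by (intro exI[of _ "h * h'"]) simp
qed

text \<open>Evaluation at \<open>z\<close> is a ring homomorphism, so the determinant of the matrix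
  of monomials is a polynomial whose values are the numerical determinants.\<close>

lemma det_open_condition:
  fixes as :: "('n::finite \<Rightarrow>\<^sub>0 nat) list"
  assumes "distinct as"
  shows "\<exists>h. peval h base_pt \<noteq> 0 \<and> (\<forall>z. peval h z \<noteq> 0 \<longrightarrow>
    Determinant.det (mat (length as) (length as) (\<lambda>(i, k). mono_eval (cox_pt z i) (as ! k))) \<noteq> 0)"
proof -
  let ?H = "mat (length as) (length as) (\<lambda>(i, k). cox_mono i (as ! k))"
  have "peval (Determinant.det ?H) z = Determinant.det (mat (length as) (length as) (\<lambda>(i, k). mono_eval (cox_pt z i) (as ! k)))" for z
  proof -
    have "peval (Determinant.det ?H) z = Determinant.det (map_mat (\<lambda>f. peval f z) ?H)"
      using comm_ring_hom.hom_det[OF peval_ring_hom, of z ?H] by simp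
    also have "map_mat (\<lambda>f. peval f z) ?H = mat (length as) (length as) (\<lambda>(i, k). mono_eval (cox_pt z i) (as ! k))"
      by (rule eq_matI) auto
    finally show ?thesis .
  qed
  then show ?thesis using det_base_nonzero[OF assms] by (intro exI[of _ "Determinant.det ?H"]) simp
qed

text \<open>Each degree requires an open condition on the \<open>r\<close> points. On the torus, multiplication by a
  monomial carries the condition from a degree to the larger ones, and by Dickson's lemma finitely many
  degrees suffice.\<close>

lemma generic_points:
  fixes u :: "'n::finite \<Rightarrow> int^'d::finite" and a b :: "'n \<Rightarrow>\<^sub>0 nat"
  assumes fin: "\<And>\<alpha>. \<alpha> \<in> Pic u \<Longrightarrow> finite (monomials \<alpha>)" and ab: "a \<noteq> b"
  obtains h where "h \<noteq> 0" "\<forall>z. peval h z \<noteq> 0 \<longrightarrow> (\<forall>j<r. \<forall>i :: 'n. cox_pt z j i \<noteq> 0)"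
    "\<forall>z. peval h z \<noteq> 0 \<longrightarrow> (\<forall>\<alpha>\<in>Pic u.
      hilbert_fun (vanishing_ideal (cox_orbit u ` cox_pt z ` {..<r})) \<alpha> = generic_hilbert_fun r \<alpha>)"
    "\<forall>z. peval h z \<noteq> 0 \<longrightarrow> (\<forall>j<r. \<forall>k<r. j \<noteq> k \<longrightarrow>
      mono_eval (cox_pt z j) a * mono_eval (cox_pt z k) b \<noteq> mono_eval (cox_pt z k) a * mono_eval (cox_pt z j) b)"
proof -
  \<comment> \<open>With a fixed threshold \<open>m\<close>, an exponent above a minimal
    \<open>a0\<close> inherits \<open>m\<close> monomials in its degree by shifting those of the
    degree of \<open>a0\<close>. Only \<open>m \<le> r\<close> will matter.\<close>
  define C where "C m = {a. m \<le> card (monomials (mono_class u a))}" for m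
  have "\<exists>M. finite M \<and> M \<subseteq> C m \<and> (\<forall>a\<in>C m. \<exists>b\<in>M. \<exists>c. a = b + c)" for m
    using dickson[of "C m"] by metis
  then have "\<exists>M. \<forall>m. finite (M m) \<and> M m \<subseteq> C m \<and> (\<forall>a\<in>C m. \<exists>b\<in>M m. \<exists>c. a = b + c)"
    by (intro choice allI)
  then obtain M where M: "\<And>m. finite (M m)" "\<And>m. M m \<subseteq> C m" "\<And>m a. a \<in> C m \<Longrightarrow> \<exists>b\<in>M m. \<exists>c. a = b + c"
    by blast
  have "\<exists>as. distinct as \<and> length as = m \<and> set as \<subseteq> monomials (mono_class u a0)" if a0: "a0 \<in> M m" for m a0
  proof -
    have "m \<le> card (monomials (mono_class u a0))" using M(2) a0 by (auto simp: C_def)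
    then obtain T where T: "T \<subseteq> monomials (mono_class u a0)" "card T = m" "finite T"
      by (rule obtain_subset_with_card_n)
    obtain as where "set as = T" "distinct as" using finite_distinct_list[OF T(3)] by blast
    then show ?thesis using T distinct_card by metis
  qed
  then have "\<forall>p\<in>Sigma UNIV M. \<exists>as. distinct as \<and> length as = fst p \<and> set as \<subseteq> monomials (mono_class u (snd p))"
    by auto
  then obtain L where L: "\<And>m a0. a0 \<in> M m \<Longrightarrow> distinct (L (m, a0)) \<and> length (L (m, a0)) = m \<and>
      set (L (m, a0)) \<subseteq> monomials (mono_class u a0)"
    by (elim bchoice[THEN exE]) auto
  let ?D = "\<lambda>p z. Determinant.det (mat (length (L p)) (length (L p)) (\<lambda>(i, k). mono_eval (cox_pt z i) (L p ! k))) \<noteq> 0"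
  have D: "\<exists>h. peval h base_pt \<noteq> 0 \<and> (\<forall>z. peval h z \<noteq> 0 \<longrightarrow> (\<forall>p\<in>Sigma {..r} M. ?D p z))"
  proof (rule open_condition_Ball)
    show "finite (Sigma {..r} M)" using M(1) by blast
    fix p assume "p \<in> Sigma {..r} M"
    then have "distinct (L p)" using L by (cases p) auto
    then show "\<exists>h. peval h base_pt \<noteq> 0 \<and> (\<forall>z. peval h z \<noteq> 0 \<longrightarrow> ?D p z)" by (rule det_open_condition)
  qed
  have T: "\<exists>h. peval h base_pt \<noteq> 0 \<and> (\<forall>z. peval h z \<noteq> 0 \<longrightarrow> (\<forall>p\<in>{..<r} \<times> (UNIV :: 'n set). cox_pt z (fst p) (snd p) \<noteq> 0))"
  proof (rule open_condition_Ball)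
    fix p :: "nat \<times> 'n"
    have "peval (pvar (cox_var (fst p) (snd p))) base_pt \<noteq> 0"
      using prime_pt_nonzero[of "snd p"] fun_cong[OF cox_pt_base[of "fst p"], of "snd p"] by (simp add: cox_pt_def)
    then show "\<exists>h. peval h base_pt \<noteq> 0 \<and> (\<forall>z. peval h z \<noteq> 0 \<longrightarrow> cox_pt z (fst p) (snd p) \<noteq> 0)"
      by (intro exI[of _ "pvar (cox_var (fst p) (snd p))"]) (simp add: cox_pt_def)
  qed simp
  let ?P = "\<lambda>p z. mono_eval (cox_pt z (fst p)) a * mono_eval (cox_pt z (snd p)) b
      \<noteq> mono_eval (cox_pt z (snd p)) a * mono_eval (cox_pt z (fst p)) b"
  have P: "\<exists>h. peval h base_pt \<noteq> 0 \<and> (\<forall>z. peval h z \<noteq> 0 \<longrightarrow> (\<forall>p\<in>{p \<in> {..<r} \<times> {..<r}. fst p \<noteq> snd p}. ?P p z))"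
  proof (rule open_condition_Ball)
    fix p assume "p \<in> {p \<in> {..<r} \<times> {..<r}. fst p \<noteq> snd p}"
    then obtain j k where p: "p = (j, k)" "j \<noteq> k" by (cases p) auto
    define s t :: complex where "s = mono_eval prime_pt a" and "t = mono_eval prime_pt b"
    define q where "q = cox_mono j a * cox_mono k b - cox_mono k a * cox_mono j b"
    have eq_add: "s ^ i * t ^ l = mono_eval prime_pt (\<Sum>n<i. a) * mono_eval prime_pt (\<Sum>n<l. b)" for i l
    proof -
      have "mono_eval w (\<Sum>n<i. c) = mono_eval w c ^ i" for w :: "'n \<Rightarrow> complex" and c i
        by (induction i) (simp_all add: mono_eval_add mult.commute)
      then show ?thesis by (simp add: s_def t_def)
    qed
    \<comment> \<open>By injectivity of monomials at the prime point, an equality would become one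
      of exponents, and there it reads \<open>(j - k) * (a - b) = 0\<close> in each
      coordinate.\<close>
    have "s ^ Suc j * t ^ Suc k \<noteq> s ^ Suc k * t ^ Suc j"
    proof
      assume "s ^ Suc j * t ^ Suc k = s ^ Suc k * t ^ Suc j"
      then have "mono_eval prime_pt ((\<Sum>n<Suc j. a) + (\<Sum>n<Suc k. b)) = mono_eval prime_pt ((\<Sum>n<Suc k. a) + (\<Sum>n<Suc j. b))"
        by (simp only: eq_add mono_eval_add)
      then have "(\<Sum>n<Suc j. a) + (\<Sum>n<Suc k. b) = (\<Sum>n<Suc k. a) + (\<Sum>n<Suc j. b)"
        by (rule injD[OF inj_mono_eval_prime])
      then have eq: "Suc j * Poly_Mapping.lookup a i + Suc k * Poly_Mapping.lookup b i
          = Suc k * Poly_Mapping.lookup a i + Suc j * Poly_Mapping.lookup b i" for i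
        by (drule_tac arg_cong[where f = "\<lambda>x. Poly_Mapping.lookup x i"]) (simp add: lookup_add lookup_sum)
      have "Poly_Mapping.lookup a i = Poly_Mapping.lookup b i" for i
      proof -
        have "(int j - int k) * (int (Poly_Mapping.lookup a i) - int (Poly_Mapping.lookup b i)) = 0"
          using arg_cong[OF eq[of i], of int] by (simp add: algebra_simps)
        then show ?thesis using p(2) by simp
      qed
      then show False using ab by (simp add: poly_mapping_eqI)
    qed
    then have "peval q base_pt \<noteq> 0" by (simp add: q_def mono_eval_base s_def t_def)
    then show "\<exists>h. peval h base_pt \<noteq> 0 \<and> (\<forall>z. peval h z \<noteq> 0 \<longrightarrow> ?P p z)"
      by (intro exI[of _ q]) (simp add: q_def p)
  qed simp
  obtain h where h: "peval h base_pt \<noteq> 0" "\<And>z. peval h z \<noteq> 0 \<Longrightarrow>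
      (\<forall>p\<in>Sigma {..r} M. ?D p z) \<and> (\<forall>p\<in>{..<r} \<times> (UNIV :: 'n set). cox_pt z (fst p) (snd p) \<noteq> 0) \<and>
      (\<forall>p\<in>{p \<in> {..<r} \<times> {..<r}. fst p \<noteq> snd p}. ?P p z)"
    using open_condition_conj[OF D open_condition_conj[OF T P]] by blast
  have torus: "cox_pt z j (i :: 'n) \<noteq> 0" if "peval h z \<noteq> 0" "j < r" for z j i
    using h(2)[OF that(1)] that(2) by auto
  have hilb: "hilbert_fun (vanishing_ideal (cox_orbit u ` cox_pt z ` {..<r})) \<alpha> = generic_hilbert_fun r \<alpha>"
    if z: "peval h z \<noteq> 0" and \<alpha>: "\<alpha> \<in> Pic u" for z \<alpha>
  proof (cases "monomials \<alpha> = {}")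
    case True
    \<comment> \<open>Without monomials the matrix is empty and its determinant is 1.\<close>
    then show ?thesis
      by (intro hilbert_fun_vanishing_ideal[OF \<alpha> fin[OF \<alpha>], of "[]"]) (auto simp: det_dim_zero)
  next
    case False
    then obtain a where a: "a \<in> monomials \<alpha>" by blast
    then have cls: "\<alpha> = mono_class u a" using monomials_iff[OF \<alpha>] by simp
    define m where "m = min r (card (monomials \<alpha>))"
    have "a \<in> C m" by (simp add: C_def m_def flip: cls)
    then obtain a0 c where a0: "a0 \<in> M m" "a = a0 + c" using M(3) by blast
    define as0 where "as0 = L (m, a0)"
    have as0: "distinct as0" "length as0 = m" "set as0 \<subseteq> monomials (mono_class u a0)"
      using L[OF a0(1)] by (auto simp: as0_def)
    have "(m, a0) \<in> Sigma {..r} M" using a0 by (auto simp: m_def)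
    then have "?D (m, a0) z" using h(2)[OF z] by blast
    then have det0: "Determinant.det (mat m m (\<lambda>(i, k). mono_eval (cox_pt z i) (as0 ! k))) \<noteq> 0"
      by (simp add: as0(2) flip: as0_def)
    \<comment> \<open>Adding \<open>c\<close> to all exponents multiplies row \<open>i\<close> by
      the value of the monomial \<open>c\<close> at the \<open>i\<close>-th point. This is nonzero
      on the torus, so nonsingularity carries over from the degree of \<open>a0\<close> to that of
      \<open>a\<close>.\<close>
    define as where "as = map (\<lambda>b. b + c) as0"
    show ?thesis
    proof (rule hilbert_fun_vanishing_ideal[OF \<alpha> fin[OF \<alpha>], of as])
      show "distinct as" using as0(1) by (simp add: as_def distinct_map inj_on_def)
      show "set as \<subseteq> monomials \<alpha>"
      proof
        fix b' assume "b' \<in> set as"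
        then obtain b where b: "b \<in> set as0" "b' = b + c" by (auto simp: as_def)
        then have "mono_class u b = mono_class u a0"
          using as0(3) monomials_iff[of "mono_class u a0" u] by auto
        then have "mono_class u b' = \<alpha>"
          by (simp only: b(2) cls a0(2) mono_class_add_cancel)
        then show "b' \<in> monomials \<alpha>" by (simp only: monomials_iff[OF \<alpha>])
      qed
      show "length as = min r (card (monomials \<alpha>))" using as0(2) by (simp add: as_def m_def)
      have len: "length as = m" using as0(2) by (simp add: as_def)
      show "Determinant.det (mat (length as) (length as) (\<lambda>(i, k). mono_eval (cox_pt z i) (as ! k))) \<noteq> 0"
        unfolding len det_nonzero_iff_kernel
      proof (intro allI impI)
        fix w k assume w: "\<forall>i<m. (\<Sum>k<m. mono_eval (cox_pt z i) (as ! k) * w k) = 0" and k: "k < m"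
        have "(\<Sum>k<m. mono_eval (cox_pt z i) (as0 ! k) * w k) = 0" if i: "i < m" for i
        proof -
          have "mono_eval (cox_pt z i) c * (\<Sum>k<m. mono_eval (cox_pt z i) (as0 ! k) * w k)
              = (\<Sum>k<m. mono_eval (cox_pt z i) (as ! k) * w k)"
            unfolding sum_distrib_left
            by (intro sum.cong refl) (simp add: as_def as0(2) mono_eval_add)
          moreover have "mono_eval (cox_pt z i) c \<noteq> 0"
            using i by (intro mono_eval_nonzero torus[OF z]) (simp add: m_def)
          ultimately show ?thesis using w i by simp
        qed
        then show "w k = 0" using det0 k unfolding det_nonzero_iff_kernel by blast
      qed
    qed
  qed
  show ?thesis
  proof (rule that)
    show "h \<noteq> 0" using h(1) by auto
    show "\<forall>z. peval h z \<noteq> 0 \<longrightarrow> (\<forall>j<r. \<forall>i :: 'n. cox_pt z j i \<noteq> 0)"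
      using torus by blast
    show "\<forall>z. peval h z \<noteq> 0 \<longrightarrow> (\<forall>\<alpha>\<in>Pic u.
        hilbert_fun (vanishing_ideal (cox_orbit u ` cox_pt z ` {..<r})) \<alpha> = generic_hilbert_fun r \<alpha>)"
      using hilb by blast
    show "\<forall>z. peval h z \<noteq> 0 \<longrightarrow> (\<forall>j<r. \<forall>k<r. j \<noteq> k \<longrightarrow>
        mono_eval (cox_pt z j) a * mono_eval (cox_pt z k) b \<noteq> mono_eval (cox_pt z k) a * mono_eval (cox_pt z j) b)"
      using h(2) by auto
  qed
qed


section \<open>The Zariski topology on projective space\<close>

definition tdeg :: "('x \<Rightarrow>\<^sub>0 nat) \<Rightarrow> nat" where
  "tdeg a = (\<Sum>x\<in>Poly_Mapping.keys a. Poly_Mapping.lookup a x)"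

lemma tdeg_add: "tdeg (a + b) = tdeg a + tdeg b"
proof -
  let ?S = "Poly_Mapping.keys a \<union> Poly_Mapping.keys b"
  have "tdeg c = (\<Sum>x\<in>?S. Poly_Mapping.lookup c x)" if "c \<in> {a, b, a + b}" for c
    unfolding tdeg_def using that Poly_Mapping.keys_add[of a b]
    by (intro sum.mono_neutral_left) (auto simp: in_keys_iff)
  then show ?thesis by (simp add: lookup_add sum.distrib)
qed

lemma mono_eval_scale: "mono_eval (\<lambda>i. c * y i) a = c ^ tdeg a * mono_eval y a"
  by (simp add: mono_eval_mult) (simp add: mono_eval_def tdeg_def power_sum)

lemma total_homogeneous_iff: "total_homogeneous q \<longleftrightarrow> (\<exists>d. \<forall>a\<in>Poly_Mapping.keys q. tdeg a = d)"
  by (simp add: total_homogeneous_def tdeg_def)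

lemma total_homogeneous_mult:
  assumes "total_homogeneous p" "total_homogeneous q"
  shows "total_homogeneous (p * q)"
proof -
  obtain d e where "\<And>a. a \<in> Poly_Mapping.keys p \<Longrightarrow> tdeg a = d" "\<And>a. a \<in> Poly_Mapping.keys q \<Longrightarrow> tdeg a = e"
    using assms by (auto simp: total_homogeneous_iff)
  then have "tdeg a = d + e" if "a \<in> Poly_Mapping.keys (p * q)" for a
    using that Poly_Mapping.keys_mult[of p q] by (auto simp: tdeg_add)
  then show ?thesis by (auto simp: total_homogeneous_iff)
qed

lemma total_homogeneous_1: "total_homogeneous 1"
  by (simp add: total_homogeneous_iff)

lemma peval_scale:
  assumes "total_homogeneous q"
  obtains d where "\<And>c y. peval q (\<lambda>a. c * y a) = c ^ d * peval q y"
proof -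
  obtain d where "\<And>a. a \<in> Poly_Mapping.keys q \<Longrightarrow> tdeg a = d"
    using assms by (auto simp: total_homogeneous_iff)
  then have "peval q (\<lambda>a. c * y a) = c ^ d * peval q y" for c y
    by (simp add: peval_alt mono_eval_scale sum_distrib_left mult_ac)
  then show ?thesis by (rule that)
qed

definition hcomp :: "'x cpoly \<Rightarrow> nat \<Rightarrow> 'x cpoly" where
  "hcomp q d = (\<Sum>a\<in>{a \<in> Poly_Mapping.keys q. tdeg a = d}. Poly_Mapping.single a (Poly_Mapping.lookup q a))"

lemma total_homogeneous_hcomp: "total_homogeneous (hcomp q d)"
  unfolding total_homogeneous_iff hcomp_def
  by (intro exI[of _ d]) (auto simp: in_keys_iff lookup_sum_single split: if_splits)

text \<open>The link between arbitrary and homogeneous equations: along the line through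
  \<open>y\<close>, the values of \<open>q\<close> are a univariate polynomial in the scaling
  factor, and its coefficients are the values at \<open>y\<close> of the homogeneous
  components.\<close>

lemma peval_scale_expansion:
  obtains p :: "complex poly" where "\<And>c. poly p c = peval q (\<lambda>a. c * y a)"
    "\<And>d. poly.coeff p d = peval (hcomp q d) y"
proof
  let ?p = "\<Sum>a\<in>Poly_Mapping.keys q. Polynomial.monom (Poly_Mapping.lookup q a * mono_eval y a) (tdeg a)"
  show "poly ?p c = peval q (\<lambda>a. c * y a)" for c
    by (simp add: poly_sum poly_monom peval_alt mono_eval_scale mult_ac)
  show "poly.coeff ?p d = peval (hcomp q d) y" for d
    by (simp add: coeff_sum hcomp_def sum.If_cases Int_def)
qed

lemma peval_hcomp_zero:
  assumes "\<And>c. peval q (\<lambda>a. c * y a) = 0"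
  shows "peval (hcomp q d) y = 0"
proof -
  obtain p where p: "\<And>c. poly p c = peval q (\<lambda>a. c * y a)" "\<And>d. poly.coeff p d = peval (hcomp q d) y"
    using peval_scale_expansion[of q y] by blast
  then have "p = 0" using assms poly_all_0_iff_0[of p] by simp
  then show ?thesis using p(2)[of d] by simp
qed

lemma peval_scale_zero:
  assumes "\<And>d. peval (hcomp q d) y = 0"
  shows "peval q (\<lambda>a. c * y a) = 0"
proof -
  obtain p where p: "\<And>c. poly p c = peval q (\<lambda>a. c * y a)" "\<And>d. poly.coeff p d = peval (hcomp q d) y"
    using peval_scale_expansion[of q y] by blast
  then have "p = 0" using assms by (simp add: poly_eq_iff)
  then show ?thesis using p(1)[of c] by simp
qed

lemma exists_scale_nonzero:
  assumes "peval (hcomp q d) y \<noteq> 0"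
  shows "\<exists>c. c \<noteq> 0 \<and> peval q (\<lambda>a. c * y a) \<noteq> 0"
proof -
  obtain p where p: "\<And>c. poly p c = peval q (\<lambda>a. c * y a)" "\<And>d. poly.coeff p d = peval (hcomp q d) y"
    using peval_scale_expansion[of q y] by blast
  have "p \<noteq> 0" using p(2)[of d] assms by auto
  \<comment> \<open>A non-root of the product is a non-root of \<open>p\<close> different from 0, as
    a rescaling of projective coordinates must be.\<close>
  then have "[:0, 1:] * p \<noteq> 0" by simp
  then obtain c where "poly ([:0, 1:] * p) c \<noteq> 0" using poly_all_0_iff_0 by blast
  then show ?thesis using p(1)[of c] by (intro exI[of _ c]) auto
qed

section \<open>Points and basic open sets of projective space\<close>

lemma mem_proj_point_self: "F \<in> proj_point F"
  by (auto simp: proj_point_def intro!: exI[of _ 1] simp: cscale_def)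

lemma proj_point_eqD:
  assumes "proj_point F = proj_point G"
  obtains c where "c \<noteq> 0" "F = cscale c G"
  using mem_proj_point_self[of F] unfolding assms by (auto simp: proj_point_def)

lemma proj_point_cscale:
  assumes "c \<noteq> 0"
  shows "proj_point (cscale c F) = proj_point F"
proof -
  have "cscale e F = cscale (e / c) (cscale c F)" for e using assms by simp
  then show ?thesis unfolding proj_point_def using assms
    by (auto intro: exI[of _ "_ / c"] exI[of _ "_ * c"])
qed

definition proj_nonvanishing :: "('n \<Rightarrow> int) set \<Rightarrow> ('n \<Rightarrow>\<^sub>0 nat) cpoly \<Rightarrow> 'n cpoly set set" where
  "proj_nonvanishing v q = {proj_point F |F. F \<in> graded_piece v \<and> F \<noteq> 0 \<and> peval q (Poly_Mapping.lookup F) \<noteq> 0}"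

lemma proj_zariski_alt: "proj_zariski v = topology_generated_by {proj_nonvanishing v q |q. total_homogeneous q}"
  by (simp add: proj_zariski_def proj_nonvanishing_def)

lemma lookup_cscale_fun: "Poly_Mapping.lookup (cscale c F) = (\<lambda>a. c * Poly_Mapping.lookup F a)"
  by (rule ext) simp

lemma proj_point_in_nonvanishing:
  assumes "total_homogeneous q"
  shows "proj_point F \<in> proj_nonvanishing v q \<longleftrightarrow>
    F \<in> graded_piece v \<and> F \<noteq> 0 \<and> peval q (Poly_Mapping.lookup F) \<noteq> 0"
proof
  assume "proj_point F \<in> proj_nonvanishing v q"
  then obtain G where G: "proj_point F = proj_point G" "G \<in> graded_piece v" "G \<noteq> 0" "peval q (Poly_Mapping.lookup G) \<noteq> 0"
    by (auto simp: proj_nonvanishing_def)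
  obtain c where c: "c \<noteq> 0" "F = cscale c G" using proj_point_eqD[OF G(1)] by blast
  obtain d where "\<And>c y. peval q (\<lambda>a. c * y a) = c ^ d * peval q y" using peval_scale[OF assms] by blast
  then have "peval q (Poly_Mapping.lookup F) \<noteq> 0" using c G(4) by (simp add: lookup_cscale_fun)
  then show "F \<in> graded_piece v \<and> F \<noteq> 0 \<and> peval q (Poly_Mapping.lookup F) \<noteq> 0"
    using c G(2,3) by (simp add: cp.subspace_scale[OF subspace_graded_piece])
qed (auto simp: proj_nonvanishing_def)

text \<open>Products of homogeneous polynomials are homogeneous, so the generating sets are closed
  under intersection and form a base, not merely a subbase.\<close>

lemma proj_zariski_base:
  assumes "openin (proj_zariski v) U" "x \<in> U"
  shows "\<exists>q. total_homogeneous q \<and> x \<in> proj_nonvanishing v q \<and> proj_nonvanishing v q \<subseteq> U"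
proof -
  have "generate_topology_on {proj_nonvanishing v q |q. total_homogeneous q} U"
    using assms(1) unfolding proj_zariski_alt by (rule openin_topology_generated_by)
  then show ?thesis using assms(2)
  proof (induction arbitrary: x rule: generate_topology_on.induct)
    case (Int a b)
    obtain p where p: "total_homogeneous p" "x \<in> proj_nonvanishing v p" "proj_nonvanishing v p \<subseteq> a"
      using Int.IH(1)[of x] Int.prems by blast
    obtain q where q: "total_homogeneous q" "x \<in> proj_nonvanishing v q" "proj_nonvanishing v q \<subseteq> b"
      using Int.IH(2)[of x] Int.prems by blast
    have "proj_nonvanishing v (p * q) = proj_nonvanishing v p \<inter> proj_nonvanishing v q"
    proof (intro subset_antisym subsetI)
      fix y assume "y \<in> proj_nonvanishing v p \<inter> proj_nonvanishing v q"
      moreover from this obtain F where "y = proj_point F" by (auto simp: proj_nonvanishing_def)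
      ultimately show "y \<in> proj_nonvanishing v (p * q)"
        using p(1) q(1) total_homogeneous_mult[OF p(1) q(1)] by (simp add: proj_point_in_nonvanishing)
    qed (auto simp: proj_nonvanishing_def)
    then show ?case using p q total_homogeneous_mult[OF p(1) q(1)] by (intro exI[of _ "p * q"]) auto
  next
    case (UN K)
    then show ?case by (meson Union_iff Sup_upper subset_trans)
  qed auto
qed

lemma proj_point_in_topspace:
  assumes "F \<in> graded_piece v" "F \<noteq> 0"
  shows "proj_point F \<in> topspace (proj_zariski v)"
proof -
  have "proj_point F \<in> proj_nonvanishing v 1"
    using assms by (simp add: proj_point_in_nonvanishing total_homogeneous_1)
  then show ?thesis
    unfolding proj_zariski_alt topology_generated_by_topspace using total_homogeneous_1 by blast
qed

definition poly_subst :: "'k cpoly \<Rightarrow> ('k \<Rightarrow> 'x cpoly) \<Rightarrow> 'x cpoly" where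
  "poly_subst q \<Phi> = (\<Sum>a\<in>Poly_Mapping.keys q. pconst (Poly_Mapping.lookup q a) *
     (\<Prod>i\<in>Poly_Mapping.keys a. \<Phi> i ^ Poly_Mapping.lookup a i))"

lemma peval_poly_subst: "peval (poly_subst q \<Phi>) z = peval q (\<lambda>i. peval (\<Phi> i) z)"
  by (simp add: poly_subst_def peval_def[of q])

text \<open>The positive and negative parts of the divisor of a character have the same class. For
  the character with exponent vector \<open>u i0\<close>, the coefficient at \<open>i0\<close> is a
  positive sum of squares, so the two parts differ. The pair serves to keep Cox orbits
  apart.\<close>

lemma exists_monomial_pair:
  fixes u :: "'n::finite \<Rightarrow> int^'d::finite"
  assumes "ray_generators \<Delta> u"
  obtains a b where "a \<noteq> b" "mono_class u a = mono_class u b"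
proof -
  obtain i0 :: 'n where True by blast
  define D where "D i = dual_pairing (u i0) (u i)" for i
  define a where "a = Abs_poly_mapping (\<lambda>i. nat (D i))"
  define b where "b = Abs_poly_mapping (\<lambda>i. nat (- D i))"
  have lookup: "Poly_Mapping.lookup a i = nat (D i)" "Poly_Mapping.lookup b i = nat (- D i)" for i
    by (simp_all add: a_def b_def)
  have "Gcd (range (vec_nth (u i0))) = 1" using assms by (simp add: ray_generators_def)
  then obtain k where "vec_nth (u i0) k \<noteq> 0" by (metis Gcd_0_iff image_subset_iff insertI1 zero_neq_one)
  then have "0 < vec_nth (u i0) k * vec_nth (u i0) k" by (auto simp: zero_less_mult_iff linorder_neq_iff)
  then have "D i0 > 0"
    unfolding D_def dual_pairing_def by (intro sum_pos2[of UNIV k]) auto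
  then have "a \<noteq> b" using lookup(1)[of i0] lookup(2)[of i0] by auto
  moreover have "mono_class u b = mono_class u a"
    unfolding mono_class_def div_class_eq_iff lookup
    by (intro exI[of _ "u i0"]) (simp flip: D_def)
  ultimately show ?thesis using that by metis
qed


section \<open>Secant varieties\<close>

definition secant_pt :: "('n::finite \<Rightarrow> int) set \<Rightarrow> nat \<Rightarrow> (nat \<Rightarrow> complex) \<Rightarrow> 'n cpoly" where
  "secant_pt v r z = (\<Sum>j<r. cscale (z (weight_var j)) (eval_point v (cox_pt z j)))"

definition secant_coord :: "('n::finite \<Rightarrow> int) set \<Rightarrow> nat \<Rightarrow> ('n \<Rightarrow>\<^sub>0 nat) \<Rightarrow> nat cpoly" where
  "secant_coord v r a = (if a \<in> monomials v
     then \<Sum>j<r. pvar (weight_var j) * cox_mono j a * pconst (1 / (\<Prod>i\<in>UNIV. fact (Poly_Mapping.lookup a i))) else 0)"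

lemma peval_secant_coord:
  assumes "finite (monomials v)"
  shows "peval (secant_coord v r a) z = Poly_Mapping.lookup (secant_pt v r z) a"
  by (simp add: secant_coord_def secant_pt_def lookup_sum lookup_eval_point[OF assms])

lemma eval_point_graded: "finite (monomials v) \<Longrightarrow> eval_point v \<xi> \<in> graded_piece v"
  by (auto simp: graded_piece_def in_keys_iff lookup_eval_point split: if_splits)

lemma secant_pt_graded: "finite (monomials v) \<Longrightarrow> secant_pt v r z \<in> graded_piece v"
  unfolding secant_pt_def
  by (intro cp.subspace_sum cp.subspace_scale subspace_graded_piece eval_point_graded)

lemma secant_pt_span: "secant_pt v r z \<in> cp.span (eval_point v ` cox_pt z ` {..<r})"
  unfolding secant_pt_def by (intro cp.span_sum cp.span_scale cp.span_base) auto

lemma exists_coordinates: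
  fixes \<xi> :: "nat \<Rightarrow> 'n::finite \<Rightarrow> complex"
  obtains z where "\<And>j. z (weight_var j) = c j" "\<And>j. cox_pt z j = \<xi> j"
proof
  let ?z = "\<lambda>n. case prod_decode n of (j, l) \<Rightarrow> (case l of 0 \<Rightarrow> c j | Suc l \<Rightarrow> \<xi> j (from_nat l))"
  show "?z (weight_var j) = c j" for j by (simp add: weight_var_def)
  show "cox_pt ?z j = \<xi> j" for j by (rule ext) (simp add: cox_pt_def cox_var_def)
qed

text \<open>Scaling the weights shows that the image of the parametrization is a cone, which allows
  its equations to be split into homogeneous components.\<close>

lemma secant_pt_scale:
  fixes v :: "('n::finite \<Rightarrow> int) set"
  obtains z' where "secant_pt v r z' = cscale c (secant_pt v r z)"
proof -
  obtain z' where z': "\<And>j. z' (weight_var j) = c * z (weight_var j)" "\<And>j. cox_pt z' j = (cox_pt z j :: 'n \<Rightarrow> complex)"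
    using exists_coordinates[of "\<lambda>j. c * z (weight_var j)" "cox_pt z"] by blast
  then have "secant_pt v r z' = cscale c (secant_pt v r z)"
    by (simp add: secant_pt_def cp.scale_sum_right)
  then show ?thesis by (rule that)
qed

definition secant_union ::
  "(real^'d) set set \<Rightarrow> ('n::finite \<Rightarrow> int^'d) \<Rightarrow> ('n \<Rightarrow> int) set \<Rightarrow> nat \<Rightarrow> 'n cpoly set set" where
  "secant_union \<Delta> u v r = \<Union>{proj_span P |P. P \<subseteq> embedded_variety \<Delta> u v \<and> finite P \<and> card P = r}"

text \<open>Representatives of the \<open>r\<close> points are scalar multiples of
  \<open>eval_point\<close> at Cox coordinates; the scalars are absorbed by the weights.\<close>

lemma secant_union_imp_secant_pt:
  fixes u :: "'n::finite \<Rightarrow> int^'d"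
  assumes "x \<in> secant_union \<Delta> u v r"
  obtains z where "x = proj_point (secant_pt v r z)" "secant_pt v r z \<noteq> 0"
proof -
  obtain P F where P: "P \<subseteq> embedded_variety \<Delta> u v" "finite P" "card P = r"
    and F: "F \<in> cp.span (\<Union>P)" "F \<noteq> 0" "x = proj_point F"
    using assms by (auto simp: secant_union_def proj_span_def)
  obtain p where p: "bij_betw p {..<r} P"
    using ex_bij_betw_nat_finite[OF P(2)] P(3) by (auto simp: lessThan_atLeast0)
  have "\<forall>j\<in>{..<r}. \<exists>\<xi>. p j = proj_point (eval_point v \<xi>)"
    using p P(1) by (auto simp: bij_betw_def embedded_variety_def)
  then obtain \<xi> where \<xi>: "\<forall>j\<in>{..<r}. p j = proj_point (eval_point v (\<xi> j))"
    by (rule bchoice[THEN exE])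
  let ?V = "{\<Sum>j<r. cscale (c j) (eval_point v (\<xi> j)) |c. True}"
  have "cp.subspace ?V"
    unfolding cp.subspace_def
  proof (intro conjI ballI allI)
    show "0 \<in> ?V" by (intro CollectI exI[of _ "\<lambda>_. 0"]) simp
    fix f assume "f \<in> ?V"
    then obtain c where c: "f = (\<Sum>j<r. cscale (c j) (eval_point v (\<xi> j)))" by blast
    show "cscale e f \<in> ?V" for e
      by (intro CollectI exI[of _ "\<lambda>j. e * c j"]) (simp add: c cp.scale_sum_right)
    fix g assume "g \<in> ?V"
    then obtain c' where c': "g = (\<Sum>j<r. cscale (c' j) (eval_point v (\<xi> j)))" by blast
    show "f + g \<in> ?V"
      by (intro CollectI exI[of _ "\<lambda>j. c j + c' j"]) (simp add: c c' cp.scale_left_distrib sum.distrib)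
  qed
  moreover have "\<Union>P \<subseteq> ?V"
  proof
    fix f assume "f \<in> \<Union>P"
    then obtain j where j: "j < r" "f \<in> p j" using p by (auto simp: bij_betw_def)
    then obtain e where e: "f = cscale e (eval_point v (\<xi> j))" using \<xi> by (auto simp: proj_point_def)
    have "(\<Sum>k<r. cscale (if k = j then e else 0) (eval_point v (\<xi> k)))
        = (\<Sum>k<r. if k = j then cscale e (eval_point v (\<xi> j)) else 0)"
      by (intro sum.cong) auto
    also have "\<dots> = f" using j e by simp
    finally show "f \<in> ?V" by (intro CollectI exI[of _ "\<lambda>k. if k = j then e else 0"]) simp
  qed
  ultimately have "F \<in> ?V" using F(1) cp.span_minimal by blast
  then obtain c where c: "F = (\<Sum>j<r. cscale (c j) (eval_point v (\<xi> j)))" by blast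
  obtain z where "\<And>j. z (weight_var j) = c j" "\<And>j. cox_pt z j = \<xi> j"
    using exists_coordinates[of c \<xi>] by blast
  then have "secant_pt v r z = F" by (simp add: secant_pt_def c)
  then show ?thesis using F that by blast
qed

lemma eval_point_proj_eq:
  assumes fin: "finite (monomials v)" and ab: "a \<in> monomials v" "b \<in> monomials v"
    and eq: "proj_point (eval_point v \<xi>) = proj_point (eval_point v \<eta>)"
  shows "mono_eval \<xi> a * mono_eval \<eta> b = mono_eval \<eta> a * mono_eval \<xi> b"
proof -
  obtain c where c: "eval_point v \<xi> = cscale c (eval_point v \<eta>)" using proj_point_eqD[OF eq] by blast
  have "mono_eval \<xi> e = c * mono_eval \<eta> e" if "e \<in> monomials v" for e
    using arg_cong[OF c, of "\<lambda>F. Poly_Mapping.lookup F e"] that by (simp add: lookup_eval_point[OF fin])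
  then show ?thesis using ab by simp
qed

text \<open>\<open>secant_union\<close> asks for exactly \<open>r\<close> distinct points, so
  coincidences must be excluded. If degree \<open>v\<close> has two monomials, the ratio of a
  suitable pair does this. Otherwise the projective space has at most one point, and the assumed
  member of \<open>secant_union\<close> is that point.\<close>

lemma generic_secant_pt_in_union:
  fixes u :: "'n::finite \<Rightarrow> int^'d"
  assumes fan: "is_fan \<Delta>" and fin: "finite (monomials v)" and ne: "secant_union \<Delta> u v r \<noteq> {}"
    and torus: "\<And>j i. j < r \<Longrightarrow> cox_pt z j (i :: 'n) \<noteq> 0"
    and sep: "\<And>a b. a \<in> monomials v \<Longrightarrow> b \<in> monomials v \<Longrightarrow> a \<noteq> b \<Longrightarrow>
      \<exists>a\<in>monomials v. \<exists>b\<in>monomials v. \<forall>j<r. \<forall>k<r. j \<noteq> k \<longrightarrow>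
        mono_eval (cox_pt z j) a * mono_eval (cox_pt z k) b \<noteq> mono_eval (cox_pt z k) a * mono_eval (cox_pt z j) b"
    and nz: "secant_pt v r z \<noteq> 0"
  shows "proj_point (secant_pt v r z) \<in> secant_union \<Delta> u v r"
proof (cases "\<exists>a\<in>monomials v. \<exists>b\<in>monomials v. a \<noteq> b")
  case True
  then obtain a b where ab: "a \<in> monomials v" "b \<in> monomials v"
    "\<forall>j<r. \<forall>k<r. j \<noteq> k \<longrightarrow>
        mono_eval (cox_pt z j) a * mono_eval (cox_pt z k) b \<noteq> mono_eval (cox_pt z k) a * mono_eval (cox_pt z j) b"
    using sep by blast
  let ?p = "\<lambda>j. proj_point (eval_point v (cox_pt z j))"
  have "inj_on ?p {..<r}"
  proof (rule inj_onI, rule ccontr)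
    fix j k assume "j \<in> {..<r}" "k \<in> {..<r}" "?p j = ?p k" "j \<noteq> k"
    then show False using ab(3) eval_point_proj_eq[OF fin ab(1,2)] by blast
  qed
  then have "card (?p ` {..<r}) = r" by (simp add: card_image)
  moreover have "?p ` {..<r} \<subseteq> embedded_variety \<Delta> u v"
    using torus by (auto simp: embedded_variety_def intro!: torus_point_stable[OF fan])
  moreover have "secant_pt v r z \<in> cp.span (\<Union>(?p ` {..<r}))"
  proof -
    have "eval_point v ` cox_pt z ` {..<r} \<subseteq> \<Union>(?p ` {..<r})"
      using mem_proj_point_self by fastforce
    then show ?thesis using secant_pt_span[of v r z] cp.span_mono by blast
  qed
  ultimately show ?thesis
    unfolding secant_union_def proj_span_def using nz by blast
next
  case False
  obtain x where x: "x \<in> secant_union \<Delta> u v r" using ne by blast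
  obtain w where w: "x = proj_point (secant_pt v r w)" "secant_pt v r w \<noteq> 0"
    using secant_union_imp_secant_pt[OF x] by blast
  have "\<exists>a. Poly_Mapping.lookup (secant_pt v r w) a \<noteq> 0"
    using w(2) by (metis lookup_zero poly_mapping_eqI)
  then obtain a where a: "Poly_Mapping.lookup (secant_pt v r w) a \<noteq> 0" by blast
  have graded: "Poly_Mapping.lookup (secant_pt v r y) b = 0" if "b \<notin> monomials v" for y b
    using secant_pt_graded[OF fin, of r y] that by (auto simp: graded_piece_def in_keys_iff)
  then have "a \<in> monomials v" using a by blast
  then have only: "b \<notin> monomials v" if "b \<noteq> a" for b using False that by blast
  define c where "c = Poly_Mapping.lookup (secant_pt v r z) a / Poly_Mapping.lookup (secant_pt v r w) a"
  have eq: "secant_pt v r z = cscale c (secant_pt v r w)"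
  proof (rule poly_mapping_eqI)
    fix b
    show "Poly_Mapping.lookup (secant_pt v r z) b = Poly_Mapping.lookup (cscale c (secant_pt v r w)) b"
      using a graded[OF only] by (cases "b = a") (simp_all add: c_def)
  qed
  then have "c \<noteq> 0" using nz by auto
  then show ?thesis using x w(1) by (simp add: eq proj_point_cscale)
qed

text \<open>The ratio of two monomials of equal degree is invariant under the Cox torus; the
  cross-multiplied form also covers zero values.\<close>

lemma cox_orbit_eq_mono:
  fixes u :: "'n::finite \<Rightarrow> int^'d::finite"
  assumes "cox_orbit u \<xi> = cox_orbit u \<eta>" and cls: "mono_class u a = mono_class u b"
  shows "mono_eval \<xi> a * mono_eval \<eta> b = mono_eval \<eta> a * mono_eval \<xi> b"
proof -
  have "\<xi> \<in> cox_orbit u \<xi>"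
    unfolding cox_orbit_def by (rule image_eqI[OF _ cox_torus_one]) simp
  then obtain t where t: "t \<in> cox_torus u" "\<xi> = (\<lambda>i. t i * \<eta> i)"
    unfolding assms(1) by (auto simp: cox_orbit_def)
  show ?thesis
    unfolding t(2) mono_eval_mult cox_torus_mono_eval_cong[OF t(1) cls] by simp
qed

lemma generic_vanishing_ideal_in_Sip:
  fixes u :: "'n::finite \<Rightarrow> int^'d::finite"
  assumes fan: "is_fan \<Delta>" "smooth_fan \<Delta>" "complete_fan \<Delta>" "ray_generators \<Delta> u"
    and torus: "\<And>j i. j < r \<Longrightarrow> cox_pt z j (i :: 'n) \<noteq> 0"
    and hilb: "\<And>\<alpha>. \<alpha> \<in> Pic u \<Longrightarrow>
      hilbert_fun (vanishing_ideal (cox_orbit u ` cox_pt z ` {..<r})) \<alpha> = generic_hilbert_fun r \<alpha>"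
    and cls: "mono_class u a = mono_class u b"
    and sep: "\<And>j k. j < r \<Longrightarrow> k < r \<Longrightarrow> j \<noteq> k \<Longrightarrow>
      mono_eval (cox_pt z j) a * mono_eval (cox_pt z k) b \<noteq> mono_eval (cox_pt z k) a * mono_eval (cox_pt z j) b"
  shows "vanishing_ideal (cox_orbit u ` cox_pt z ` {..<r}) \<in> Sip \<Delta> u r"
proof -
  let ?P = "cox_orbit u ` cox_pt z ` {..<r}"
  have "inj_on (\<lambda>j. cox_orbit u (cox_pt z j)) {..<r}"
  proof (rule inj_onI, rule ccontr)
    fix j k assume "j \<in> {..<r}" "k \<in> {..<r}" "cox_orbit u (cox_pt z j) = cox_orbit u (cox_pt z k)" "j \<noteq> k"
    then show False using sep cox_orbit_eq_mono[OF _ cls] by blast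
  qed
  then have "card ?P = r" by (simp add: image_image card_image)
  moreover have "?P \<subseteq> toric_variety \<Delta> u"
    using torus by (auto simp: toric_variety_def intro!: imageI torus_point_stable[OF fan(1)])
  moreover have "vanishing_ideal ?P \<in> Hilb u r"
    using vanishing_ideal_homogeneous[OF fan] hilb by (simp add: Hilb_def)
  moreover have "B_saturated \<Delta> u (vanishing_ideal ?P)"
    using torus by (intro torus_vanishing_ideal_B_saturated[OF fan(1)]) auto
  ultimately show ?thesis unfolding Sip_def by blast
qed

lemma Sip_subset_Slip:
  fixes u :: "'n::finite \<Rightarrow> int^'d::finite"
  assumes "\<And>\<alpha>. \<alpha> \<in> Pic u \<Longrightarrow> finite (monomials \<alpha>)"
  shows "Sip \<Delta> u r \<subseteq> Slip \<Delta> u r"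
  unfolding Slip_def
  using topspace_hilb_zariski[OF assms] by (intro closure_of_subset) (auto simp: Sip_def)

text \<open>The open set is cut out by a homogeneous component of the affine polynomial
  \<open>Q\<close>. A point of the closure in this set has a rescaling at which \<open>Q\<close> is
  nonzero and which still satisfies all equations of the image. The fibre statement applies to that
  rescaling, and spans are insensitive to it.\<close>

lemma secant_open_dense:
  fixes u :: "'n::finite \<Rightarrow> int^'d::finite" and v :: "('n \<Rightarrow> int) set"
  assumes fin: "finite (monomials v)" and h: "h \<noteq> 0"
    and generic: "\<And>z. peval h z \<noteq> 0 \<Longrightarrow> secant_pt v r z \<noteq> 0 \<Longrightarrow> secant_union \<Delta> u v r \<noteq> {} \<Longrightarrow>
      proj_point (secant_pt v r z) \<in> secant_union \<Delta> u v r"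
  obtains W where "open_dense_in (proj_zariski v) (secant_variety \<Delta> u v r) W"
    "\<forall>F\<in>graded_piece v. F \<noteq> 0 \<and> proj_point F \<in> W \<longrightarrow>
      (\<exists>z. peval h z \<noteq> 0 \<and> F \<in> cp.span (eval_point v ` cox_pt z ` {..<r}))"
proof -
  let ?X = "proj_zariski v" and ?U = "secant_union \<Delta> u v r"
  let ?\<Phi> = "secant_coord v r"
  have SV: "secant_variety \<Delta> u v r = ?X closure_of ?U"
    by (simp add: secant_variety_def secant_union_def)
  have coord: "(\<lambda>a. peval (?\<Phi> a) z) = Poly_Mapping.lookup (secant_pt v r z)" for z
    using peval_secant_coord[OF fin] by blast
  have "finite {a. ?\<Phi> a \<noteq> 0}"
    by (rule finite_subset[OF _ fin]) (auto simp: secant_coord_def)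
  then obtain Q where Q: "\<exists>z. peval Q (Poly_Mapping.lookup (secant_pt v r z)) \<noteq> 0"
    and Qfib: "\<And>y. (\<And>Q'. (\<And>z. peval Q' (Poly_Mapping.lookup (secant_pt v r z)) = 0) \<Longrightarrow> peval Q' y = 0) \<Longrightarrow>
      peval Q y \<noteq> 0 \<Longrightarrow> \<exists>z. peval h z \<noteq> 0 \<and> (\<forall>a. Poly_Mapping.lookup (secant_pt v r z) a = y a)"
    using image_contains_open_of_closure[of ?\<Phi> h, OF _ h] unfolding coord peval_secant_coord[OF fin] by blast
  obtain z1 where z1: "peval Q (Poly_Mapping.lookup (secant_pt v r z1)) \<noteq> 0" using Q by blast
  have "\<exists>d. peval (hcomp Q d) (Poly_Mapping.lookup (secant_pt v r z1)) \<noteq> 0"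
    using peval_scale_zero[of Q "Poly_Mapping.lookup (secant_pt v r z1)" 1] z1 by auto
  then obtain d where d: "peval (hcomp Q d) (Poly_Mapping.lookup (secant_pt v r z1)) \<noteq> 0" by blast
  define N where "N = proj_nonvanishing v (hcomp Q d)"
  define W where "W = N \<inter> secant_variety \<Delta> u v r"
  have U_top: "?U \<subseteq> topspace ?X"
  proof
    fix x assume "x \<in> ?U"
    then obtain z where "x = proj_point (secant_pt v r z)" "secant_pt v r z \<noteq> 0"
      by (rule secant_union_imp_secant_pt)
    then show "x \<in> topspace ?X" using proj_point_in_topspace[OF secant_pt_graded[OF fin]] by simp
  qed
  then have U_SV: "?U \<subseteq> secant_variety \<Delta> u v r"
    unfolding SV by (rule closure_of_subset)
  have "openin ?X N"
    unfolding N_def proj_zariski_alt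
    by (rule topology_generated_by_Basis) (use total_homogeneous_hcomp in blast)
  then have openW: "openin (subtopology ?X (secant_variety \<Delta> u v r)) W"
    unfolding W_def openin_subtopology by blast
  have dense: "secant_variety \<Delta> u v r \<subseteq> ?X closure_of W"
  proof
    fix x assume x: "x \<in> secant_variety \<Delta> u v r"
    show "x \<in> ?X closure_of W"
      unfolding in_closure_of
    proof (intro conjI allI impI)
      show "x \<in> topspace ?X" using x unfolding SV in_closure_of by blast
      fix T assume T: "x \<in> T \<and> openin ?X T"
      obtain q where q: "total_homogeneous q" "x \<in> proj_nonvanishing v q" "proj_nonvanishing v q \<subseteq> T"
        using proj_zariski_base[of v T x] T by blast
      have "openin ?X (proj_nonvanishing v q)"
        unfolding proj_zariski_alt by (rule topology_generated_by_Basis) (use q(1) in blast)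
      then obtain y where y: "y \<in> ?U" "y \<in> proj_nonvanishing v q"
        using x q(2) unfolding SV in_closure_of by blast
      obtain z0 where z0: "y = proj_point (secant_pt v r z0)" "secant_pt v r z0 \<noteq> 0"
        using secant_union_imp_secant_pt[OF y(1)] by blast
      have qz0: "peval q (Poly_Mapping.lookup (secant_pt v r z0)) \<noteq> 0"
        using y(2) unfolding z0(1) proj_point_in_nonvanishing[OF q(1)] by blast
      have "\<exists>a. Poly_Mapping.lookup (secant_pt v r z0) a \<noteq> 0"
        using z0(2) by (metis lookup_zero poly_mapping_eqI)
      then obtain a where a: "Poly_Mapping.lookup (secant_pt v r z0) a \<noteq> 0" by blast
      \<comment> \<open>The factors express in turn membership in the given neighbourhood,
        membership in \<open>N\<close>, genericity, and being a nonzero vector. Each is nonzero for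
        its own reason, possibly at different points; that they are nonzero together somewhere is
        irreducibility of the parameter space.\<close>
      define f where "f = poly_subst q ?\<Phi> * poly_subst (hcomp Q d) ?\<Phi> * h * ?\<Phi> a"
      have nonzero: "g \<noteq> 0" if "peval g z \<noteq> 0" for g :: "nat cpoly" and z using that by auto
      have "poly_subst q ?\<Phi> \<noteq> 0"
        by (rule nonzero[of _ z0]) (simp add: peval_poly_subst coord qz0)
      moreover have "poly_subst (hcomp Q d) ?\<Phi> \<noteq> 0"
        by (rule nonzero[of _ z1]) (simp add: peval_poly_subst coord d)
      moreover have "?\<Phi> a \<noteq> 0"
        by (rule nonzero[of _ z0]) (simp add: peval_secant_coord[OF fin] a)
      ultimately have "f \<noteq> 0" using h by (simp add: f_def)
      then obtain z where "peval f z \<noteq> 0" using exists_peval_nonzero by blast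
      then have z: "peval q (Poly_Mapping.lookup (secant_pt v r z)) \<noteq> 0"
        "peval (hcomp Q d) (Poly_Mapping.lookup (secant_pt v r z)) \<noteq> 0"
        "peval h z \<noteq> 0" "Poly_Mapping.lookup (secant_pt v r z) a \<noteq> 0"
        by (simp_all add: f_def peval_poly_subst coord peval_secant_coord[OF fin])
      have "secant_pt v r z \<noteq> 0" using z(4) by auto
      have "proj_point (secant_pt v r z) \<in> ?U"
        using generic[OF z(3) \<open>secant_pt v r z \<noteq> 0\<close>] y(1) by blast
      moreover have "proj_point (secant_pt v r z) \<in> N"
        using z(2) \<open>secant_pt v r z \<noteq> 0\<close> secant_pt_graded[OF fin]
        unfolding N_def proj_point_in_nonvanishing[OF total_homogeneous_hcomp] by blast
      moreover have "proj_point (secant_pt v r z) \<in> proj_nonvanishing v q"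
        using z(1) \<open>secant_pt v r z \<noteq> 0\<close> secant_pt_graded[OF fin]
        unfolding proj_point_in_nonvanishing[OF q(1)] by blast
      ultimately show "\<exists>y. y \<in> W \<and> y \<in> T" using U_SV q(3) unfolding W_def by blast
    qed
  qed
  have "subtopology ?X (secant_variety \<Delta> u v r) closure_of W = secant_variety \<Delta> u v r"
  proof -
    have "secant_variety \<Delta> u v r \<inter> W = W" unfolding W_def by blast
    then show ?thesis unfolding closure_of_subtopology using dense by auto
  qed
  with openW have OD: "open_dense_in ?X (secant_variety \<Delta> u v r) W"
    by (simp add: open_dense_in_def)
  have "\<exists>z. peval h z \<noteq> 0 \<and> F \<in> cp.span (eval_point v ` cox_pt z ` {..<r})"
    if F: "F \<in> graded_piece v" "F \<noteq> 0" "proj_point F \<in> W" for F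
  proof -
    have FN: "peval (hcomp Q d) (Poly_Mapping.lookup F) \<noteq> 0"
      using F(3) unfolding W_def N_def by (simp add: proj_point_in_nonvanishing[OF total_homogeneous_hcomp])
    obtain c where c: "c \<noteq> 0" "peval Q (\<lambda>a. c * Poly_Mapping.lookup F a) \<noteq> 0"
      using exists_scale_nonzero[OF FN] by blast
    have "peval Q' (\<lambda>a. c * Poly_Mapping.lookup F a) = 0"
      if Q': "\<And>z. peval Q' (Poly_Mapping.lookup (secant_pt v r z)) = 0" for Q'
    proof (rule peval_scale_zero)
      fix e
      \<comment> \<open>Stability of the image under scaling replaces the equation \<open>Q'\<close>
        by its homogeneous components, and only these carry over to the projective closure.\<close>
      have van: "peval (hcomp Q' e) (Poly_Mapping.lookup (secant_pt v r z)) = 0" for z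
      proof (rule peval_hcomp_zero)
        fix c
        obtain z' where "secant_pt v r z' = cscale c (secant_pt v r z)" by (rule secant_pt_scale)
        then show "peval Q' (\<lambda>a. c * Poly_Mapping.lookup (secant_pt v r z) a) = 0"
          using Q'[of z'] by (simp add: lookup_cscale_fun)
      qed
      show "peval (hcomp Q' e) (Poly_Mapping.lookup F) = 0"
      proof (rule ccontr)
        assume "peval (hcomp Q' e) (Poly_Mapping.lookup F) \<noteq> 0"
        then have "proj_point F \<in> proj_nonvanishing v (hcomp Q' e)"
          using F by (simp add: proj_point_in_nonvanishing[OF total_homogeneous_hcomp])
        moreover have "openin ?X (proj_nonvanishing v (hcomp Q' e))"
          unfolding proj_zariski_alt
          by (rule topology_generated_by_Basis) (use total_homogeneous_hcomp in blast)
        moreover have "proj_point F \<in> ?X closure_of ?U" using F(3) unfolding W_def SV by blast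
        ultimately obtain y where y: "y \<in> ?U" "y \<in> proj_nonvanishing v (hcomp Q' e)"
          unfolding in_closure_of by blast
        obtain z where "y = proj_point (secant_pt v r z)"
          using secant_union_imp_secant_pt[OF y(1)] by blast
        with y(2) van[of z] show False
          by (simp add: proj_point_in_nonvanishing[OF total_homogeneous_hcomp])
      qed
    qed
    from Qfib[OF this c(2)] obtain z where z: "peval h z \<noteq> 0"
      "\<And>a. Poly_Mapping.lookup (secant_pt v r z) a = c * Poly_Mapping.lookup F a" by blast
    have "F = cscale (1 / c) (secant_pt v r z)"
      using c(1) by (intro poly_mapping_eqI) (simp add: z(2))
    then have "F \<in> cp.span (eval_point v ` cox_pt z ` {..<r})"
      using cp.span_scale[OF secant_pt_span, of "1 / c" v r z] by simp
    then show ?thesis using z(1) by blast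
  qed
  then show ?thesis using that OD by blast
qed

theorem proposition4p10:
  fixes \<Delta> :: "(real^'d) set set"
    and u :: "'n::finite \<Rightarrow> int^'d"
    and v :: "('n \<Rightarrow> int) set"
    and r :: nat
  assumes "is_fan \<Delta>" and "smooth_fan \<Delta>" and "complete_fan \<Delta>"
    and "ray_generators \<Delta> u"
    and "ample \<Delta> u v"
    and "r > 0"
  shows "(\<exists>W_sat. open_dense_in (proj_zariski v) (secant_variety \<Delta> u v r) W_sat \<and>
            (\<forall>F\<in>graded_piece v. F \<noteq> 0 \<and> proj_point F \<in> W_sat \<longrightarrow>
               (\<exists>J\<in>VSP \<Delta> u F r. B_saturated \<Delta> u J))) \<and>
         (\<exists>W_rad. open_dense_in (proj_zariski v) (secant_variety \<Delta> u v r) W_rad \<and>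
            (\<forall>F\<in>graded_piece v. F \<noteq> 0 \<and> proj_point F \<in> W_rad \<longrightarrow>
               (\<exists>J\<in>VSP \<Delta> u F r. radical_ideal J)))"
proof -
  note fan = assms(1-4)
  have v: "v \<in> Pic u" using assms(5) by (simp add: ample_def)
  note fin = finite_monomials[OF fan]
  obtain a b where ab: "a \<noteq> b" "mono_class u a = mono_class u b"
    using exists_monomial_pair[OF assms(4)] by blast
  \<comment> \<open>The primed pair has degree \<open>v\<close> as soon as that degree has two
    monomials; otherwise \<open>a\<close> and \<open>b\<close> can stand in, so that
    \<open>generic_points\<close> applies in either case. Through \<open>h1\<close> the pair
    \<open>a\<close>, \<open>b\<close> keeps Cox orbits apart, and through \<open>h2\<close> the
    primed pair keeps points of projective space apart.\<close>
  obtain a' b' where pair: "a' \<noteq> b'"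
    "\<forall>x\<in>monomials v. \<forall>y\<in>monomials v. x \<noteq> y \<longrightarrow> a' \<in> monomials v \<and> b' \<in> monomials v"
    using ab(1) by (cases "\<exists>x\<in>monomials v. \<exists>y\<in>monomials v. x \<noteq> y") blast+
  obtain h1 where h1: "h1 \<noteq> 0" "\<forall>z. peval h1 z \<noteq> 0 \<longrightarrow> (\<forall>j<r. \<forall>i :: 'n. cox_pt z j i \<noteq> 0)"
    "\<forall>z. peval h1 z \<noteq> 0 \<longrightarrow> (\<forall>\<alpha>\<in>Pic u.
      hilbert_fun (vanishing_ideal (cox_orbit u ` cox_pt z ` {..<r})) \<alpha> = generic_hilbert_fun r \<alpha>)"
    "\<forall>z. peval h1 z \<noteq> 0 \<longrightarrow> (\<forall>j<r. \<forall>k<r. j \<noteq> k \<longrightarrow>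
      mono_eval (cox_pt z j) a * mono_eval (cox_pt z k) b \<noteq> mono_eval (cox_pt z k) a * mono_eval (cox_pt z j) b)"
    by (rule generic_points[OF fin ab(1), where r = r])
  obtain h2 where h2: "h2 \<noteq> 0" "\<forall>z. peval h2 z \<noteq> 0 \<longrightarrow> (\<forall>j<r. \<forall>k<r. j \<noteq> k \<longrightarrow>
      mono_eval (cox_pt z j) a' * mono_eval (cox_pt z k) b'
      \<noteq> mono_eval (cox_pt z k) a' * mono_eval (cox_pt z j) b')"
    by (rule generic_points[OF fin pair(1), where r = r])
  define h where "h = h1 * h2"
  have "h \<noteq> 0" using h1(1) h2(1) by (simp add: h_def)
  have hz: "peval h1 z \<noteq> 0" "peval h2 z \<noteq> 0" if "peval h z \<noteq> 0" for z
    using that by (auto simp: h_def)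
  have generic: "proj_point (secant_pt v r z) \<in> secant_union \<Delta> u v r"
    if z: "peval h z \<noteq> 0" "secant_pt v r z \<noteq> 0" "secant_union \<Delta> u v r \<noteq> {}" for z
  proof (rule generic_secant_pt_in_union[OF assms(1) fin[OF v] z(3) _ _ z(2)])
    show "cox_pt z j (i :: 'n) \<noteq> 0" if "j < r" for j i using h1(2) hz(1)[OF z(1)] that by blast
    fix a b assume "a \<in> monomials v" "b \<in> monomials v" "a \<noteq> b"
    then have "a' \<in> monomials v" "b' \<in> monomials v" using pair(2) by blast+
    then show "\<exists>a\<in>monomials v. \<exists>b\<in>monomials v. \<forall>j<r. \<forall>k<r. j \<noteq> k \<longrightarrow>
        mono_eval (cox_pt z j) a * mono_eval (cox_pt z k) b \<noteq> mono_eval (cox_pt z k) a * mono_eval (cox_pt z j) b"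
      using h2(2) hz(2)[OF z(1)] by blast
  qed
  obtain W where W: "open_dense_in (proj_zariski v) (secant_variety \<Delta> u v r) W"
    "\<forall>F\<in>graded_piece v. F \<noteq> 0 \<and> proj_point F \<in> W \<longrightarrow>
      (\<exists>z. peval h z \<noteq> 0 \<and> F \<in> cp.span (eval_point v ` cox_pt z ` {..<r}))"
    by (rule secant_open_dense[OF fin[OF v] \<open>h \<noteq> 0\<close> generic])
  have "\<exists>J\<in>VSP \<Delta> u F r. B_saturated \<Delta> u J \<and> radical_ideal J"
    if F: "F \<in> graded_piece v" "F \<noteq> 0" "proj_point F \<in> W" for F
  proof -
    obtain z where z: "peval h z \<noteq> 0" "F \<in> cp.span (eval_point v ` cox_pt z ` {..<r})"
      using W(2) F by blast
    let ?J = "vanishing_ideal (cox_orbit u ` cox_pt z ` {..<r})"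
    have "?J \<in> Sip \<Delta> u r"
      using h1(2-4) hz(1)[OF z(1)] by (intro generic_vanishing_ideal_in_Sip[OF fan _ _ ab(2)]) blast+
    moreover from this have "?J \<in> Slip \<Delta> u r" using Sip_subset_Slip[OF fin] by blast
    moreover have "?J \<subseteq> Ann F" by (rule vanishing_ideal_apolar[OF fan v z(2)])
    ultimately show ?thesis
      using vanishing_ideal_radical by (auto simp: VSP_def Sip_def)
  qed
  then show ?thesis using W(1) by blast
qed


end
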